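(* Let $p$ be an odd prime and let $k$ be a natural number such that $k \equiv 1 \pmod p$ and $k \not\equiv 1 \pmod{p^2}$. Let $F$ be a field of characteristic $p$. Then the Specht module $S^{(kp-p,1^p)}$, defined over $F$, has a Sylow $p$-subgroup of $\mathfrak{S}_{kp}$ as a vertex.
   Context: $\mathfrak{S}_n$ is the symmetric group on $\{1,\ldots,n\}$. For a partition $\lambda$ of $n$, $S^\lambda$ is the Specht module for $F\mathfrak{S}_n$ labelled by $\lambda$ as defined by James (the submodule of the permutation module on $\lambda$-tabloids spanned by the polytabloids); $(kp-p,1^p)$ is the hook partition of $kp$ with first part $kp-p$ followed by $p$ parts equal to $1$. In odd characteristic Specht modules are always indecomposable. Let $G$ be a finite group and $M$ an indecomposable $FG$-module. A subgroup $Q \le G$ is a vertex of $M$ if there is an $FQ$-module $U$ such that $M$ is a direct summand of the induced module $U\uparrow^G$, and $Q$ is minimal with this property. The vertices of $M$ form a single conjugacy class of $p$-subgroups of $G$. *)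

theory Defs
  imports
    Complex_Main
    "HOL-Algebra.Sym_Groups"
    "HOL-Number_Theory.Cong"
    "HOL-Computational_Algebra.Primes"
    "HOL-Library.Function_Algebras"
begin

section \<open>Modules for group algebras\<close>

text \<open>
  A module for the group algebra of \<open>G\<close> over the field \<open>'f\<close> is given by its underlying vector space,
  realised as a subspace \<open>carrier M\<close> of an ambient vector space \<open>('v, gscale M)\<close>, and a linear
  action \<open>gact M\<close> of \<open>G\<close> on it from the left. All modules are finite-dimensional.
\<close>

record ('f, 'g, 'v) gmod = "'v partial_object" +
  gscale :: "'f \<Rightarrow> 'v \<Rightarrow> 'v"
  gact :: "'g \<Rightarrow> 'v \<Rightarrow> 'v"

locale fg_module = G: group G + V: vector_space "gscale M"
  for G :: "'g monoid" and M :: "('f::field, 'g, 'v::ab_group_add) gmod" +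
  assumes subspace_carrier: "V.subspace (carrier M)"
    and finite_dim: "\<exists>B. finite B \<and> B \<subseteq> carrier M \<and> V.span B = carrier M"
    and act_closed: "\<lbrakk>g \<in> carrier G; v \<in> carrier M\<rbrakk> \<Longrightarrow> gact M g v \<in> carrier M"
    and act_add: "\<lbrakk>g \<in> carrier G; v \<in> carrier M; w \<in> carrier M\<rbrakk>
          \<Longrightarrow> gact M g (v + w) = gact M g v + gact M g w"
    and act_scale: "\<lbrakk>g \<in> carrier G; v \<in> carrier M\<rbrakk>
          \<Longrightarrow> gact M g (gscale M c v) = gscale M c (gact M g v)"
    and act_one: "v \<in> carrier M \<Longrightarrow> gact M \<one>\<^bsub>G\<^esub> v = v"
    and act_mult: "\<lbrakk>g \<in> carrier G; h \<in> carrier G; v \<in> carrier M\<rbrakk>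
          \<Longrightarrow> gact M (g \<otimes>\<^bsub>G\<^esub> h) v = gact M g (gact M h v)"

definition fg_submodule :: "'g monoid \<Rightarrow> ('f::field, 'g, 'v::ab_group_add) gmod \<Rightarrow> 'v set \<Rightarrow> bool"
  where "fg_submodule G M W \<longleftrightarrow>
    module.subspace (gscale M) W \<and> W \<subseteq> carrier M \<and>
    (\<forall>g\<in>carrier G. \<forall>w\<in>W. gact M g w \<in> W)"

definition fg_hom :: "'g monoid \<Rightarrow> ('f::field, 'g, 'v::ab_group_add) gmod
    \<Rightarrow> ('f, 'g, 'w::ab_group_add) gmod \<Rightarrow> ('v \<Rightarrow> 'w) set"
  where "fg_hom G M N = {h \<in> carrier M \<rightarrow> carrier N.
    (\<forall>v\<in>carrier M. \<forall>w\<in>carrier M. h (v + w) = h v + h w) \<and>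
    (\<forall>c. \<forall>v\<in>carrier M. h (gscale M c v) = gscale N c (h v)) \<and>
    (\<forall>g\<in>carrier G. \<forall>v\<in>carrier M. h (gact M g v) = gact N g (h v))}"

definition fg_isomorphic :: "'g monoid \<Rightarrow> ('f::field, 'g, 'v::ab_group_add) gmod
    \<Rightarrow> ('f, 'g, 'w::ab_group_add) gmod \<Rightarrow> bool"
  where "fg_isomorphic G M N \<longleftrightarrow> (\<exists>h\<in>fg_hom G M N. bij_betw h (carrier M) (carrier N))"

definition internal_direct_sum ::
    "'g monoid \<Rightarrow> ('f::field, 'g, 'v::ab_group_add) gmod \<Rightarrow> 'v set \<Rightarrow> 'v set \<Rightarrow> bool"
  where "internal_direct_sum G M U W \<longleftrightarrow>
    fg_submodule G M U \<and> fg_submodule G M W \<and>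
    carrier M = {u + w | u w. u \<in> U \<and> w \<in> W} \<and> U \<inter> W = {0}"

definition direct_summand :: "'g monoid \<Rightarrow> ('f::field, 'g, 'v::ab_group_add) gmod
    \<Rightarrow> ('f, 'g, 'w::ab_group_add) gmod \<Rightarrow> bool"
  where "direct_summand G M N \<longleftrightarrow>
    (\<exists>U W. internal_direct_sum G N U W \<and> fg_isomorphic G M (N\<lparr>carrier := U\<rparr>))"

definition indecomposable :: "'g monoid \<Rightarrow> ('f::field, 'g, 'v::ab_group_add) gmod \<Rightarrow> bool"
  where "indecomposable G M \<longleftrightarrow> fg_module G M \<and> carrier M \<noteq> {0} \<and>
    (\<forall>U W. internal_direct_sum G M U W \<longrightarrow> U = {0} \<or> W = {0})"


section \<open>Induced modules and vertices\<close>

text \<open>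
  The induced module \<open>FG \<otimes>\<^bsub>FQ\<^esub> U\<close>, for a subgroup \<open>Q\<close> of a finite group \<open>G\<close>. Every element is
  \<open>\<Sum>x. x \<otimes> f x\<close>, with \<open>x\<close> running over representatives of the left cosets \<open>x Q\<close>, for exactly one
  function \<open>f\<close> as below: the condition on \<open>f\<close> says \<open>x q \<otimes> f (x q) = x \<otimes> f x\<close>, so that the sum does
  not depend on the representatives. The universal property is proved as \<open>induced_universal\<close>.
\<close>

definition induced :: "'g monoid \<Rightarrow> 'g set \<Rightarrow> ('f::field, 'g, 'v::ab_group_add) gmod
    \<Rightarrow> ('f, 'g, 'g \<Rightarrow> 'v) gmod"
  where "induced G Q U = \<lparr>
    carrier = {f. (\<forall>x\<in>carrier G. f x \<in> carrier U) \<and> (\<forall>x. x \<notin> carrier G \<longrightarrow> f x = 0) \<and>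
      (\<forall>x\<in>carrier G. \<forall>q\<in>Q. f (x \<otimes>\<^bsub>G\<^esub> q) = gact U (inv\<^bsub>G\<^esub> q) (f x))},
    gscale = (\<lambda>c f x. gscale U c (f x)),
    gact = (\<lambda>g f x. if x \<in> carrier G then f (inv\<^bsub>G\<^esub> g \<otimes>\<^bsub>G\<^esub> x) else 0)\<rparr>"

text \<open>
  HOL does not quantify over types inside a formula, so the module \<open>U\<close> is sought in the fixed
  ambient space \<open>nat \<Rightarrow> 'f\<close>; \<open>fg_module_isomorphic_copy\<close> shows that every finite-dimensional module
  has an isomorphic copy there.
\<close>

definition summand_of_induced ::
    "'g monoid \<Rightarrow> 'g set \<Rightarrow> ('f::field, 'g, 'v::ab_group_add) gmod \<Rightarrow> bool"
  where "summand_of_induced G Q M \<longleftrightarrow>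
    (\<exists>U :: ('f, 'g, nat \<Rightarrow> 'f) gmod.
      fg_module (G\<lparr>carrier := Q\<rparr>) U \<and> direct_summand G M (induced G Q U))"

definition is_vertex :: "'g monoid \<Rightarrow> ('f::field, 'g, 'v::ab_group_add) gmod \<Rightarrow> 'g set \<Rightarrow> bool"
  where "is_vertex G M Q \<longleftrightarrow> indecomposable G M \<and>
    subgroup Q G \<and> summand_of_induced G Q M \<and>
    (\<forall>R. subgroup R G \<and> R \<subset> Q \<longrightarrow> \<not> summand_of_induced G R M)"

definition sylow_subgroup :: "nat \<Rightarrow> 'g monoid \<Rightarrow> 'g set \<Rightarrow> bool"
  where "sylow_subgroup p G P \<longleftrightarrow> subgroup P G \<and> card P = p ^ multiplicity p (order G)"


section \<open>Specht modules\<close>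

text \<open>
  Rows and columns of the Young diagram are counted from 0. A tableau is set to 0 outside the
  diagram; as permutations of \<open>{1..n}\<close> fix 0, they act on tableaux by composition.
  James lets permutations act from the right; here they act from the left.
\<close>

type_synonym tableau = "nat \<times> nat \<Rightarrow> nat"
type_synonym tabloid = "tableau set"

definition diagram :: "nat list \<Rightarrow> (nat \<times> nat) set"
  where "diagram l = {(i, j). i < length l \<and> j < l ! i}"

definition tableaux :: "nat list \<Rightarrow> tableau set"
  where "tableaux l = {t. bij_betw t (diagram l) {1..sum_list l} \<and> (\<forall>x. x \<notin> diagram l \<longrightarrow> t x = 0)}"

definition row_stabilizer :: "nat list \<Rightarrow> tableau \<Rightarrow> (nat \<Rightarrow> nat) set"
  where "row_stabilizer l t = {s \<in> carrier (sym_group (sum_list l)).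
    \<forall>i. s ` (t ` {x \<in> diagram l. fst x = i}) = t ` {x \<in> diagram l. fst x = i}}"

definition column_stabilizer :: "nat list \<Rightarrow> tableau \<Rightarrow> (nat \<Rightarrow> nat) set"
  where "column_stabilizer l t = {s \<in> carrier (sym_group (sum_list l)).
    \<forall>j. s ` (t ` {x \<in> diagram l. snd x = j}) = t ` {x \<in> diagram l. snd x = j}}"

definition tabloid_of :: "nat list \<Rightarrow> tableau \<Rightarrow> tabloid"
  where "tabloid_of l t = {s \<circ> t | s. s \<in> row_stabilizer l t}"

definition tabloids :: "nat list \<Rightarrow> tabloid set"
  where "tabloids l = tabloid_of l ` tableaux l"

definition basis_vec :: "'x \<Rightarrow> 'x \<Rightarrow> 'f::field"
  where "basis_vec x = (\<lambda>y. if y = x then 1 else 0)"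

text \<open>
  The permutation module on \<open>l\<close>-tabloids: formal linear combinations of tabloids, with the
  linear extension of the action \<open>s {t} = {s t}\<close>.
\<close>

definition tabloid_module :: "nat list \<Rightarrow> ('f::field, nat \<Rightarrow> nat, tabloid \<Rightarrow> 'f) gmod"
  where "tabloid_module l = \<lparr>
    carrier = {v. \<forall>T. T \<notin> tabloids l \<longrightarrow> v T = 0},
    gscale = (\<lambda>c v T. c * v T),
    gact = (\<lambda>s v. \<Sum>T\<in>tabloids l. (\<lambda>T'. v T * basis_vec ((\<circ>) s ` T) T'))\<rparr>"

definition polytabloid :: "nat list \<Rightarrow> tableau \<Rightarrow> tabloid \<Rightarrow> 'f::field"
  where "polytabloid l t =
    (\<Sum>s\<in>column_stabilizer l t. (\<lambda>T. of_int (sign s) * basis_vec ((\<circ>) s ` tabloid_of l t) T))"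

definition specht_module :: "nat list \<Rightarrow> ('f::field, nat \<Rightarrow> nat, tabloid \<Rightarrow> 'f) gmod"
  where "specht_module l = (tabloid_module l)\<lparr>carrier :=
    module.span (gscale (tabloid_module l)) (polytabloid l ` tableaux l)\<rparr>"


section \<open>Existence of isomorphic copies\<close>

lemma vector_space_pointwise:
  assumes "vector_space (s :: 'f::field \<Rightarrow> 'v::ab_group_add \<Rightarrow> 'v)"
  shows "vector_space (\<lambda>c (f :: 'x \<Rightarrow> 'v) x. s c (f x))"
proof -
  interpret vector_space s by fact
  show ?thesis
    by unfold_locales (auto simp: fun_eq_iff scale_right_distrib scale_left_distrib)
qed

lemma vector_space_fun: "vector_space (\<lambda>c (f :: 'x \<Rightarrow> 'f::field) x. c * f x)"
  by unfold_locales (auto simp: fun_eq_iff algebra_simps)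

lemma sum_fun_apply: "(\<Sum>a\<in>A. f a) x = (\<Sum>a\<in>A. f a x :: 'b::ab_group_add)"
  by (induction A rule: infinite_finite_induct) auto

lemma (in vector_space) subspace_of_finite_span:
  assumes "subspace W" "finite T" "W \<subseteq> span T"
  shows "\<exists>B. finite B \<and> B \<subseteq> W \<and> independent B \<and> span B = W"
proof -
  obtain B where B: "B \<subseteq> W" "independent B" "W \<subseteq> span B"
    using maximal_independent_subset[of W] by blast
  have "finite B" using independent_span_bound[OF assms(2) B(2)] B(1) assms(3) by auto
  moreover have "span B \<subseteq> W" using B(1) assms(1) by (rule span_minimal)
  ultimately show ?thesis using B by blast
qed

lemma (in fg_module) act_sum:
  assumes "g \<in> carrier G" "\<And>a. a \<in> A \<Longrightarrow> f a \<in> carrier M"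
  shows "gact M g (\<Sum>a\<in>A. f a) = (\<Sum>a\<in>A. gact M g (f a))"
proof -
  have z: "gact M g 0 = 0"
    using act_add[OF assms(1), of 0 0] subspace_carrier by (auto simp: V.subspace_0)
  show ?thesis using assms(2)
  proof (induction A rule: infinite_finite_induct)
    case (insert a A)
    have "sum f A \<in> carrier M"
      using insert by (intro V.subspace_sum[OF subspace_carrier]) auto
    with insert assms(1) show ?case by (simp add: act_add)
  qed (auto simp: z)
qed

lemma fg_module_isomorphic_copy:
  assumes "fg_module G (M :: ('f::field, 'g, 'v::ab_group_add) gmod)"
  shows "\<exists>U :: ('f, 'g, nat \<Rightarrow> 'f) gmod. fg_module G U \<and> fg_isomorphic G M U"
proof -
  interpret fg_module G M by fact
  interpret N: vector_space "\<lambda>c (f :: nat \<Rightarrow> 'f) x. c * f x" by (rule vector_space_fun)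
  obtain B where B: "finite B" "B \<subseteq> carrier M" "V.independent B" "V.span B = carrier M"
    using finite_dim V.subspace_of_finite_span[OF subspace_carrier] by (metis order_refl)
  obtain e where e: "bij_betw e {..<card B} B"
    using ex_bij_betw_nat_finite[OF B(1)] by (auto simp: atLeast0LessThan)
  define W where "W = {f :: nat \<Rightarrow> 'f. \<forall>i\<ge>card B. f i = 0}"
  define \<phi> where "\<phi> f = (\<Sum>i<card B. gscale M (f i) (e i))" for f
  define \<psi> where "\<psi> v = (\<lambda>i. if i < card B then V.representation B v (e i) else 0)" for v
  have eB: "e i \<in> B" if "i < card B" for i using e that by (auto simp: bij_betw_def)
  have \<phi>c: "\<phi> f \<in> carrier M" for f
    unfolding \<phi>_def B(4)[symmetric] by (intro V.span_sum V.span_scale V.span_base eB) auto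
  have \<psi>W: "\<psi> v \<in> W" for v by (auto simp: \<psi>_def W_def)
  have \<phi>\<psi>: "\<phi> (\<psi> v) = v" if "v \<in> carrier M" for v
  proof -
    have "\<phi> (\<psi> v) = (\<Sum>i<card B. gscale M (V.representation B v (e i)) (e i))"
      by (simp add: \<phi>_def \<psi>_def)
    also have "\<dots> = (\<Sum>b\<in>B. gscale M (V.representation B v b) b)"
      by (rule sum.reindex_bij_betw[OF e])
    also have "\<dots> = v"
      using V.sum_representation_eq[OF B(3) _ B(1)] that B(4) by auto
    finally show ?thesis .
  qed
  have \<psi>add: "\<psi> (v + w) = \<psi> v + \<psi> w" if "v \<in> carrier M" "w \<in> carrier M" for v w
    using that B by (auto simp: \<psi>_def fun_eq_iff V.representation_add)
  have \<psi>sc: "\<psi> (gscale M c v) = (\<lambda>i. c * \<psi> v i)" if "v \<in> carrier M" for v c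
    using that B by (auto simp: \<psi>_def fun_eq_iff V.representation_scale)
  have \<psi>\<phi>: "\<psi> (\<phi> f) = f" if "f \<in> W" for f
  proof
    fix i
    show "\<psi> (\<phi> f) i = f i"
    proof (cases "i < card B")
      case False
      then show ?thesis using that by (auto simp: \<psi>_def W_def)
    next
      case True
      have r: "V.representation B (\<phi> f) b = f (the_inv_into {..<card B} e b)" if "b \<in> B" for b
      proof -
        have inj: "inj_on e {..<card B}" using e by (auto simp: bij_betw_def)
        have "V.representation B (\<phi> f) b = (\<Sum>j<card B. V.representation B (gscale M (f j) (e j)) b)"
          unfolding \<phi>_def using B(3) eB
          by (subst V.representation_sum) (auto intro: V.span_scale V.span_base)
        also have "\<dots> = (\<Sum>j<card B. if e j = b then f j else 0)"
          using B(3) eB by (intro sum.cong refl)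
            (auto simp: V.representation_scale V.span_base V.representation_basis)
        also have "\<dots> = (\<Sum>j<card B. if j = the_inv_into {..<card B} e b then f j else 0)"
          using e that inj by (intro sum.cong refl if_cong)
            (auto simp: the_inv_into_f_f bij_betw_def f_the_inv_into_f)
        also have "\<dots> = f (the_inv_into {..<card B} e b)"
          using e that inj the_inv_into_into[OF inj, of b "{..<card B}"]
          by (auto simp: bij_betw_def)
        finally show ?thesis .
      qed
      have "the_inv_into {..<card B} e (e i) = i"
        using e True by (intro the_inv_into_f_f) (auto simp: bij_betw_def)
      then show ?thesis using r[OF eB[OF True]] True by (simp add: \<psi>_def)
    qed
  qed
  have \<phi>add: "\<phi> (f + f') = \<phi> f + \<phi> f'" for f f'
    by (simp add: \<phi>_def V.scale_left_distrib sum.distrib)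
  have \<phi>sc: "\<phi> (\<lambda>i. c * f i) = gscale M c (\<phi> f)" for c f
    by (simp add: \<phi>_def V.scale_sum_right)
  define U where "U = \<lparr>carrier = W, gscale = (\<lambda>c f x. c * f x),
     gact = (\<lambda>g f. \<psi> (gact M g (\<phi> f)))\<rparr>"
  have subW: "N.subspace W" unfolding N.subspace_def by (auto simp: W_def)
  have "fg_module G U"
  proof (intro fg_module.intro fg_module_axioms.intro)
    have "W \<subseteq> N.span (basis_vec ` {..<card B})"
    proof
      fix f assume f: "f \<in> W"
      have "f = (\<Sum>i<card B. (\<lambda>x. f i * basis_vec i x))"
        using f by (auto simp: fun_eq_iff sum_fun_apply basis_vec_def W_def if_distrib cong: if_cong)
      also have "\<dots> \<in> N.span (basis_vec ` {..<card B})"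
        by (intro N.span_sum N.span_scale N.span_base) auto
      finally show "f \<in> N.span (basis_vec ` {..<card B})" .
    qed
    then show "\<exists>B. finite B \<and> B \<subseteq> carrier U \<and> module.span (gscale U) B = carrier U"
      using N.subspace_of_finite_span[OF subW, of "basis_vec ` {..<card B}"]
      by (auto simp: U_def)
  qed (auto simp: U_def vector_space_fun subW \<psi>W \<phi>add act_add \<psi>add act_closed \<phi>c \<phi>sc act_scale
        \<psi>sc act_one \<psi>\<phi> act_mult \<phi>\<psi> intro: G.is_group)
  moreover have "fg_isomorphic G M U"
    unfolding fg_isomorphic_def
  proof (intro bexI)
    show "bij_betw \<psi> (carrier M) (carrier U)"
      by (intro bij_betw_byWitness[of _ \<phi>]) (auto simp: U_def \<phi>\<psi> \<psi>\<phi> \<psi>W \<phi>c)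
    show "\<psi> \<in> fg_hom G M U"
      by (auto simp: fg_hom_def U_def \<psi>W \<psi>add \<psi>sc \<phi>\<psi>)
  qed
  ultimately show ?thesis by blast
qed


section \<open>The universal property of induction\<close>

lemma induced_fg_module:
  assumes "group G" "finite (carrier G)" "subgroup Q G"
    and U: "fg_module (G\<lparr>carrier := Q\<rparr>) (U :: ('f::field, 'g, 'v::ab_group_add) gmod)"
  shows "fg_module G (induced G Q U)"
proof -
  interpret G: group G by fact
  interpret Q: subgroup Q G by fact
  interpret U: fg_module "G\<lparr>carrier := Q\<rparr>" U by fact
  let ?s = "\<lambda>c (f :: 'g \<Rightarrow> 'v) x. gscale U c (f x)"
  interpret N: vector_space ?s
    by (rule vector_space_pointwise) (rule U.V.vector_space_axioms)
  let ?I = "carrier (induced G Q U)"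
  have sub: "N.subspace ?I"
    unfolding N.subspace_def using U.subspace_carrier U.act_add[of _ 0 0]
    by (auto simp: induced_def U.V.subspace_def U.act_add U.act_scale)
  obtain B where B: "finite B" "B \<subseteq> carrier U" "U.V.span B = carrier U"
    using U.finite_dim by blast
  define d where "d x b = (\<lambda>y. if y = x then b else (0::'v))" for x :: 'g and b
  define T where "T = (\<lambda>(x, b). d x b) ` (carrier G \<times> B)"
  have d_span: "d x u \<in> N.span T" if x: "x \<in> carrier G" and u: "u \<in> carrier U" for x u
  proof -
    obtain t r where tr: "u = (\<Sum>b\<in>t. gscale U (r b) b)" "finite t" "t \<subseteq> B"
      using u unfolding B(3)[symmetric] U.V.span_explicit by blast
    have "d x u = (\<Sum>b\<in>t. ?s (r b) (d x b))"
      by (auto simp: fun_eq_iff sum_fun_apply d_def tr(1) U.V.scale_zero_right intro!: sum.cong)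
    also have "\<dots> \<in> N.span T"
      using tr(3) x by (intro N.span_sum N.span_scale N.span_base) (auto simp: T_def)
    finally show ?thesis .
  qed
  have "?I \<subseteq> N.span T"
  proof
    fix f assume f: "f \<in> ?I"
    have "f = (\<Sum>x\<in>carrier G. d x (f x))"
    proof
      fix y
      have "(\<Sum>x\<in>carrier G. d x (f x)) y = (\<Sum>x\<in>carrier G. if x = y then f x else 0)"
        unfolding sum_fun_apply d_def by (intro sum.cong) auto
      then show "f y = (\<Sum>x\<in>carrier G. d x (f x)) y"
        using f assms(2) by (auto simp: induced_def)
    qed
    also have "\<dots> \<in> N.span T"
      using f by (intro N.span_sum d_span) (auto simp: induced_def)
    finally show "f \<in> N.span T" .
  qed
  then have fin: "\<exists>B. finite B \<and> B \<subseteq> ?I \<and> N.span B = ?I"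
    using N.subspace_of_finite_span[OF sub, of T] B(1) assms(2) by (auto simp: T_def)
  have s: "gscale (induced G Q U) = ?s" by (simp add: induced_def)
  show ?thesis
  proof (intro fg_module.intro fg_module_axioms.intro)
    fix g h f assume *: "g \<in> carrier G" "h \<in> carrier G" "f \<in> ?I"
    show "gact (induced G Q U) (g \<otimes>\<^bsub>G\<^esub> h) f = gact (induced G Q U) g (gact (induced G Q U) h f)"
      using * by (auto simp: induced_def fun_eq_iff G.inv_mult_group G.m_assoc)
  next
    fix g f assume *: "g \<in> carrier G" "f \<in> ?I"
    show "gact (induced G Q U) g f \<in> ?I"
      using * Q.subset by (auto simp: induced_def G.m_assoc[symmetric] subset_iff)
  next
    fix f assume "f \<in> ?I"
    then show "gact (induced G Q U) \<one>\<^bsub>G\<^esub> f = f"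
      by (auto simp: induced_def fun_eq_iff)
  qed (use sub fin N.vector_space_axioms s in \<open>auto simp: induced_def fun_eq_iff U.V.scale_zero_right intro: assms(1)\<close>)
qed

text \<open>The map \<open>u \<mapsto> 1 \<otimes> u\<close>.\<close>

definition induced_inj :: "'g monoid \<Rightarrow> 'g set \<Rightarrow> ('f::field, 'g, 'v::ab_group_add) gmod \<Rightarrow> 'v \<Rightarrow> 'g \<Rightarrow> 'v"
  where "induced_inj G Q U u = (\<lambda>x. if x \<in> Q then gact U (inv\<^bsub>G\<^esub> x) u else 0)"

lemma induced_universal:
  assumes "group G" "finite (carrier G)" "subgroup Q G"
    and U: "fg_module (G\<lparr>carrier := Q\<rparr>) (U :: ('f::field, 'g, 'v::ab_group_add) gmod)"
    and M: "fg_module G (M :: ('f, 'g, 'w::ab_group_add) gmod)"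
    and h: "h \<in> fg_hom (G\<lparr>carrier := Q\<rparr>) U M"
  shows "induced_inj G Q U \<in> fg_hom (G\<lparr>carrier := Q\<rparr>) U (induced G Q U)"
    and "\<exists>H\<in>fg_hom G (induced G Q U) M. (\<forall>u\<in>carrier U. H (induced_inj G Q U u) = h u) \<and>
      (\<forall>H'\<in>fg_hom G (induced G Q U) M. (\<forall>u\<in>carrier U. H' (induced_inj G Q U u) = h u) \<longrightarrow>
        (\<forall>f\<in>carrier (induced G Q U). H' f = H f))"
proof -
  interpret G: group G by fact
  interpret Q: subgroup Q G by fact
  interpret U: fg_module "G\<lparr>carrier := Q\<rparr>" U by fact
  interpret M: fg_module G M by fact
  let ?I = "induced G Q U" and ?\<iota> = "induced_inj G Q U"
  interpret I: fg_module G ?I by (rule induced_fg_module) fact+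
  have QG: "q \<in> carrier G" if "q \<in> Q" for q using that Q.subset by auto
  have [simp]: "gact U g 0 = 0" if "g \<in> Q" for g
    using U.act_add[of g 0 0] that U.subspace_carrier by (auto simp: U.V.subspace_def)
  have U0[simp]: "0 \<in> carrier U" using U.subspace_carrier by (auto simp: U.V.subspace_def)
  have Uadd: "u + v \<in> carrier U" if "u \<in> carrier U" "v \<in> carrier U" for u v
    using that U.subspace_carrier by (auto simp: U.V.subspace_def)
  have Usc: "gscale U c u \<in> carrier U" if "u \<in> carrier U" for u c
    using that U.subspace_carrier by (auto simp: U.V.subspace_def)
  have Uact: "gact U q u \<in> carrier U" if "u \<in> carrier U" "q \<in> Q" for q u
    using that U.act_closed by auto
  have Umult: "gact U (q \<otimes>\<^bsub>G\<^esub> r) u = gact U q (gact U r u)" if "u \<in> carrier U" "q \<in> Q" "r \<in> Q" for q r u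
    using that U.act_mult by auto
  have xq: "x \<otimes>\<^bsub>G\<^esub> q \<in> Q \<longleftrightarrow> x \<in> Q" if "x \<in> carrier G" "q \<in> Q" for x q
    using that G.inv_solve_right'[of x] Q.m_closed Q.m_inv_closed
    by (metis G.inv_closed G.m_assoc G.r_inv G.r_one QG)
  have qx: "q \<otimes>\<^bsub>G\<^esub> x \<in> Q \<longleftrightarrow> x \<in> Q" if "x \<in> carrier G" "q \<in> Q" for x q
    using that Q.m_closed Q.m_inv_closed
    by (metis G.inv_closed G.m_assoc G.l_inv G.l_one QG)
  have \<iota>c: "?\<iota> u \<in> carrier ?I" if u: "u \<in> carrier U" for u
    using that QG by (auto simp: induced_inj_def induced_def xq Uact G.inv_mult_group Umult)
  show \<iota>: "?\<iota> \<in> fg_hom (G\<lparr>carrier := Q\<rparr>) U ?I"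
    unfolding fg_hom_def
  proof (intro CollectI conjI ballI allI Pi_I \<iota>c)
    fix q u assume "q \<in> carrier (G\<lparr>carrier := Q\<rparr>)" "u \<in> carrier U"
    then show "?\<iota> (gact U q u) = gact ?I q (?\<iota> u)"
      using QG by (auto simp: induced_inj_def induced_def fun_eq_iff qx G.inv_mult_group Umult)
  qed (auto simp: induced_inj_def induced_def fun_eq_iff U.act_add U.act_scale U.V.scale_zero_right)
  have hc: "h u \<in> carrier M" if "u \<in> carrier U" for u
    using h that by (auto simp: fg_hom_def)
  have hact: "h (gact U q u) = gact M q (h u)" if "u \<in> carrier U" "q \<in> Q" for q u
    using h that by (auto simp: fg_hom_def)
  define r where "r x = (SOME y. y \<in> x <#\<^bsub>G\<^esub> Q)" for x
  define T where "T = r ` carrier G"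
  have r_ex: "\<exists>q\<in>Q. r x = x \<otimes>\<^bsub>G\<^esub> q" if "x \<in> carrier G" for x
  proof -
    have "x \<in> x <#\<^bsub>G\<^esub> Q"
      using that Q.one_closed by (force simp: l_coset_def)
    then have "r x \<in> x <#\<^bsub>G\<^esub> Q" unfolding r_def by (rule someI)
    then show ?thesis by (auto simp: l_coset_def)
  qed
  have rG: "r x \<in> carrier G" if "x \<in> carrier G" for x using r_ex[OF that] that QG by auto
  have TG: "T \<subseteq> carrier G" using rG by (auto simp: T_def)
  have r_coset: "r (x \<otimes>\<^bsub>G\<^esub> q) = r x" if "x \<in> carrier G" "q \<in> Q" for x q
  proof -
    have "\<exists>q''\<in>Q. x \<otimes>\<^bsub>G\<^esub> q' = x \<otimes>\<^bsub>G\<^esub> q \<otimes>\<^bsub>G\<^esub> q''" if "q' \<in> Q" for q'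
      using that \<open>x \<in> carrier G\<close> \<open>q \<in> Q\<close> QG
      by (intro bexI[of _ "inv\<^bsub>G\<^esub> q \<otimes>\<^bsub>G\<^esub> q'"])
        (auto simp: G.m_assoc, simp add: G.m_assoc[symmetric])
    then have "(x \<otimes>\<^bsub>G\<^esub> q) <#\<^bsub>G\<^esub> Q = x <#\<^bsub>G\<^esub> Q"
      using that QG by (auto simp: l_coset_def G.m_assoc)
    then show ?thesis by (simp add: r_def)
  qed
  have r_left: "r (x \<otimes>\<^bsub>G\<^esub> r y) = r (x \<otimes>\<^bsub>G\<^esub> y)" if "x \<in> carrier G" "y \<in> carrier G" for x y
  proof -
    obtain q where "q \<in> Q" "r y = y \<otimes>\<^bsub>G\<^esub> q" using r_ex[OF \<open>y \<in> carrier G\<close>] by blast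
    then show ?thesis using that QG r_coset[of "x \<otimes>\<^bsub>G\<^esub> y" q] by (simp add: G.m_assoc)
  qed
  have rT: "r t = t" if "t \<in> T" for t
  proof -
    obtain y where y: "y \<in> carrier G" "t = r y" using \<open>t \<in> T\<close> by (auto simp: T_def)
    show ?thesis using r_left[OF G.one_closed y(1)] y rG by simp
  qed
  have finT: "finite T" using assms(2) by (simp add: T_def)
  define F where "F f x = gact M x (h (f x))" for f x
  have fc: "f x \<in> carrier U" if "f \<in> carrier ?I" "x \<in> carrier G" for f x
    using that by (auto simp: induced_def)
  have Fc: "F f x \<in> carrier M" if "f \<in> carrier ?I" "x \<in> carrier G" for f x
    using that by (auto simp: F_def intro!: M.act_closed hc fc)
  have Fq: "F f (x \<otimes>\<^bsub>G\<^esub> q) = F f x" if "f \<in> carrier ?I" "x \<in> carrier G" "q \<in> Q" for f x q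
  proof -
    have "f (x \<otimes>\<^bsub>G\<^esub> q) = gact U (inv\<^bsub>G\<^esub> q) (f x)" using that by (auto simp: induced_def)
    then have "F f (x \<otimes>\<^bsub>G\<^esub> q) = gact M (x \<otimes>\<^bsub>G\<^esub> q) (gact M (inv\<^bsub>G\<^esub> q) (h (f x)))"
      using that by (simp add: F_def hact fc)
    also have "\<dots> = gact M (x \<otimes>\<^bsub>G\<^esub> q \<otimes>\<^bsub>G\<^esub> inv\<^bsub>G\<^esub> q) (h (f x))"
      using that QG by (intro M.act_mult[symmetric]) (auto intro: hc fc)
    also have "\<dots> = F f x" using that QG by (simp add: F_def G.m_assoc)
    finally show ?thesis .
  qed
  define H where "H f = (\<Sum>t\<in>T. F f t)" for f
  have T_shift: "(\<Sum>t\<in>T. F f (inv\<^bsub>G\<^esub> g \<otimes>\<^bsub>G\<^esub> t)) = H f" if g: "g \<in> carrier G" and f: "f \<in> carrier ?I" for f g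
  proof -
    have inv: "r (b \<otimes>\<^bsub>G\<^esub> r (a \<otimes>\<^bsub>G\<^esub> t)) = t"
      if "a \<in> carrier G" "b \<in> carrier G" "b \<otimes>\<^bsub>G\<^esub> a = \<one>\<^bsub>G\<^esub>" "t \<in> T" for a b t
    proof -
      have t: "t \<in> carrier G" using that TG by auto
      have "r (b \<otimes>\<^bsub>G\<^esub> r (a \<otimes>\<^bsub>G\<^esub> t)) = r (b \<otimes>\<^bsub>G\<^esub> (a \<otimes>\<^bsub>G\<^esub> t))"
        using that t by (intro r_left) auto
      also have "b \<otimes>\<^bsub>G\<^esub> (a \<otimes>\<^bsub>G\<^esub> t) = t"
        using that t by (metis G.m_assoc G.l_one)
      finally show ?thesis using rT that by simp
    qed
    have bij: "bij_betw (\<lambda>t. r (inv\<^bsub>G\<^esub> g \<otimes>\<^bsub>G\<^esub> t)) T T"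
    proof (rule bij_betw_byWitness[of _ "\<lambda>t. r (g \<otimes>\<^bsub>G\<^esub> t)"])
      have "r (a \<otimes>\<^bsub>G\<^esub> t) \<in> T" if "a \<in> carrier G" "t \<in> T" for a t
        using that TG unfolding T_def by (intro imageI G.m_closed) auto
      then show "(\<lambda>t. r (inv\<^bsub>G\<^esub> g \<otimes>\<^bsub>G\<^esub> t)) ` T \<subseteq> T" "(\<lambda>t. r (g \<otimes>\<^bsub>G\<^esub> t)) ` T \<subseteq> T"
        using g by auto
    qed (use g in \<open>auto intro!: inv\<close>)
    have "F f (inv\<^bsub>G\<^esub> g \<otimes>\<^bsub>G\<^esub> t) = F f (r (inv\<^bsub>G\<^esub> g \<otimes>\<^bsub>G\<^esub> t))" if "t \<in> T" for t
    proof -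
      have c: "inv\<^bsub>G\<^esub> g \<otimes>\<^bsub>G\<^esub> t \<in> carrier G" using g that TG by auto
      then obtain q where "q \<in> Q" "r (inv\<^bsub>G\<^esub> g \<otimes>\<^bsub>G\<^esub> t) = inv\<^bsub>G\<^esub> g \<otimes>\<^bsub>G\<^esub> t \<otimes>\<^bsub>G\<^esub> q" using r_ex by blast
      then show ?thesis using Fq[OF f c] by simp
    qed
    then have "(\<Sum>t\<in>T. F f (inv\<^bsub>G\<^esub> g \<otimes>\<^bsub>G\<^esub> t)) = (\<Sum>t\<in>T. F f (r (inv\<^bsub>G\<^esub> g \<otimes>\<^bsub>G\<^esub> t)))"
      by (rule sum.cong[OF refl])
    also have "\<dots> = H f" unfolding H_def by (rule sum.reindex_bij_betw[OF bij])
    finally show ?thesis .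
  qed
  have H: "H \<in> fg_hom G ?I M"
    unfolding fg_hom_def
  proof (intro CollectI conjI ballI allI Pi_I)
    show "H f \<in> carrier M" if "f \<in> carrier ?I" for f
      unfolding H_def using that TG Fc by (intro M.V.subspace_sum[OF M.subspace_carrier]) auto
    show "H (f + f') = H f + H f'" if "f \<in> carrier ?I" "f' \<in> carrier ?I" for f f'
    proof -
      have "F (f + f') t = F f t + F f' t" if "t \<in> T" for t
      proof -
        have "t \<in> carrier G" using that TG by auto
        then show ?thesis
          using fc \<open>f \<in> carrier ?I\<close> \<open>f' \<in> carrier ?I\<close> h hc
          by (simp add: F_def fg_hom_def M.act_add)
      qed
      then show ?thesis by (simp add: H_def sum.distrib)
    qed
    show "H (gscale ?I c f) = gscale M c (H f)" if "f \<in> carrier ?I" for c f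
    proof -
      have "F (gscale ?I c f) t = gscale M c (F f t)" if "t \<in> T" for t
      proof -
        have t: "t \<in> carrier G" using that TG by auto
        have "gscale ?I c f t = gscale U c (f t)" by (simp add: induced_def)
        then show ?thesis
          using t fc \<open>f \<in> carrier ?I\<close> h hc by (simp add: F_def fg_hom_def M.act_scale)
      qed
      then show ?thesis by (simp add: H_def M.V.scale_sum_right)
    qed
    show "H (gact ?I g f) = gact M g (H f)" if "g \<in> carrier G" "f \<in> carrier ?I" for g f
    proof -
      have "F (gact ?I g f) t = gact M g (F f (inv\<^bsub>G\<^esub> g \<otimes>\<^bsub>G\<^esub> t))" if "t \<in> T" for t
      proof -
        have t: "t \<in> carrier G" using that TG by auto
        have "g \<otimes>\<^bsub>G\<^esub> (inv\<^bsub>G\<^esub> g \<otimes>\<^bsub>G\<^esub> t) = t"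
          using t \<open>g \<in> carrier G\<close> by (simp add: G.m_assoc[symmetric])
        moreover have "gact ?I g f t = f (inv\<^bsub>G\<^esub> g \<otimes>\<^bsub>G\<^esub> t)"
          using t by (simp add: induced_def)
        ultimately show ?thesis
          using t fc \<open>f \<in> carrier ?I\<close> \<open>g \<in> carrier G\<close> hc
            M.act_mult[of g "inv\<^bsub>G\<^esub> g \<otimes>\<^bsub>G\<^esub> t" "h (f (inv\<^bsub>G\<^esub> g \<otimes>\<^bsub>G\<^esub> t))"]
          by (simp add: F_def)
      qed
      then have "H (gact ?I g f) = (\<Sum>t\<in>T. gact M g (F f (inv\<^bsub>G\<^esub> g \<otimes>\<^bsub>G\<^esub> t)))"
        by (simp add: H_def)
      also have "\<dots> = gact M g (\<Sum>t\<in>T. F f (inv\<^bsub>G\<^esub> g \<otimes>\<^bsub>G\<^esub> t))"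
        using that TG by (intro M.act_sum[symmetric] Fc) auto
      finally show ?thesis using T_shift that by simp
    qed
  qed
  have H\<iota>: "H (?\<iota> u) = h u" if u: "u \<in> carrier U" for u
  proof -
    have h0: "h 0 = 0"
    proof -
      have "h (0 + 0) = h 0 + h 0" using h U0 unfolding fg_hom_def by blast
      then show ?thesis by simp
    qed
    have M0: "gact M t 0 = 0" if "t \<in> carrier G" for t
      using M.act_add[OF that, of 0 0] M.subspace_carrier by (auto simp: M.V.subspace_def)
    obtain q where q: "q \<in> Q" "r \<one>\<^bsub>G\<^esub> = q"
      using r_ex[OF G.one_closed] QG by auto
    have "F (?\<iota> u) t = (if t = r \<one>\<^bsub>G\<^esub> then h u else 0)" if t: "t \<in> T" for t
    proof (cases "t \<in> Q")
      case True
      then have "r t = r \<one>\<^bsub>G\<^esub>" using r_coset[OF G.one_closed True] QG by simp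
      moreover have "F (?\<iota> u) t = F (?\<iota> u) \<one>\<^bsub>G\<^esub>"
        using Fq[OF \<iota>c[OF u] G.one_closed True] QG[OF True] by simp
      moreover have "F (?\<iota> u) \<one>\<^bsub>G\<^esub> = h u"
        using U.act_one u by (simp add: F_def induced_inj_def hc M.act_one)
      ultimately show ?thesis using rT[OF t] by simp
    next
      case False
      then show ?thesis using q t TG by (auto simp: F_def induced_inj_def h0 M0)
    qed
    then have "H (?\<iota> u) = (\<Sum>t\<in>T. if t = r \<one>\<^bsub>G\<^esub> then h u else 0)"
      by (simp add: H_def)
    also have "\<dots> = h u" using finT by (simp add: T_def)
    finally show ?thesis .
  qed
  have f_sum: "f = (\<Sum>t\<in>T. gact ?I t (?\<iota> (f t)))" if f: "f \<in> carrier ?I" for f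
  proof
    fix x
    have "gact ?I t (?\<iota> (f t)) x = (if x \<in> carrier G \<and> t = r x then f x else 0)" if t: "t \<in> T" for t
    proof (cases "x \<in> carrier G")
      case x: True
      have tG: "t \<in> carrier G" using t TG by auto
      define q where "q = inv\<^bsub>G\<^esub> t \<otimes>\<^bsub>G\<^esub> x"
      have xtq: "x = t \<otimes>\<^bsub>G\<^esub> q" using x tG by (simp add: q_def G.m_assoc[symmetric])
      have "q \<in> Q \<longleftrightarrow> t = r x"
      proof
        assume "q \<in> Q"
        then show "t = r x" using xtq r_coset[OF tG] rT[OF t] by simp
      next
        assume "t = r x"
        then obtain q' where "q' \<in> Q" "t = x \<otimes>\<^bsub>G\<^esub> q'" using r_ex[OF x] by auto
        then have "q = inv\<^bsub>G\<^esub> q'" using x QG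
          by (simp add: q_def G.inv_mult_group G.m_assoc)
        then show "q \<in> Q" using \<open>q' \<in> Q\<close> by simp
      qed
      moreover have "f x = gact U (inv\<^bsub>G\<^esub> q) (f t)" if "q \<in> Q"
        using f tG that xtq by (auto simp: induced_def)
      ultimately show ?thesis using x tG
        by (auto simp: induced_def induced_inj_def q_def)
    qed (use f in \<open>auto simp: induced_def\<close>)
    then have "(\<Sum>t\<in>T. gact ?I t (?\<iota> (f t))) x = (\<Sum>t\<in>T. if x \<in> carrier G \<and> t = r x then f x else 0)"
      by (simp add: sum_fun_apply)
    also have "\<dots> = f x"
      using finT f by (cases "x \<in> carrier G") (auto simp: T_def induced_def)
    finally show "f x = (\<Sum>t\<in>T. gact ?I t (?\<iota> (f t))) x" ..
  qed
  have uniq: "H' f = H f" if H': "H' \<in> fg_hom G ?I M" "\<forall>u\<in>carrier U. H' (?\<iota> u) = h u"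
      and f: "f \<in> carrier ?I" for H' f
  proof -
    have z: "0 \<in> carrier ?I" using I.subspace_carrier by (simp add: I.V.subspace_def)
    have H'_sum: "H' (\<Sum>a\<in>A. k a) = (\<Sum>a\<in>A. H' (k a))"
      if "\<And>a. a \<in> A \<Longrightarrow> k a \<in> carrier ?I" "finite A" for A and k :: "'g \<Rightarrow> 'g \<Rightarrow> 'v"
      using that(2,1)
    proof (induction A rule: finite_induct)
      case empty
      have "H' (0 + 0) = H' 0 + H' 0" using H'(1) z unfolding fg_hom_def by blast
      then have "H' 0 = 0" by simp
      then show ?case by (simp add: zero_fun_def)
    next
      case (insert a A)
      have "sum k A \<in> carrier ?I"
        using insert by (intro I.V.subspace_sum[OF I.subspace_carrier]) auto
      then have "H' (k a + sum k A) = H' (k a) + H' (sum k A)"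
        using H'(1) insert.prems unfolding fg_hom_def by blast
      then show ?case
        unfolding sum.insert[OF insert.hyps] using insert.IH insert.prems by (metis insertI2)
    qed
    have "H' f = H' (\<Sum>t\<in>T. gact ?I t (?\<iota> (f t)))" using f_sum[OF f] by simp
    also have "\<dots> = (\<Sum>t\<in>T. H' (gact ?I t (?\<iota> (f t))))"
      using TG f by (intro H'_sum finT I.act_closed \<iota>c fc) auto
    also have "\<dots> = (\<Sum>t\<in>T. F f t)"
    proof (rule sum.cong[OF refl])
      fix t assume "t \<in> T"
      then have t: "t \<in> carrier G" using TG by auto
      then have "H' (gact ?I t (?\<iota> (f t))) = gact M t (H' (?\<iota> (f t)))"
        using H'(1) \<iota>c[OF fc[OF f t]] unfolding fg_hom_def by blast
      then show "H' (gact ?I t (?\<iota> (f t))) = F f t"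
        using H'(2) fc[OF f t] by (simp add: F_def)
    qed
    finally show ?thesis by (simp add: H_def)
  qed
  show "\<exists>H\<in>fg_hom G ?I M. (\<forall>u\<in>carrier U. H (?\<iota> u) = h u) \<and>
      (\<forall>H'\<in>fg_hom G ?I M. (\<forall>u\<in>carrier U. H' (?\<iota> u) = h u) \<longrightarrow>
        (\<forall>f\<in>carrier ?I. H' f = H f))"
    using H H\<iota> uniq by blast
qed


section \<open>Specht modules are modules\<close>


lemma finite_diagram: "finite (diagram l)"
proof -
  have "diagram l = (SIGMA i:{..<length l}. {..<l ! i})"
    by (auto simp: diagram_def)
  then show ?thesis by simp
qed

lemma card_diagram: "card (diagram l) = sum_list l"
proof -
  have "diagram l = (SIGMA i:{..<length l}. {..<l ! i})"
    by (auto simp: diagram_def)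
  then show ?thesis by (simp add: sum_list_sum_nth atLeast0LessThan)
qed

lemma finite_tableaux: "finite (tableaux l)"
proof (rule finite_subset)
  show "tableaux l \<subseteq> {t. \<forall>x. (x \<in> diagram l \<longrightarrow> t x \<in> {1..sum_list l}) \<and> (x \<notin> diagram l \<longrightarrow> t x = 0)}"
    by (auto simp: tableaux_def bij_betw_def)
  show "finite {t. \<forall>x. (x \<in> diagram l \<longrightarrow> t x \<in> {1..sum_list l}) \<and> (x \<notin> diagram l \<longrightarrow> t x = 0)}"
    by (rule finite_set_of_finite_funs) (auto simp: finite_diagram)
qed

lemma finite_tabloids: "finite (tabloids l)"
  by (simp add: tabloids_def finite_tableaux)

lemma tableaux_comp:
  assumes "s permutes {1..sum_list l}" "t \<in> tableaux l"
  shows "s \<circ> t \<in> tableaux l"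
  using assms permutes_not_in[OF assms(1), of 0]
  by (auto simp: tableaux_def intro: bij_betw_trans permutes_imp_bij)

lemma stabilizer_conj:
  fixes R :: "'i \<Rightarrow> 'x set"
  assumes s: "s permutes {1..n::nat}" and u: "u permutes {1..n}"
  shows "(\<forall>i. (s \<circ> u \<circ> inv' s) ` ((s \<circ> t) ` R i) = (s \<circ> t) ` R i) \<longleftrightarrow> (\<forall>i. u ` (t ` R i) = t ` R i)"
proof -
  have "(s \<circ> u \<circ> inv' s) ` ((s \<circ> t) ` R i) = s ` (u ` (t ` R i))" for i
    using permutes_inverses[OF s] by (simp add: image_comp[symmetric] image_image)
  moreover have "(s \<circ> t) ` R i = s ` (t ` R i)" for i by (simp add: image_comp)
  moreover have "s ` A = s ` B \<longleftrightarrow> A = B" for A B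
    using permutes_inj[OF s] by (simp add: inj_image_eq_iff)
  ultimately show ?thesis by simp
qed

lemma stabilizer_conj_image:
  assumes s: "s permutes {1..n::nat}"
  shows "{u. u permutes {1..n} \<and> (\<forall>i. u ` ((s \<circ> t) ` R i) = (s \<circ> t) ` R i)} =
    (\<lambda>u. s \<circ> u \<circ> inv' s) ` {u. u permutes {1..n} \<and> (\<forall>i. u ` (t ` R i) = t ` R i)}"
    (is "?A = ?f ` ?B")
proof -
  note i = permutes_inverses[OF s] permutes_inv[OF s]
  have p: "s \<circ> u \<circ> inv' s permutes {1..n}" "inv' s \<circ> u \<circ> s permutes {1..n}" if "u permutes {1..n}" for u
    using that s i by (auto intro!: permutes_compose)
  have e: "s \<circ> (inv' s \<circ> u \<circ> s) \<circ> inv' s = u" for u using i by (auto simp: fun_eq_iff)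
  show ?thesis
  proof
    show "?f ` ?B \<subseteq> ?A" using p stabilizer_conj[OF s, of _ t R] by blast
    show "?A \<subseteq> ?f ` ?B"
    proof
      fix u assume u: "u \<in> ?A"
      then have "inv' s \<circ> u \<circ> s \<in> ?B"
        using p stabilizer_conj[OF s, of "inv' s \<circ> u \<circ> s" t R] e[of u] by auto
      then show "u \<in> ?f ` ?B" using e[of u] by (metis (no_types, lifting) imageI)
    qed
  qed
qed

lemma row_stabilizer_comp:
  assumes "s permutes {1..sum_list l}"
  shows "row_stabilizer l (s \<circ> t) = (\<lambda>u. s \<circ> u \<circ> inv' s) ` row_stabilizer l t"
  using stabilizer_conj_image[OF assms, of t "\<lambda>i. {x \<in> diagram l. fst x = i}"]
  by (simp add: row_stabilizer_def sym_group_def)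

lemma column_stabilizer_comp:
  assumes "s permutes {1..sum_list l}"
  shows "column_stabilizer l (s \<circ> t) = (\<lambda>u. s \<circ> u \<circ> inv' s) ` column_stabilizer l t"
  using stabilizer_conj_image[OF assms, of t "\<lambda>i. {x \<in> diagram l. snd x = i}"]
  by (simp add: column_stabilizer_def sym_group_def)

lemma conj_comp:
  assumes "s permutes {1..n::nat}"
  shows "s \<circ> u \<circ> inv' s \<circ> (s \<circ> t) = s \<circ> (u \<circ> t)"
  using permutes_inverses[OF assms] by (auto simp: fun_eq_iff)

lemma tabloid_of_comp:
  assumes "s permutes {1..sum_list l}"
  shows "tabloid_of l (s \<circ> t) = (\<circ>) s ` tabloid_of l t"
proof -
  have "tabloid_of l (s \<circ> t) = (\<lambda>u. u \<circ> (s \<circ> t)) ` row_stabilizer l (s \<circ> t)"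
    by (auto simp: tabloid_of_def)
  also have "\<dots> = (\<lambda>u. s \<circ> (u \<circ> t)) ` row_stabilizer l t"
    unfolding row_stabilizer_comp[OF assms] image_image conj_comp[OF assms] ..
  also have "\<dots> = (\<circ>) s ` tabloid_of l t" by (auto simp: tabloid_of_def)
  finally show ?thesis .
qed

lemma tabloids_act:
  assumes "s permutes {1..sum_list l}" "T \<in> tabloids l"
  shows "(\<circ>) s ` T \<in> tabloids l"
  using assms tableaux_comp by (auto simp: tabloids_def tabloid_of_comp[symmetric])

lemma tabloid_of_in: "t \<in> tableaux l \<Longrightarrow> tabloid_of l t \<in> tabloids l"
  by (simp add: tabloids_def)

lemma tabloid_module_act_basis:
  assumes "s permutes {1..sum_list l}" "T \<in> tabloids l"
  shows "gact (tabloid_module l) s (\<lambda>T'. c * basis_vec T T') = (\<lambda>T'. c * basis_vec ((\<circ>) s ` T) T')"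
proof
  fix T'
  have "gact (tabloid_module l) s (\<lambda>T'. c * basis_vec T T') T' =
      (\<Sum>X\<in>tabloids l. if X = T then c * basis_vec ((\<circ>) s ` T) T' else 0)"
    by (auto simp: tabloid_module_def sum_fun_apply basis_vec_def intro!: sum.cong)
  then show "gact (tabloid_module l) s (\<lambda>T'. c * basis_vec T T') T' = c * basis_vec ((\<circ>) s ` T) T'"
    using assms finite_tabloids by simp
qed

lemma tabloid_module_fg_module:
  "fg_module (sym_group (sum_list l)) (tabloid_module l :: ('f::field, _, _) gmod)"
proof -
  let ?M = "tabloid_module l :: ('f, _, _) gmod"
  interpret G: group "sym_group (sum_list l)" by (rule sym_group_is_group)
  have s: "gscale ?M = (\<lambda>c v T. c * v T)" by (simp add: tabloid_module_def)
  interpret V: vector_space "gscale ?M" unfolding s by (rule vector_space_fun)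
  have sub: "V.subspace (carrier ?M)"
    unfolding V.subspace_def by (auto simp: tabloid_module_def)
  have act: "gact ?M s v T' = (\<Sum>T\<in>tabloids l. v T * basis_vec ((\<circ>) s ` T) T')" for s v T'
    by (simp add: tabloid_module_def sum_fun_apply)
  show ?thesis
  proof (intro fg_module.intro fg_module_axioms.intro)
    have "carrier ?M \<subseteq> V.span (basis_vec ` tabloids l)"
    proof
      fix v assume v: "v \<in> carrier ?M"
      have "v = (\<Sum>T\<in>tabloids l. gscale ?M (v T) (basis_vec T))"
      proof
        fix T'
        have "(\<Sum>T\<in>tabloids l. gscale ?M (v T) (basis_vec T)) T' =
          (\<Sum>T\<in>tabloids l. if T = T' then v T' else 0)"
          unfolding sum_fun_apply by (intro sum.cong) (auto simp: s basis_vec_def)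
        then show "v T' = (\<Sum>T\<in>tabloids l. gscale ?M (v T) (basis_vec T)) T'"
          using v finite_tabloids by (auto simp: tabloid_module_def)
      qed
      also have "\<dots> \<in> V.span (basis_vec ` tabloids l)"
        by (intro V.span_sum V.span_scale V.span_base) auto
      finally show "v \<in> V.span (basis_vec ` tabloids l)" .
    qed
    then show "\<exists>B. finite B \<and> B \<subseteq> carrier ?M \<and> V.span B = carrier ?M"
      using V.subspace_of_finite_span[OF sub, of "basis_vec ` tabloids l"] finite_tabloids by blast
  next
    fix g v assume "g \<in> carrier (sym_group (sum_list l))" "v \<in> carrier ?M"
    then have g: "g permutes {1..sum_list l}" by (simp add: sym_group_carrier)
    show "gact ?M g v \<in> carrier ?M"
      using tabloids_act[OF g]
      by (auto simp: act tabloid_module_def sum_fun_apply basis_vec_def intro!: sum.neutral)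
  next
    fix g v w
    show "gact ?M g (v + w) = gact ?M g v + gact ?M g w"
      by (auto simp: fun_eq_iff act sum.distrib algebra_simps)
  next
    fix g v c
    show "gact ?M g (gscale ?M c v) = gscale ?M c (gact ?M g v)"
      by (auto simp: fun_eq_iff act s sum_distrib_left algebra_simps)
  next
    fix v assume v: "v \<in> carrier ?M"
    show "gact ?M \<one>\<^bsub>sym_group (sum_list l)\<^esub> v = v"
    proof
      fix T'
      have "gact ?M \<one>\<^bsub>sym_group (sum_list l)\<^esub> v T' = (\<Sum>T\<in>tabloids l. if T = T' then v T' else 0)"
        unfolding act by (intro sum.cong) (auto simp: sym_group_def basis_vec_def)
      then show "gact ?M \<one>\<^bsub>sym_group (sum_list l)\<^esub> v T' = v T'"
        using v finite_tabloids by (auto simp: tabloid_module_def)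
    qed
  next
    fix g h v assume "g \<in> carrier (sym_group (sum_list l))" "h \<in> carrier (sym_group (sum_list l))"
    then have g: "g permutes {1..sum_list l}" and h: "h permutes {1..sum_list l}"
      by (simp_all add: sym_group_carrier)
    show "gact ?M (g \<otimes>\<^bsub>sym_group (sum_list l)\<^esub> h) v = gact ?M g (gact ?M h v)"
    proof
      fix T'
      have "gact ?M g (gact ?M h v) T' = (\<Sum>X\<in>tabloids l. \<Sum>T\<in>tabloids l.
          v T * basis_vec ((\<circ>) h ` T) X * basis_vec ((\<circ>) g ` X) T')"
        by (simp add: act sum_distrib_right)
      also have "\<dots> = (\<Sum>T\<in>tabloids l. \<Sum>X\<in>tabloids l.
          v T * basis_vec ((\<circ>) h ` T) X * basis_vec ((\<circ>) g ` X) T')"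
        by (rule sum.swap)
      also have "\<dots> = (\<Sum>T\<in>tabloids l. v T * basis_vec ((\<circ>) g ` (\<circ>) h ` T) T')"
      proof (rule sum.cong[OF refl])
        fix T assume T: "T \<in> tabloids l"
        have "(\<Sum>X\<in>tabloids l. v T * basis_vec ((\<circ>) h ` T) X * basis_vec ((\<circ>) g ` X) T') =
          (\<Sum>X\<in>tabloids l. if X = (\<circ>) h ` T then v T * basis_vec ((\<circ>) g ` (\<circ>) h ` T) T' else 0)"
          by (intro sum.cong) (auto simp: basis_vec_def)
        then show "(\<Sum>X\<in>tabloids l. v T * basis_vec ((\<circ>) h ` T) X * basis_vec ((\<circ>) g ` X) T') =
          v T * basis_vec ((\<circ>) g ` (\<circ>) h ` T) T'"
          using tabloids_act[OF h T] finite_tabloids by simp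
      qed
      also have "\<dots> = gact ?M (g \<otimes>\<^bsub>sym_group (sum_list l)\<^esub> h) v T'"
        by (simp add: act sym_group_def image_image o_assoc comp_def)
      finally show "gact ?M (g \<otimes>\<^bsub>sym_group (sum_list l)\<^esub> h) v T' = gact ?M g (gact ?M h v) T'" ..
    qed
  qed (use sub in \<open>auto intro: G.is_group V.vector_space_axioms\<close>)
qed

lemma polytabloid_act:
  assumes s: "s permutes {1..sum_list l}" and t: "t \<in> tableaux l"
  shows "gact (tabloid_module l) s (polytabloid l t) = (polytabloid l (s \<circ> t) :: _ \<Rightarrow> 'f::field)"
proof -
  let ?M = "tabloid_module l :: ('f, _, _) gmod"
  interpret M: fg_module "sym_group (sum_list l)" ?M by (rule tabloid_module_fg_module)
  have u: "u permutes {1..sum_list l}" if "u \<in> column_stabilizer l t" for u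
    using that by (simp add: column_stabilizer_def sym_group_carrier)
  have "gact ?M s (polytabloid l t) =
      (\<Sum>u\<in>column_stabilizer l t. gact ?M s (\<lambda>T. of_int (sign u) * basis_vec ((\<circ>) u ` tabloid_of l t) T))"
    unfolding polytabloid_def
  proof (intro M.act_sum)
    show "(\<lambda>T. of_int (sign u) * basis_vec ((\<circ>) u ` tabloid_of l t) T) \<in> carrier ?M"
      if "u \<in> column_stabilizer l t" for u
      using tabloids_act[OF u tabloid_of_in] t that by (auto simp: tabloid_module_def basis_vec_def)
  qed (use s in \<open>simp add: sym_group_carrier\<close>)
  also have "\<dots> = (\<Sum>u\<in>column_stabilizer l t.
      (\<lambda>T. of_int (sign u) * basis_vec ((\<circ>) s ` (\<circ>) u ` tabloid_of l t) T))"
    using u t s by (intro sum.cong refl tabloid_module_act_basis tabloids_act tabloid_of_in) auto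
  also have "\<dots> = (\<Sum>u\<in>column_stabilizer l t.
      (\<lambda>T. of_int (sign (s \<circ> u \<circ> inv' s)) * basis_vec ((\<circ>) (s \<circ> u \<circ> inv' s) ` tabloid_of l (s \<circ> t)) T))"
  proof (intro sum.cong refl)
    fix x assume x: "x \<in> column_stabilizer l t"
    have perm: "permutation s" "permutation x"
      using s u[OF x] by (auto simp: permutation_permutes)
    then have "sign (s \<circ> x \<circ> inv' s) = sign x"
      by (simp add: sign_compose sign_inverse permutation_compose permutation_inverse sign_idempotent
          mult.commute mult.left_commute)
    moreover have "(\<circ>) (s \<circ> x \<circ> inv' s) ` tabloid_of l (s \<circ> t) = (\<circ>) s ` (\<circ>) x ` tabloid_of l t"
      unfolding tabloid_of_comp[OF s] image_image conj_comp[OF s] ..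
    ultimately show "(\<lambda>T. of_int (sign x) * basis_vec ((\<circ>) s ` (\<circ>) x ` tabloid_of l t) T) =
      (\<lambda>T. of_int (sign (s \<circ> x \<circ> inv' s)) *
        basis_vec ((\<circ>) (s \<circ> x \<circ> inv' s) ` tabloid_of l (s \<circ> t)) T)" by simp
  qed
  also have "\<dots> = polytabloid l (s \<circ> t)"
  proof -
    have "inj_on (\<lambda>u. s \<circ> u \<circ> inv' s) (column_stabilizer l t)"
    proof (rule inj_onI)
      fix a b assume "s \<circ> a \<circ> inv' s = s \<circ> b \<circ> inv' s"
      then have "inv' s \<circ> (s \<circ> a \<circ> inv' s) \<circ> s = inv' s \<circ> (s \<circ> b \<circ> inv' s) \<circ> s" by simp
      then show "a = b" using permutes_inverses[OF s] by (auto simp: fun_eq_iff)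
    qed
    then show ?thesis
      unfolding polytabloid_def column_stabilizer_comp[OF s] by (subst sum.reindex) simp_all
  qed
  finally show ?thesis .
qed

lemma specht_submodule:
  "fg_submodule (sym_group (sum_list l)) (tabloid_module l) (carrier (specht_module l :: ('f::field, _, _) gmod))"
proof -
  let ?M = "tabloid_module l :: ('f, _, _) gmod"
  interpret M: fg_module "sym_group (sum_list l)" ?M by (rule tabloid_module_fg_module)
  let ?E = "polytabloid l ` tableaux l :: (_ \<Rightarrow> 'f) set"
  have c: "carrier (specht_module l :: ('f, _, _) gmod) = M.V.span ?E" by (simp add: specht_module_def)
  have E: "polytabloid l t \<in> carrier ?M" if "t \<in> tableaux l" for t
    unfolding polytabloid_def
  proof (intro M.V.subspace_sum[OF M.subspace_carrier])
    fix u assume "u \<in> column_stabilizer l t"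
    then have u: "u permutes {1..sum_list l}" by (simp add: column_stabilizer_def sym_group_carrier)
    show "(\<lambda>T. of_int (sign u) * basis_vec ((\<circ>) u ` tabloid_of l t) T) \<in> carrier ?M"
      using tabloids_act[OF u tabloid_of_in[OF that]] by (auto simp: tabloid_module_def basis_vec_def)
  qed
  then have sub: "M.V.span ?E \<subseteq> carrier ?M"
    by (intro M.V.span_minimal M.subspace_carrier) auto
  have "gact ?M g v \<in> M.V.span ?E" if g: "g \<in> carrier (sym_group (sum_list l))" and v: "v \<in> M.V.span ?E" for g v
  proof -
    obtain A r where A: "v = (\<Sum>a\<in>A. gscale ?M (r a) a)" "finite A" "A \<subseteq> ?E"
      using v unfolding M.V.span_explicit by blast
    have sc: "gscale ?M c w \<in> carrier ?M" if "w \<in> carrier ?M" for c w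
      using that M.subspace_carrier by (auto simp: M.V.subspace_def)
    have "gact ?M g v = (\<Sum>a\<in>A. gact ?M g (gscale ?M (r a) a))"
      unfolding A(1) using A(3) E by (intro M.act_sum g sc) auto
    also have "\<dots> = (\<Sum>a\<in>A. gscale ?M (r a) (gact ?M g a))"
      using A(3) E g by (intro sum.cong refl M.act_scale) auto
    also have "\<dots> \<in> M.V.span ?E"
    proof (intro M.V.span_sum M.V.span_scale M.V.span_base)
      fix a assume "a \<in> A"
      then obtain t where t: "t \<in> tableaux l" "a = polytabloid l t" using A(3) by auto
      then show "gact ?M g a \<in> ?E"
        using g polytabloid_act[of g l t] tableaux_comp[of g l t] by (auto simp: sym_group_carrier)
    qed
    finally show ?thesis .
  qed
  then show ?thesis unfolding fg_submodule_def c using sub by (auto intro: M.V.subspace_span)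
qed

lemma specht_fg_module:
  "fg_module (sym_group (sum_list l)) (specht_module l :: ('f::field, _, _) gmod)"
proof -
  let ?M = "tabloid_module l :: ('f, _, _) gmod" and ?S = "specht_module l :: ('f, _, _) gmod"
  interpret M: fg_module "sym_group (sum_list l)" ?M by (rule tabloid_module_fg_module)
  have sub: "M.V.subspace (carrier ?S)" "carrier ?S \<subseteq> carrier ?M"
    and cl: "\<And>g v. g \<in> carrier (sym_group (sum_list l)) \<Longrightarrow> v \<in> carrier ?S \<Longrightarrow> gact ?M g v \<in> carrier ?S"
    using specht_submodule[of l, where 'f='f] by (auto simp: fg_submodule_def)
  have S: "gscale ?S = gscale ?M" "gact ?S = gact ?M" by (simp_all add: specht_module_def)
  have c: "carrier ?S = M.V.span (polytabloid l ` tableaux l)" by (simp add: specht_module_def)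
  show ?thesis
  proof (intro fg_module.intro fg_module_axioms.intro)
    show "\<exists>B. finite B \<and> B \<subseteq> carrier ?S \<and> module.span (gscale ?S) B = carrier ?S"
      unfolding S c using finite_tableaux[of l]
      by (intro exI[of _ "polytabloid l ` tableaux l"]) (auto intro: M.V.span_base)
  qed (use sub cl in \<open>auto simp: S subset_iff M.act_add M.act_scale M.act_one M.act_mult
      intro: M.G.is_group M.V.vector_space_axioms\<close>)
qed

end

theory Submission
  imports Defs "HOL-Algebra.Group_Action" "HOL-Algebra.Left_Coset" "HOL-Algebra.Sylow"
begin

text \<open>
  Let \<open>G\<close> be the symmetric group of degree \<open>n = k p\<close>, let \<open>K\<close> be generated by a \<open>p\<close>-cycle on \<open>{1..p}\<close>
  and let \<open>H\<close> be a Sylow \<open>p\<close>-subgroup of the symmetric group on the remaining points. As \<open>p\<close> does not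
  divide \<open>k\<close>, the group \<open>K H\<close> is a Sylow \<open>p\<close>-subgroup of \<open>G\<close>. The Specht module \<open>S\<close> is projective
  relative to it because its index is invertible in the field.

  Conversely, let \<open>S\<close> be projective relative to \<open>R\<close>. Then the identity of \<open>S\<close> is a sum of linear maps
  \<open>\<theta> C\<close>, one for each coset \<open>C\<close> of \<open>R\<close>, which \<open>G\<close> permutes by conjugation as it permutes the cosets.
  Let \<open>v\<close> be the polytabloid of a tableau with first column \<open>p + 1, 1, \<dots>, p\<close>, and let \<open>\<mu>\<close> be the
  coefficient of its tabloid. Then \<open>\<mu> v = 1\<close>, the functional \<open>\<mu>\<close> is invariant under \<open>K H\<close>, the vector \<open>v\<close>
  is fixed by \<open>K\<close>, and the Garnir relation shows that \<open>v - h v\<close> is a trace over \<open>K\<close> for \<open>h\<close> in \<open>H\<close>.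
  Hence \<open>C \<mapsto> \<mu> (\<theta> C v)\<close> is invariant under \<open>K\<close> and, on the cosets fixed by \<open>K\<close>, also under \<open>H\<close>. Counting
  orbits modulo \<open>p\<close>, its sum \<open>1\<close> is already the sum over the cosets fixed by \<open>K H\<close>. So such a coset
  exists, and \<open>R\<close> contains a conjugate of \<open>K H\<close>.
\<close>

section \<open>Actions of \<open>p\<close>-groups, cosets and rotations\<close>

text \<open>Orbit sizes divide \<open>p ^ k\<close>, so an orbit is a single point or its size is 0
  in the coefficient ring. As \<open>f\<close> is constant on orbits, those of the second kind
  contribute nothing.\<close>

lemma (in group_action) sum_eq_sum_fixed_points:
  fixes f :: "'c \<Rightarrow> 'd::semiring_1"
  assumes "finite E" "prime p" "order G = p ^ k" "of_nat p = (0::'d)"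
    and inv: "\<And>g x. g \<in> carrier G \<Longrightarrow> x \<in> E \<Longrightarrow> f (\<phi> g x) = f x"
  shows "sum f E = sum f {x \<in> E. \<forall>g\<in>carrier G. \<phi> g x = x}"
proof -
  define h where "h x = (if \<forall>g\<in>carrier G. \<phi> g x = x then f x else 0)" for x
  have "sum f O1 = sum h O1" if O1: "O1 \<in> orbits G E \<phi>" for O1
  proof -
    obtain x where x: "x \<in> E" "O1 = orbit G \<phi> x" using O1 by (auto simp: orbits_def)
    show ?thesis
    proof (cases "\<forall>g\<in>carrier G. \<phi> g x = x")
      case True
      then have "O1 = {x}" using x orbit_refl[of x] by (auto simp: orbit_def)
      then show ?thesis using True by (simp add: h_def)
    next
      case False
      \<comment> \<open>A fixed point \<open>y\<close> would have orbit \<open>{y}\<close>, which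
        contains \<open>x\<close>; so no point of this orbit is fixed.\<close>
      have nf: "\<not> (\<forall>g\<in>carrier G. \<phi> g y = y)" if "y \<in> O1" for y
      proof
        assume y: "\<forall>g\<in>carrier G. \<phi> g y = y"
        have "y \<in> E" using that x orbits_coverture O1 by blast
        then have "x \<in> orbit G \<phi> y" using orbit_sym x that by blast
        then have "x = y" using y by (auto simp: orbit_def)
        then show False using False y by simp
      qed
      have "card O1 dvd p ^ k"
        using orbit_stabilizer_theorem[OF x(1)] x(2) assms(3) by (metis dvd_triv_left)
      moreover have "card O1 \<noteq> 1"
      proof
        assume "card O1 = 1"
        then obtain z where "O1 = {z}" by (auto simp: card_1_singleton_iff)
        moreover have "x \<in> O1" using x orbit_refl by simp
        ultimately have "\<phi> g x = x" if "g \<in> carrier G" for g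
          using that x by (auto simp: orbit_def)
        then show False using False by simp
      qed
      ultimately have "p dvd card O1"
        using \<open>prime p\<close> by (metis divides_primepow_nat dvd_power gr0I power_0)
      then have "of_nat (card O1) = (0::'d)"
        using assms(4) by (auto simp: dvd_def)
      moreover have "sum f O1 = (\<Sum>y\<in>O1. f x)"
        using inv x by (intro sum.cong) (auto simp: orbit_def)
      moreover have "sum h O1 = 0" using nf by (intro sum.neutral) (auto simp: h_def)
      ultimately show ?thesis by simp
    qed
  qed
  then have "sum f E = sum h E"
    unfolding disjoint_sum[OF assms(1), symmetric] by (rule sum.cong[OF refl])
  also have "\<dots> = sum f {x \<in> E. \<forall>g\<in>carrier G. \<phi> g x = x}"
    unfolding h_def using assms(1) by (subst sum.inter_filter) auto
  finally show ?thesis .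
qed

context group
begin

lemma lcosets_translate:
  assumes "subgroup H G" "g \<in> carrier G" "C \<in> lcosets H"
  shows "g <# C \<in> lcosets H"
  using assms by (auto simp: LCOSETS_def lcos_m_assoc subgroup.subset)

lemma l_coset_mem_translate:
  assumes "g \<in> carrier G" "x \<in> carrier G" "C \<subseteq> carrier G"
  shows "x \<in> g <# C \<longleftrightarrow> inv g \<otimes> x \<in> C"
proof
  assume "inv g \<otimes> x \<in> C"
  moreover have "x = g \<otimes> (inv g \<otimes> x)" using assms by (simp add: m_assoc[symmetric])
  ultimately show "x \<in> g <# C" by (auto simp: l_coset_def)
next
  assume "x \<in> g <# C"
  then obtain c where "c \<in> C" "x = g \<otimes> c" by (auto simp: l_coset_def)
  then show "inv g \<otimes> x \<in> C" using assms by (auto simp: m_assoc[symmetric])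
qed

text \<open>\<open>X\<close> is any family of subsets stable under \<open>Q\<close>, because the
  count is made twice: for \<open>K\<close> on all cosets of \<open>R\<close>, and then for
  \<open>H\<close> on the cosets fixed by \<open>K\<close>.\<close>

lemma sum_eq_sum_translation_fixed:
  fixes f :: "'a set \<Rightarrow> 'd::semiring_1"
  assumes Q: "subgroup Q G" and "prime p" "card Q = p ^ k" "of_nat p = (0::'d)"
    and X: "finite X" "X \<subseteq> Pow (carrier G)" "\<And>q C. q \<in> Q \<Longrightarrow> C \<in> X \<Longrightarrow> q <# C \<in> X"
    and inv: "\<And>q C. q \<in> Q \<Longrightarrow> C \<in> X \<Longrightarrow> f (q <# C) = f C"
  shows "sum f X = sum f {C \<in> X. \<forall>q\<in>Q. q <# C = C}"
proof -
  have QG: "q \<in> carrier G" if "q \<in> Q" for q using that subgroup.subset[OF Q] by auto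
  \<comment> \<open>Elements of \<open>Bij X\<close> are \<open>undefined\<close> outside
    \<open>X\<close>, hence the restricted abstraction.\<close>
  define \<phi> where "\<phi> q = (\<lambda>C\<in>X. q <# C)" for q
  have iq: "inv q \<in> Q" if "q \<in> Q" for q using that subgroup.m_inv_closed[OF Q] by simp
  have "group_action (G\<lparr>carrier := Q\<rparr>) X \<phi>"
    unfolding group_action_def
  proof (intro group_hom.intro group_hom_axioms.intro)
    show "group (G\<lparr>carrier := Q\<rparr>)" using subgroup.subgroup_is_group[OF Q] is_group .
    show "group (BijGroup X)" by (rule group_BijGroup)
    have bij: "\<phi> q \<in> Bij X" if "q \<in> Q" for q
    proof -
      have "bij_betw (\<lambda>C. q <# C) X X"
      proof (rule bij_betw_byWitness[of _ "\<lambda>C. inv q <# C"])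
        show "\<forall>C\<in>X. inv q <# (q <# C) = C" "\<forall>C\<in>X. q <# (inv q <# C) = C"
          using X QG[OF that] by (auto simp: lcos_m_assoc lcos_mult_one)
      qed (use X that iq in auto)
      then show ?thesis
        by (auto simp: Bij_def \<phi>_def cong: bij_betw_cong)
    qed
    show "\<phi> \<in> hom (G\<lparr>carrier := Q\<rparr>) (BijGroup X)"
    proof (rule homI)
      fix q r assume "q \<in> carrier (G\<lparr>carrier := Q\<rparr>)" "r \<in> carrier (G\<lparr>carrier := Q\<rparr>)"
      then have qr: "q \<in> Q" "r \<in> Q" by auto
      have "(q \<otimes> r) <# C = q <# (r <# C)" if "C \<in> X" for C
        using that qr X QG by (subst lcos_m_assoc) auto
      then show "\<phi> (q \<otimes>\<^bsub>G\<lparr>carrier := Q\<rparr>\<^esub> r) = \<phi> q \<otimes>\<^bsub>BijGroup X\<^esub> \<phi> r"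
        using qr bij X(3) by (auto simp: BijGroup_def compose_def \<phi>_def fun_eq_iff)
    qed (use bij in \<open>auto simp: BijGroup_def\<close>)
  qed
  then interpret A: group_action "G\<lparr>carrier := Q\<rparr>" X \<phi> .
  have "sum f X = sum f {C \<in> X. \<forall>q\<in>carrier (G\<lparr>carrier := Q\<rparr>). \<phi> q C = C}"
    using assms(3) inv by (intro A.sum_eq_sum_fixed_points[OF X(1) \<open>prime p\<close> _ \<open>of_nat p = 0\<close>])
      (auto simp: order_def \<phi>_def)
  also have "{C \<in> X. \<forall>q\<in>carrier (G\<lparr>carrier := Q\<rparr>). \<phi> q C = C} = {C \<in> X. \<forall>q\<in>Q. q <# C = C}"
    by (auto simp: \<phi>_def)
  finally show ?thesis .
qed

text \<open>If \<open>Q\<close> fixes the coset \<open>x R\<close>, then \<open>x\<inverse> Q x \<subseteq> R\<close>.\<close>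

lemma card_le_if_fixes_lcoset:
  assumes "finite (carrier G)" "subgroup Q G" "subgroup R G" "C \<in> lcosets R"
    and fixes_C: "\<And>q. q \<in> Q \<Longrightarrow> q <# C = C"
  shows "card Q \<le> card R"
proof -
  obtain x where x: "x \<in> carrier G" "C = x <# R" using assms(4) by (auto simp: LCOSETS_def)
  have sub: "Q \<subseteq> carrier G" "R \<subseteq> carrier G" using assms by (simp_all add: subgroup.subset)
  have xC: "x \<in> C" using x lcos_self assms(3) by simp
  \<comment> \<open>Instead of conjugating, right multiplication by \<open>x\<close> embeds
    \<open>Q\<close> into \<open>C\<close>, which has as many elements as \<open>R\<close>.\<close>
  have "(\<lambda>q. q \<otimes> x) ` Q \<subseteq> C"
    using fixes_C xC by (force simp: l_coset_def)
  moreover have "inj_on (\<lambda>q. q \<otimes> x) Q" using x sub by (intro inj_onI) (metis right_cancel subsetD)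
  moreover have "card C = card R"
    using l_card_cosets_equal[OF assms(4) sub(2) assms(1)] by simp
  moreover have "finite C" using x sub assms(1)
    by (metis finite_subset l_coset_subset_G)
  ultimately show ?thesis by (metis card_inj_on_le)
qed

end

section \<open>Products of commuting subgroups\<close>

lemma permutes_disjoint_commute:
  assumes f: "f permutes A" and g: "g permutes B" and "A \<inter> B = {}"
  shows "f \<circ> g = g \<circ> f"
proof
  fix x
  have "f (g x) = g (f x)"
  proof (cases "x \<in> A")
    case True
    then have "f x \<in> A" using permutes_in_image[OF f] by blast
    then show ?thesis using True assms(3) permutes_not_in[OF g] by (metis disjoint_iff)
  next
    case False
    then have "g x \<notin> A"
      using assms(3) permutes_in_image[OF g] permutes_not_in[OF g] by (metis disjoint_iff)
    then show ?thesis using False permutes_not_in[OF f] by metis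
  qed
  then show "(f \<circ> g) x = (g \<circ> f) x" by simp
qed

text \<open>Exchanging neighbouring factors from \<open>K\<close> and \<open>H\<close> brings
  products and inverses back to the form \<open>k \<otimes> h\<close>.\<close>

lemma (in group) commuting_set_mult_subgroup:
  assumes K: "subgroup K G" and H: "subgroup H G"
    and comm: "\<And>k h. k \<in> K \<Longrightarrow> h \<in> H \<Longrightarrow> k \<otimes> h = h \<otimes> k"
  shows "subgroup (K <#> H) G"
proof (rule subgroupI)
  interpret K: subgroup K G by fact
  interpret H: subgroup H G by fact
  show "K <#> H \<subseteq> carrier G" by (rule set_mult_closed[OF K.subset H.subset])
  show "K <#> H \<noteq> {}" using K.one_closed H.one_closed unfolding set_mult_def by blast
  fix x assume "x \<in> K <#> H"
  then obtain k h where x: "x = k \<otimes> h" "k \<in> K" "h \<in> H" by (auto simp: set_mult_def)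
  then have "inv x = inv k \<otimes> inv h"
    using comm[of "inv k" "inv h"] by (simp add: inv_mult_group)
  then show "inv x \<in> K <#> H" using x by (auto simp: set_mult_def)
  fix y assume "y \<in> K <#> H"
  then obtain k' h' where y: "y = k' \<otimes> h'" "k' \<in> K" "h' \<in> H" by (auto simp: set_mult_def)
  have "x \<otimes> y = k \<otimes> (h \<otimes> k') \<otimes> h'" using x y by (simp add: m_assoc)
  also have "h \<otimes> k' = k' \<otimes> h" using x y comm[of k' h] by simp
  also have "k \<otimes> (k' \<otimes> h) \<otimes> h' = (k \<otimes> k') \<otimes> (h \<otimes> h')" using x y by (simp add: m_assoc)
  finally show "x \<otimes> y \<in> K <#> H"
    using x y K.m_closed H.m_closed by (auto simp: set_mult_def)
qed

text \<open>Two factorizations of one element give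
  \<open>inv k' \<otimes> k = h' \<otimes> inv h\<close>, which lies in \<open>K \<inter> H\<close>;
  so factorizations are unique.\<close>

lemma (in group) card_set_mult_trivial_Int:
  assumes K: "subgroup K G" and H: "subgroup H G" and int: "K \<inter> H = {\<one>}"
  shows "card (K <#> H) = card K * card H"
proof -
  interpret K: subgroup K G by fact
  interpret H: subgroup H G by fact
  have "inj_on (\<lambda>(k, h). k \<otimes> h) (K \<times> H)"
  proof (rule inj_onI, clarify)
    fix k h k' h' assume *: "k \<in> K" "h \<in> H" "k' \<in> K" "h' \<in> H" and eq: "k \<otimes> h = k' \<otimes> h'"
    have "inv k' \<otimes> k = inv k' \<otimes> (k \<otimes> h) \<otimes> inv h" using * by (simp add: m_assoc)
    also have "\<dots> = h' \<otimes> inv h" using * unfolding eq by (simp add: m_assoc[symmetric])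
    finally have e: "inv k' \<otimes> k = h' \<otimes> inv h" .
    moreover have "inv k' \<otimes> k \<in> K" "h' \<otimes> inv h \<in> H" using * by auto
    ultimately have "inv k' \<otimes> k = \<one>" "h' \<otimes> inv h = \<one>" using int by auto
    then show "k = k' \<and> h = h'"
      using * by (metis K.mem_carrier H.mem_carrier inv_closed inv_equality inv_inv)
  qed
  moreover have "K <#> H = (\<lambda>(k, h). k \<otimes> h) ` (K \<times> H)" by (auto simp: set_mult_def)
  ultimately show ?thesis by (simp add: card_image card_cartesian_product)
qed

section \<open>The cyclic group generated by an \<open>r\<close>-cycle\<close>

text \<open>For \<open>0 < r\<close>, the bound \<open>1 \<le> x\<close> keeps 0 fixed; 0 marks the
  outside of a tableau and must not be moved.\<close>

definition rot :: "nat \<Rightarrow> nat \<Rightarrow> nat"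
  where "rot r x = (if 1 \<le> x \<and> x < r then Suc x else if x = r then 1 else x)"

lemma rot_permutes:
  assumes "0 < r"
  shows "rot r permutes {1..r}"
proof (rule bij_imp_permutes)
  show "bij_betw (rot r) {1..r} {1..r}"
    using assms by (intro bij_betw_byWitness[of _ "\<lambda>x. if x = 1 then r else x - 1"])
      (auto simp: rot_def)
qed (use assms in \<open>auto simp: rot_def\<close>)

lemma rot_pow_one: "j < r \<Longrightarrow> (rot r ^^ j) 1 = Suc j"
  by (induction j) (auto simp: rot_def)

text \<open>Powers of \<open>rot r\<close> commute and carry 1 to every point of
  \<open>{1..r}\<close>, so it is enough that the \<open>r\<close>-th power fixes 1.\<close>

lemma rot_pow_self:
  assumes "0 < r"
  shows "rot r ^^ r = id"
proof
  fix x
  have "(rot r ^^ r) 1 = rot r ((rot r ^^ (r - 1)) 1)"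
    using assms by (metis Suc_diff_1 funpow.simps(2) o_apply)
  then have one: "(rot r ^^ r) 1 = 1" using assms by (subst (asm) rot_pow_one) (auto simp: rot_def)
  show "(rot r ^^ r) x = id x"
  proof (cases "x \<in> {1..r}")
    case True
    then have "x = (rot r ^^ (x - 1)) 1" by (subst rot_pow_one) auto
    then have "(rot r ^^ r) x = (rot r ^^ (x - 1)) ((rot r ^^ r) 1)"
      by (metis comp_apply funpow_add add.commute)
    then show ?thesis using one \<open>x = (rot r ^^ (x - 1)) 1\<close> by simp
  next
    case False
    then have "(rot r ^^ j) x = x" for j
      using permutes_not_in[OF rot_permutes[OF assms]] by (induction j) auto
    then show ?thesis by simp
  qed
qed

text \<open>With all natural exponents, closure under composition is immediate; for
  \<open>0 < r\<close> the inverses are among these powers.\<close>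

definition rotations :: "nat \<Rightarrow> (nat \<Rightarrow> nat) set"
  where "rotations r = range (\<lambda>j. rot r ^^ j)"

lemma rotations_eq:
  assumes "0 < r"
  shows "rotations r = (\<lambda>j. rot r ^^ j) ` {..<r}"
proof -
  have "rot r ^^ j = rot r ^^ (j mod r)" for j
  proof -
    have "rot r ^^ j = rot r ^^ (r * (j div r) + j mod r)" by simp
    also have "\<dots> = (rot r ^^ r) ^^ (j div r) \<circ> rot r ^^ (j mod r)"
      by (simp only: funpow_add funpow_mult mult.commute)
    finally show ?thesis by (simp add: rot_pow_self[OF assms])
  qed
  then show ?thesis using assms by (force simp: rotations_def)
qed

text \<open>The images \<open>Suc j\<close> of the point 1 tell the first \<open>r\<close> powers
  apart.\<close>

lemma card_rotations:
  assumes "0 < r"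
  shows "card (rotations r) = r"
proof -
  have "inj_on (\<lambda>j. rot r ^^ j) {..<r}"
  proof (rule inj_onI)
    fix i j assume "i \<in> {..<r}" "j \<in> {..<r}" "rot r ^^ i = rot r ^^ j"
    then show "i = j" using rot_pow_one[of i r] rot_pow_one[of j r] by simp
  qed
  then show ?thesis by (simp add: rotations_eq[OF assms] card_image)
qed

lemma rotations_permutes:
  assumes "0 < r" "k \<in> rotations r"
  shows "k permutes {1..r}"
proof -
  have "rot r ^^ j permutes {1..r}" for j
  proof (induction j)
    case (Suc j)
    then show ?case unfolding funpow.simps by (rule permutes_compose[OF _ rot_permutes[OF assms(1)]])
  qed (unfold funpow.simps, rule permutes_id)
  then show ?thesis using assms(2) by (auto simp: rotations_def)
qed

lemma subgroup_rotations:
  assumes "0 < r" "r \<le> n"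
  shows "subgroup (rotations r) (sym_group n)"
proof -
  interpret G: group "sym_group n" by (rule sym_group_is_group)
  show ?thesis
  proof (rule G.subgroupI)
    have "k permutes {1..n}" if "k \<in> rotations r" for k
      using permutes_subset[OF rotations_permutes[OF assms(1) that]] assms(2) by auto
    then show sub: "rotations r \<subseteq> carrier (sym_group n)" by (auto simp: sym_group_carrier)
    show "rotations r \<noteq> {}" by (simp add: rotations_def)
    fix k assume k: "k \<in> rotations r"
    then obtain j where j: "k = rot r ^^ j" by (auto simp: rotations_def)
    \<comment> \<open>The exponents \<open>j * (r - 1)\<close> and \<open>j\<close> add up to a
      multiple of \<open>r\<close>, which exhibits the inverse as a power.\<close>
    have "rot r ^^ (j * (r - 1)) \<circ> k = rot r ^^ (r * j)"
      unfolding j using assms(1) by (simp add: funpow_add[symmetric] algebra_simps)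
    also have "\<dots> = id" unfolding funpow_mult[symmetric] rot_pow_self[OF assms(1)] by simp
    finally have "inv\<^bsub>sym_group n\<^esub> k = rot r ^^ (j * (r - 1))"
      using sub k by (intro G.inv_equality) (auto simp: sym_group_def rotations_def)
    then show "inv\<^bsub>sym_group n\<^esub> k \<in> rotations r" by (simp add: rotations_def)
    fix k' assume "k' \<in> rotations r"
    then show "k \<otimes>\<^bsub>sym_group n\<^esub> k' \<in> rotations r"
      using k by (auto simp: rotations_def sym_group_mult funpow_add[symmetric])
  qed
qed

text \<open>The \<open>r\<close>-th power of the sign of \<open>rot r\<close> is the sign of the
  identity; for odd \<open>r\<close> this excludes the sign -1.\<close>

lemma sign_rotation:
  assumes "odd r" "k \<in> rotations r"
  shows "sign k = 1"
proof -
  have r: "0 < r" using assms(1) by (rule odd_pos)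
  have "permutation (rot r)"
    using rot_permutes[OF r] unfolding permutation_permutes by blast
  then have pow: "permutation (rot r ^^ j) \<and> sign (rot r ^^ j) = sign (rot r) ^ j" for j
    by (induction j) (auto simp: sign_compose permutation_compose sign_id permutation_id id_def[symmetric])
  have "sign (rot r) ^ r = 1" using pow[of r] rot_pow_self[OF r] by (simp add: sign_id)
  then have "sign (rot r) = 1" using assms(1) by (auto simp: sign_def split: if_splits)
  then show ?thesis using pow assms(2) by (auto simp: rotations_def)
qed

text \<open>Among the \<open>p\<close> factors passing from one factorial to the other only
  \<open>k * p\<close> is divisible by \<open>p\<close>, and only once. This is what gives
  \<open>K H\<close> the order of a Sylow subgroup.\<close>

lemma multiplicity_fact_step:
  fixes p k :: nat
  assumes p: "prime p" and k: "0 < k" "\<not> p dvd k"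
  shows "multiplicity p (fact (k * p) :: nat) = Suc (multiplicity p (fact (k * p - p) :: nat))"
proof -
  let ?m = "k * p - p"
  have p1: "1 < p" using p by (rule prime_gt_1_nat)
  have m: "k * p = ?m + p" using k(1) by simp
  have dvd: "p dvd ?m" by simp
  have eq: "multiplicity p (fact (?m + j) :: nat) = multiplicity p (fact ?m :: nat)" if "j < p" for j
    using that
  proof (induction j)
    case (Suc j)
    have "\<not> p dvd Suc j" using Suc.prems by (auto dest: dvd_imp_le)
    then have "\<not> p dvd ?m + Suc j" using dvd_add_right_iff[OF dvd] by blast
    then have "multiplicity p (?m + Suc j) = 0" by (rule not_dvd_imp_multiplicity_0)
    moreover have "(fact (?m + Suc j) :: nat) = (?m + Suc j) * fact (?m + j)" by simp
    ultimately show ?case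
      using Suc p by (subst \<open>fact (?m + Suc j) = _\<close>, subst prime_elem_multiplicity_mult_distrib) auto
  qed simp
  have "multiplicity p (fact (?m + (p - 1)) :: nat) = multiplicity p (fact ?m :: nat)"
    using p1 by (intro eq) simp
  moreover have "(fact (k * p) :: nat) = (k * p) * fact (?m + (p - 1))"
    using m p1 k by (metis Suc_diff_1 add_Suc_right fact_Suc of_nat_id order_less_trans zero_less_one)
  moreover have "multiplicity p (k * p) = 1"
    using p k p1 by (subst prime_elem_multiplicity_mult_distrib)
      (auto simp: not_dvd_imp_multiplicity_0)
  ultimately show ?thesis
    using p k p1 by (simp add: prime_elem_multiplicity_mult_distrib)
qed

section \<open>Relative projectivity\<close>

lemma (in fg_module) act_zero: "g \<in> carrier G \<Longrightarrow> gact M g 0 = 0"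
  using act_sum[of g "{}"] by simp

lemma (in fg_module) zero_mem: "0 \<in> carrier M"
  using subspace_carrier by (rule V.subspace_0)

lemma (in fg_module) act_diff:
  assumes "g \<in> carrier G" "v \<in> carrier M" "w \<in> carrier M"
  shows "gact M g (v - w) = gact M g v - gact M g w"
  using act_add[OF assms(1) V.subspace_diff[OF subspace_carrier assms(2,3)] assms(3)] by simp

text \<open>The summand \<open>x \<otimes> U\<close> of the induced module belonging to the coset \<open>C = x Q\<close> consists of the
  functions supported on \<open>C\<close>; the following is the projection onto it.\<close>

definition coset_part :: "'g set \<Rightarrow> ('g \<Rightarrow> 'v::ab_group_add) \<Rightarrow> 'g \<Rightarrow> 'v"
  where "coset_part C f = (\<lambda>x. if x \<in> C then f x else 0)"

lemma coset_part_add: "coset_part C (f + f') = coset_part C f + coset_part C f'"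
  by (auto simp: coset_part_def)

text \<open>The condition defining the induced module only relates values on the same left coset of
  \<open>Q\<close>, so it survives cutting off outside \<open>C\<close>.\<close>

lemma coset_part_induced:
  assumes "group G" "subgroup Q G" "fg_module (G\<lparr>carrier := Q\<rparr>) U" "C \<in> lcosets\<^bsub>G\<^esub> Q"
    and f: "f \<in> carrier (induced G Q U)"
  shows "coset_part C f \<in> carrier (induced G Q U)"
proof -
  interpret G: group G by fact
  interpret Q: subgroup Q G by fact
  interpret U: fg_module "G\<lparr>carrier := Q\<rparr>" U by fact
  obtain y where y: "y \<in> carrier G" "C = y <#\<^bsub>G\<^esub> Q" using assms(4) by (auto simp: LCOSETS_def)
  have "x \<otimes>\<^bsub>G\<^esub> q \<in> C \<longleftrightarrow> x \<in> C" if "x \<in> carrier G" "q \<in> Q" for x q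
  proof -
    have "inv\<^bsub>G\<^esub> y \<otimes>\<^bsub>G\<^esub> x \<otimes>\<^bsub>G\<^esub> q \<in> Q \<longleftrightarrow> inv\<^bsub>G\<^esub> y \<otimes>\<^bsub>G\<^esub> x \<in> Q"
      using that y Q.mem_carrier Q.m_closed Q.m_inv_closed
      by (metis G.inv_closed G.m_assoc G.m_closed G.r_inv G.r_one)
    then show ?thesis
      using that y Q.subset by (simp add: G.l_coset_mem_translate G.m_assoc subset_iff)
  qed
  then show ?thesis
    using f U.act_zero U.zero_mem by (auto simp: coset_part_def induced_def)
qed

text \<open>The action shifts supports by left translation. From this comes the way in which
  conjugation permutes the maps \<open>\<theta> C\<close> below.\<close>

lemma coset_part_act:
  assumes "group G" "g \<in> carrier G" "C \<subseteq> carrier G"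
  shows "gact (induced G Q U) g (coset_part C f) = coset_part (g <#\<^bsub>G\<^esub> C) (gact (induced G Q U) g f)"
proof -
  interpret G: group G by fact
  have "g <#\<^bsub>G\<^esub> C \<subseteq> carrier G" using assms G.l_coset_subset_G by simp
  then show ?thesis
    using assms G.l_coset_mem_translate[of g _ C] by (auto simp: coset_part_def induced_def fun_eq_iff)
qed

lemma sum_coset_part:
  assumes "group G" "finite (carrier G)" "subgroup Q G" "f \<in> carrier (induced G Q U)"
  shows "(\<Sum>C\<in>lcosets\<^bsub>G\<^esub> Q. coset_part C f) = f"
proof
  fix x
  interpret G: group G by fact
  have fin: "finite (lcosets\<^bsub>G\<^esub> Q)" using assms(2) by (simp add: LCOSETS_def)
  show "(\<Sum>C\<in>lcosets\<^bsub>G\<^esub> Q. coset_part C f) x = f x"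
  proof (cases "x \<in> carrier G")
    case True
    then have xQ: "x <#\<^bsub>G\<^esub> Q \<in> lcosets\<^bsub>G\<^esub> Q" "x \<in> x <#\<^bsub>G\<^esub> Q"
      using G.lcos_self assms(3) by (auto simp: LCOSETS_def)
    then have "coset_part C f x = (if C = x <#\<^bsub>G\<^esub> Q then f x else 0)" if "C \<in> lcosets\<^bsub>G\<^esub> Q" for C
      using G.lcos_disjoint[OF assms(3) that xQ(1)] by (auto simp: coset_part_def)
    moreover note xQ(1)
    ultimately show ?thesis using fin by (simp add: sum_fun_apply)
  next
    case False
    then have "f x = 0" using assms(4) by (simp add: induced_def)
    then show ?thesis by (simp add: sum_fun_apply coset_part_def cong: if_cong)
  qed
qed

section \<open>Relative traces from direct summands\<close>

text \<open>The component \<open>\<pi> f\<close> is the only \<open>u\<close> in \<open>U\<close>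
  with \<open>f - u\<close> in \<open>W\<close>. Each law for \<open>\<pi>\<close> follows by
  checking these two memberships for the proposed value.\<close>

lemma internal_direct_sum_projection:
  assumes "fg_module G N" and sum: "internal_direct_sum G N U W"
  obtains \<pi> where "\<And>f. f \<in> carrier N \<Longrightarrow> \<pi> f \<in> U"
    and "\<And>f. f \<in> U \<Longrightarrow> \<pi> f = f"
    and "\<And>f f'. f \<in> carrier N \<Longrightarrow> f' \<in> carrier N \<Longrightarrow> \<pi> (f + f') = \<pi> f + \<pi> f'"
    and "\<And>g f. g \<in> carrier G \<Longrightarrow> f \<in> carrier N \<Longrightarrow> \<pi> (gact N g f) = gact N g (\<pi> f)"
proof -
  interpret fg_module G N by fact
  have U: "V.subspace U" "U \<subseteq> carrier N" "\<And>g u. g \<in> carrier G \<Longrightarrow> u \<in> U \<Longrightarrow> gact N g u \<in> U"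
    and W: "V.subspace W" "W \<subseteq> carrier N" "\<And>g u. g \<in> carrier G \<Longrightarrow> u \<in> W \<Longrightarrow> gact N g u \<in> W"
    and N: "carrier N = {u + w | u w. u \<in> U \<and> w \<in> W}" and UW: "U \<inter> W = {0}"
    using sum by (auto simp: internal_direct_sum_def fg_submodule_def)
  define \<pi> where "\<pi> f = (SOME u. u \<in> U \<and> f - u \<in> W)" for f
  have \<pi>: "\<pi> f \<in> U \<and> f - \<pi> f \<in> W" if f: "f \<in> carrier N" for f
  proof -
    obtain u w where "f = u + w" "u \<in> U" "w \<in> W" using f N by auto
    then have "\<exists>u. u \<in> U \<and> f - u \<in> W" by (intro exI[of _ u]) simp
    then show ?thesis unfolding \<pi>_def by (rule someI_ex)
  qed
  have uniq: "\<pi> f = u" if "u \<in> U" "f - u \<in> W" for f u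
  proof -
    have "f \<in> carrier N"
      unfolding N using that by (intro CollectI exI[of _ u] exI[of _ "f - u"]) simp
    then have *: "\<pi> f \<in> U" "f - \<pi> f \<in> W" using \<pi> by auto
    have "\<pi> f - u \<in> U" using V.subspace_diff[OF U(1) *(1) that(1)] .
    moreover have "\<pi> f - u = (f - u) - (f - \<pi> f)" by simp
    then have "\<pi> f - u \<in> W" using V.subspace_diff[OF W(1) that(2) *(2)] by simp
    ultimately have "\<pi> f - u \<in> {0}" unfolding UW[symmetric] by blast
    then show ?thesis by simp
  qed
  show thesis
  proof (rule that[of \<pi>])
    show "\<pi> f \<in> U" if "f \<in> carrier N" for f using \<pi> that by blast
    show "\<pi> f = f" if "f \<in> U" for f using that V.subspace_0[OF W(1)] by (intro uniq) auto
    show "\<pi> (f + f') = \<pi> f + \<pi> f'" if "f \<in> carrier N" "f' \<in> carrier N" for f f'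
    proof (rule uniq)
      show "\<pi> f + \<pi> f' \<in> U" using \<pi> that V.subspace_add[OF U(1)] by blast
      have "f + f' - (\<pi> f + \<pi> f') = (f - \<pi> f) + (f' - \<pi> f')" by simp
      then show "f + f' - (\<pi> f + \<pi> f') \<in> W" using \<pi> that V.subspace_add[OF W(1)] by metis
    qed
    show "\<pi> (gact N g f) = gact N g (\<pi> f)" if "g \<in> carrier G" "f \<in> carrier N" for g f
    proof (rule uniq)
      show "gact N g (\<pi> f) \<in> U" using \<pi> that U by blast
      have "gact N g f - gact N g (\<pi> f) = gact N g (f - \<pi> f)"
        using \<pi> that U by (intro act_diff[symmetric]) auto
      then show "gact N g f - gact N g (\<pi> f) \<in> W" using \<pi> that W by simp
    qed
  qed
qed

text \<open>One direction of Higman's criterion: the identity of \<open>M\<close> is the sum of the \<open>G\<close>-conjugates of an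
  \<open>R\<close>-endomorphism \<open>\<theta> R\<close>.\<close>

lemma summand_of_induced_trace:
  fixes M :: "('f::field, 'g, 'v::ab_group_add) gmod"
  assumes "group G" "finite (carrier G)" "subgroup R G" "fg_module G M" "summand_of_induced G R M"
  obtains \<theta> :: "'g set \<Rightarrow> 'v \<Rightarrow> 'v"
  where "\<And>C m. C \<in> lcosets\<^bsub>G\<^esub> R \<Longrightarrow> m \<in> carrier M \<Longrightarrow> \<theta> C m \<in> carrier M"
    and "\<And>C m m'. C \<in> lcosets\<^bsub>G\<^esub> R \<Longrightarrow> m \<in> carrier M \<Longrightarrow> m' \<in> carrier M \<Longrightarrow>
      \<theta> C (m + m') = \<theta> C m + \<theta> C m'"
    and "\<And>g C m. g \<in> carrier G \<Longrightarrow> C \<in> lcosets\<^bsub>G\<^esub> R \<Longrightarrow> m \<in> carrier M \<Longrightarrow>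
      gact M g (\<theta> C m) = \<theta> (g <#\<^bsub>G\<^esub> C) (gact M g m)"
    and "\<And>m. m \<in> carrier M \<Longrightarrow> (\<Sum>C\<in>lcosets\<^bsub>G\<^esub> R. \<theta> C m) = m"
proof -
  interpret G: group G by fact
  interpret M: fg_module G M by fact
  obtain U :: "('f, 'g, nat \<Rightarrow> 'f) gmod" and X Y where
    U: "fg_module (G\<lparr>carrier := R\<rparr>) U" and XY: "internal_direct_sum G (induced G R U) X Y"
    and iso: "fg_isomorphic G M ((induced G R U)\<lparr>carrier := X\<rparr>)"
    using assms(5) unfolding summand_of_induced_def direct_summand_def by blast
  let ?I = "induced G R U"
  interpret I: fg_module G ?I by (rule induced_fg_module) fact+
  obtain \<pi> where \<pi>X: "\<And>f. f \<in> carrier ?I \<Longrightarrow> \<pi> f \<in> X" and \<pi>id: "\<And>f. f \<in> X \<Longrightarrow> \<pi> f = f"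
    and \<pi>add: "\<And>f f'. f \<in> carrier ?I \<Longrightarrow> f' \<in> carrier ?I \<Longrightarrow> \<pi> (f + f') = \<pi> f + \<pi> f'"
    and \<pi>act: "\<And>g f. g \<in> carrier G \<Longrightarrow> f \<in> carrier ?I \<Longrightarrow> \<pi> (gact ?I g f) = gact ?I g (\<pi> f)"
    by (rule internal_direct_sum_projection[OF I.fg_module_axioms XY]) (rule that)
  obtain h where h: "h \<in> fg_hom G M (?I\<lparr>carrier := X\<rparr>)" and bij: "bij_betw h (carrier M) X"
    using iso by (auto simp: fg_isomorphic_def)
  have hX: "h m \<in> X" and hadd: "h (m + m') = h m + h m'"
    and hact: "g \<in> carrier G \<Longrightarrow> h (gact M g m) = gact ?I g (h m)"
    if "m \<in> carrier M" "m' \<in> carrier M" for m m' g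
    using h that by (auto simp: fg_hom_def)
  have XI: "X \<subseteq> carrier ?I" using XY by (auto simp: internal_direct_sum_def fg_submodule_def)
  \<comment> \<open>The inverse of the embedding \<open>h\<close>, from the summand \<open>X\<close>
    back to \<open>M\<close>.\<close>
  define k where "k = the_inv_into (carrier M) h"
  have kM: "k x \<in> carrier M" and hk: "h (k x) = x" if "x \<in> X" for x
    using that bij the_inv_into_into[of h "carrier M" x "carrier M"] f_the_inv_into_f[of h "carrier M" x]
    by (auto simp: k_def bij_betw_def)
  have kh: "k (h m) = m" if "m \<in> carrier M" for m
    using that bij the_inv_into_f_f[of h "carrier M" m] by (auto simp: k_def bij_betw_def)
  have Madd: "m + m' \<in> carrier M" if "m \<in> carrier M" "m' \<in> carrier M" for m m'
    using that M.V.subspace_add[OF M.subspace_carrier] by blast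
  have kadd: "k (x + x') = k x + k x'" if "x \<in> X" "x' \<in> X" for x x'
    using that kh[OF Madd[OF kM kM]] hadd[OF kM kM] by (simp add: hk)
  have kact: "k (gact ?I g x) = gact M g (k x)" if "x \<in> X" "g \<in> carrier G" for x g
    using that kh[OF M.act_closed[OF _ kM]] hact[OF kM kM] by (simp add: hk)
  \<comment> \<open>Embed \<open>m\<close> in the induced module, keep the part over
    \<open>C\<close>, project to \<open>X\<close> and return to \<open>M\<close>. All maps but the
    cutting off commute with \<open>G\<close>, and that one translates \<open>C\<close>.\<close>
  define \<theta> where "\<theta> C m = k (\<pi> (coset_part C (h m)))" for C m
  have hI: "h m \<in> carrier ?I" if "m \<in> carrier M" for m using that hX XI by blast
  have cI: "coset_part C (h m) \<in> carrier ?I" if "C \<in> lcosets\<^bsub>G\<^esub> R" "m \<in> carrier M" for C m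
    using that by (intro coset_part_induced[OF assms(1,3) U] hI)
  show thesis
  proof (rule that[of \<theta>])
    show "\<theta> C m \<in> carrier M" if "C \<in> lcosets\<^bsub>G\<^esub> R" "m \<in> carrier M" for C m
      unfolding \<theta>_def using that by (intro kM \<pi>X cI)
    show "\<theta> C (m + m') = \<theta> C m + \<theta> C m'"
      if "C \<in> lcosets\<^bsub>G\<^esub> R" "m \<in> carrier M" "m' \<in> carrier M" for C m m'
      using that by (simp add: \<theta>_def hadd coset_part_add \<pi>add cI kadd \<pi>X)
    show "gact M g (\<theta> C m) = \<theta> (g <#\<^bsub>G\<^esub> C) (gact M g m)"
      if "g \<in> carrier G" "C \<in> lcosets\<^bsub>G\<^esub> R" "m \<in> carrier M" for g C m
    proof -
      have "C \<subseteq> carrier G" using that G.lcosets_subset_PowG[OF assms(3)] by auto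
      then show ?thesis
        using that by (simp add: \<theta>_def hact coset_part_act[OF assms(1), symmetric] \<pi>act cI kact \<pi>X)
    qed
    show "(\<Sum>C\<in>lcosets\<^bsub>G\<^esub> R. \<theta> C m) = m" if m: "m \<in> carrier M" for m
    proof -
      \<comment> \<open>Membership is carried through the induction because \<open>\<pi>\<close> is
        known to be additive only on the induced module.\<close>
      have "(\<Sum>C\<in>D. coset_part C (h m)) \<in> carrier ?I \<and>
          (\<Sum>C\<in>D. \<theta> C m) = k (\<pi> (\<Sum>C\<in>D. coset_part C (h m)))"
        if "finite D" "D \<subseteq> lcosets\<^bsub>G\<^esub> R" for D
        using that
      proof (induction D)
        case empty
        have "X \<noteq> {}" "0 \<in> X" using XY I.V.subspace_0 by (auto simp: internal_direct_sum_def fg_submodule_def)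
        moreover from this have "k 0 = 0" using kadd[of 0 0] by simp
        ultimately show ?case using I.zero_mem \<pi>id by (simp add: zero_fun_def)
      next
        case (insert C D)
        let ?c = "coset_part C (h m)" and ?s = "\<Sum>C\<in>D. coset_part C (h m)"
        have mem: "?c \<in> carrier ?I" "?s \<in> carrier ?I" using insert cI[OF _ m] by auto
        have "k (\<pi> (?c + ?s)) = k (\<pi> ?c) + k (\<pi> ?s)"
          unfolding \<pi>add[OF mem] by (intro kadd \<pi>X mem)
        moreover have "?c + ?s \<in> carrier ?I"
          using I.V.subspace_add[OF I.subspace_carrier mem] .
        ultimately show ?case
          unfolding sum.insert[OF insert.hyps] using insert by (metis \<theta>_def insert_subset)
      qed
      moreover have "finite (lcosets\<^bsub>G\<^esub> R)" using assms(2) by (simp add: LCOSETS_def)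
      ultimately have "(\<Sum>C\<in>lcosets\<^bsub>G\<^esub> R. \<theta> C m) = k (\<pi> (\<Sum>C\<in>lcosets\<^bsub>G\<^esub> R. coset_part C (h m)))"
        by blast
      then show ?thesis
        using sum_coset_part[OF assms(1-3) hI[OF m]] m by (simp add: \<pi>id hX kh)
    qed
  qed
qed

section \<open>Projectivity relative to a subgroup of invertible index\<close>

text \<open>\<open>M\<close> maps by \<open>i\<close> into the module induced from its own
  restriction, and \<open>H\<close> maps back. The composite is multiplication by the index;
  dividing by it splits \<open>i\<close>.\<close>

lemma summand_of_induced_if_index_invertible:
  fixes M :: "('f::field, 'g, 'v::ab_group_add) gmod"
  assumes "group G" "finite (carrier G)" "subgroup Q G" "fg_module G M"
    and index: "of_nat (card (lcosets\<^bsub>G\<^esub> Q)) \<noteq> (0::'f)"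
  shows "summand_of_induced G Q M"
proof -
  interpret G: group G by fact
  interpret Q: subgroup Q G by fact
  interpret M: fg_module G M by fact
  have "fg_module (G\<lparr>carrier := Q\<rparr>) M"
    using M.subspace_carrier M.finite_dim M.act_closed M.act_add M.act_scale M.act_one M.act_mult
      Q.mem_carrier G.subgroup_imp_group[OF assms(3)] M.V.vector_space_axioms
    by (intro fg_module.intro fg_module_axioms.intro) simp_all
  \<comment> \<open>\<open>U\<close> is a copy of the restriction of \<open>M\<close> to
    \<open>Q\<close> in the ambient space that \<open>summand_of_induced\<close> prescribes;
    \<open>e\<close> and \<open>d\<close> translate between the two.\<close>
  then obtain U :: "('f, 'g, nat \<Rightarrow> 'f) gmod" where
    U: "fg_module (G\<lparr>carrier := Q\<rparr>) U" and iso: "fg_isomorphic (G\<lparr>carrier := Q\<rparr>) M U"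
    using fg_module_isomorphic_copy by blast
  interpret U: fg_module "G\<lparr>carrier := Q\<rparr>" U by fact
  let ?I = "induced G Q U"
  interpret I: fg_module G ?I by (rule induced_fg_module) fact+
  obtain e where e: "e \<in> fg_hom (G\<lparr>carrier := Q\<rparr>) M U" "bij_betw e (carrier M) (carrier U)"
    using iso by (auto simp: fg_isomorphic_def)
  have eU: "e m \<in> carrier U" and eadd: "e (m + m') = e m + e m'"
    and esc: "e (gscale M c m) = gscale U c (e m)"
    and eact: "q \<in> Q \<Longrightarrow> e (gact M q m) = gact U q (e m)"
    if "m \<in> carrier M" "m' \<in> carrier M" for m m' c q
    using e(1) that by (auto simp: fg_hom_def)
  define d where "d = the_inv_into (carrier M) e"
  have dM: "d u \<in> carrier M" and ed: "e (d u) = u" if "u \<in> carrier U" for u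
    using that e(2) the_inv_into_into[of e "carrier M" u "carrier M"] f_the_inv_into_f[of e "carrier M" u]
    by (auto simp: d_def bij_betw_def)
  have de: "d (e m) = m" if "m \<in> carrier M" for m
    using that e(2) the_inv_into_f_f[of e "carrier M" m] by (auto simp: d_def bij_betw_def)
  have Madd: "m + m' \<in> carrier M" if "m \<in> carrier M" "m' \<in> carrier M" for m m'
    using that M.V.subspace_add[OF M.subspace_carrier] by blast
  have Msc: "gscale M c m \<in> carrier M" if "m \<in> carrier M" for m c
    using that M.V.subspace_scale[OF M.subspace_carrier] by blast
  have "d (u + u') = d u + d u'" if "u \<in> carrier U" "u' \<in> carrier U" for u u'
    using that de[OF Madd[OF dM dM]] eadd[OF dM dM] by (simp add: ed)
  moreover have "d (gscale U c u) = gscale M c (d u)" if "u \<in> carrier U" for c u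
    using that de[OF Msc[OF dM]] esc[OF dM dM] by (simp add: ed)
  moreover have "d (gact U q u) = gact M q (d u)" if "u \<in> carrier U" "q \<in> Q" for u q
    using that de[OF M.act_closed[OF _ dM], of q u] eact[OF dM dM, of u u q] by (simp add: ed Q.mem_carrier)
  ultimately have "d \<in> fg_hom (G\<lparr>carrier := Q\<rparr>) U M"
    by (auto simp: fg_hom_def dM)
  \<comment> \<open>\<open>H\<close> is the map
    \<open>x \<otimes> u \<mapsto> x (d u)\<close>.\<close>
  then obtain H where H: "H \<in> fg_hom G ?I M" and H\<iota>: "\<And>u. u \<in> carrier U \<Longrightarrow> H (induced_inj G Q U u) = d u"
    and \<iota>: "induced_inj G Q U \<in> fg_hom (G\<lparr>carrier := Q\<rparr>) U ?I"
    using induced_universal[OF assms(1-3) U assms(4)] by blast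
  have HM: "H f \<in> carrier M" and Hadd: "H (f + f') = H f + H f'"
    and Hsc: "H (gscale ?I c f) = gscale M c (H f)"
    and Hact: "g \<in> carrier G \<Longrightarrow> H (gact ?I g f) = gact M g (H f)"
    if "f \<in> carrier ?I" "f' \<in> carrier ?I" for f f' c g
    using H that unfolding fg_hom_def by blast+
  \<comment> \<open>\<open>i m\<close> stands for the sum of \<open>x \<otimes> e (inv x m)\<close>
    over representatives \<open>x\<close> of the cosets.\<close>
  define i where "i m = (\<lambda>x. if x \<in> carrier G then e (gact M (inv\<^bsub>G\<^esub> x) m) else 0)" for m
  have iI: "i m \<in> carrier ?I" if m: "m \<in> carrier M" for m
  proof -
    have "e (gact M (inv\<^bsub>G\<^esub> (x \<otimes>\<^bsub>G\<^esub> q)) m) = gact U (inv\<^bsub>G\<^esub> q) (e (gact M (inv\<^bsub>G\<^esub> x) m))"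
      if "x \<in> carrier G" "q \<in> Q" for x q
      using that m M.act_closed[of "inv\<^bsub>G\<^esub> x" m]
      by (simp add: G.inv_mult_group M.act_mult eact[symmetric] Q.mem_carrier)
    then show ?thesis
      using m by (auto simp: i_def induced_def intro!: eU M.act_closed)
  qed
  have iadd: "i (m + m') = i m + i m'" if "m \<in> carrier M" "m' \<in> carrier M" for m m'
    using that by (auto simp: i_def fun_eq_iff M.act_add eadd M.act_closed)
  have isc: "i (gscale M c m) = gscale ?I c (i m)" if "m \<in> carrier M" for m c
    using that esc M.act_closed
    by (auto simp: i_def fun_eq_iff M.act_scale induced_def U.V.scale_zero_right)
  have iact: "i (gact M g m) = gact ?I g (i m)" if "m \<in> carrier M" "g \<in> carrier G" for m g
    using that by (auto simp: i_def fun_eq_iff induced_def G.inv_mult_group M.act_mult)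
  have H0: "H 0 = 0" using Hadd[OF I.zero_mem I.zero_mem] by simp
  have Hi: "H (i m) = gscale M (of_nat (card (lcosets\<^bsub>G\<^esub> Q))) m" if m: "m \<in> carrier M" for m
  proof -
    \<comment> \<open>The part over \<open>t Q\<close> is \<open>t \<otimes> e (inv t m)\<close>,
      which \<open>H\<close> sends to \<open>t (inv t m) = m\<close>; each coset thus contributes
      one \<open>m\<close>.\<close>
    have part: "coset_part C (i m) \<in> carrier ?I" "H (coset_part C (i m)) = m"
      if C: "C \<in> lcosets\<^bsub>G\<^esub> Q" for C
    proof -
      obtain t where t: "t \<in> carrier G" "C = t <#\<^bsub>G\<^esub> Q" using C by (auto simp: LCOSETS_def)
      let ?u = "e (gact M (inv\<^bsub>G\<^esub> t) m)"
      have u: "?u \<in> carrier U" using t m by (intro eU M.act_closed) auto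
      have \<iota>u: "induced_inj G Q U ?u \<in> carrier ?I" using \<iota> u by (auto simp: fg_hom_def)
      have "coset_part C (i m) = gact ?I t (induced_inj G Q U ?u)"
      proof
        fix x
        show "coset_part C (i m) x = gact ?I t (induced_inj G Q U ?u) x"
        proof (cases "x \<in> carrier G \<and> inv\<^bsub>G\<^esub> t \<otimes>\<^bsub>G\<^esub> x \<in> Q")
          case True
          define q where "q = inv\<^bsub>G\<^esub> t \<otimes>\<^bsub>G\<^esub> x"
          have q: "q \<in> Q" using True q_def by simp
          have "inv\<^bsub>G\<^esub> x = inv\<^bsub>G\<^esub> q \<otimes>\<^bsub>G\<^esub> inv\<^bsub>G\<^esub> t"
            using True t by (simp add: q_def G.inv_mult_group G.m_assoc)
          then have "e (gact M (inv\<^bsub>G\<^esub> x) m) = gact U (inv\<^bsub>G\<^esub> q) ?u"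
            using q t m by (simp add: M.act_mult eact[symmetric] M.act_closed Q.mem_carrier)
          then show ?thesis
            using True t q Q.subset
            by (simp add: coset_part_def i_def induced_def induced_inj_def G.l_coset_mem_translate
                flip: q_def)
        next
          case False
          have "C \<subseteq> carrier G" using C G.lcosets_subset_PowG[OF assms(3)] by auto
          then show ?thesis
            using False t Q.subset G.l_coset_mem_translate[of t x Q]
            by (auto simp: coset_part_def i_def induced_def induced_inj_def)
        qed
      qed
      moreover have "H (gact ?I t (induced_inj G Q U ?u)) = m"
        using t m M.act_closed
        by (simp add: Hact[OF \<iota>u \<iota>u] H\<iota>[OF u] de M.act_mult[symmetric] M.act_one)
      ultimately show "coset_part C (i m) \<in> carrier ?I" "H (coset_part C (i m)) = m"
        using I.act_closed[OF t(1) \<iota>u] by simp_all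
    qed
    have "(\<Sum>C\<in>D. coset_part C (i m)) \<in> carrier ?I \<and>
        H (\<Sum>C\<in>D. coset_part C (i m)) = gscale M (of_nat (card D)) m"
      if "finite D" "D \<subseteq> lcosets\<^bsub>G\<^esub> Q" for D
      using that
    proof (induction D)
      case empty
      then show ?case using I.zero_mem H0 by (simp add: zero_fun_def)
    next
      case (insert C D)
      let ?c = "coset_part C (i m)" and ?s = "\<Sum>C\<in>D. coset_part C (i m)"
      have mem: "?c \<in> carrier ?I" "?s \<in> carrier ?I" using insert part by auto
      have "H (?c + ?s) = m + gscale M (of_nat (card D)) m"
        unfolding Hadd[OF mem] using insert part by auto
      also have "\<dots> = gscale M (of_nat (card (insert C D))) m"
        using insert.hyps by (simp add: M.V.scale_left_distrib)
      finally show ?case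
        unfolding sum.insert[OF insert.hyps] using I.V.subspace_add[OF I.subspace_carrier mem] by blast
    qed
    moreover have "finite (lcosets\<^bsub>G\<^esub> Q)" using assms(2) by (simp add: LCOSETS_def)
    ultimately have "H (\<Sum>C\<in>lcosets\<^bsub>G\<^esub> Q. coset_part C (i m)) = gscale M (of_nat (card (lcosets\<^bsub>G\<^esub> Q))) m"
      by blast
    then show ?thesis using sum_coset_part[OF assms(1-3) iI[OF m]] by simp
  qed
  define r where "r = (of_nat (card (lcosets\<^bsub>G\<^esub> Q)) :: 'f)"
  have r: "r \<noteq> 0" using index by (simp add: r_def)
  have Hi_cancel: "gscale M (inverse r) (H (i m)) = m" if "m \<in> carrier M" for m
    using that r Hi by (simp add: r_def)
  define X where "X = i ` carrier M"
  define Y where "Y = {f \<in> carrier ?I. H f = 0}"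
  have "internal_direct_sum G ?I X Y"
    unfolding internal_direct_sum_def fg_submodule_def
  proof (intro conjI ballI)
    have i0: "i 0 = 0" using iadd[OF M.zero_mem M.zero_mem] by simp
    show "I.V.subspace X"
      unfolding I.V.subspace_def X_def
      using i0 M.zero_mem by (auto simp: iadd[symmetric] isc[symmetric] Madd Msc intro!: imageI)
    show "X \<subseteq> carrier ?I" using iI by (auto simp: X_def)
    show "gact ?I g w \<in> X" if "g \<in> carrier G" "w \<in> X" for g w
      using that iact M.act_closed by (auto simp: X_def image_iff) (metis)
    show "I.V.subspace Y"
      unfolding I.V.subspace_def Y_def
      using I.subspace_carrier H0 Hadd Hsc by (auto simp: I.V.subspace_def)
    show "Y \<subseteq> carrier ?I" by (auto simp: Y_def)
    show "gact ?I g w \<in> Y" if "g \<in> carrier G" "w \<in> Y" for g w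
      using that Hact I.act_closed M.act_zero by (auto simp: Y_def)
    show "X \<inter> Y = {0}"
    proof -
      have "i m = 0" if "m \<in> carrier M" "H (i m) = 0" for m
        using Hi_cancel[OF that(1)] that i0 by simp
      then show ?thesis using i0 M.zero_mem I.zero_mem H0 by (auto simp: X_def Y_def image_iff)
    qed
    show "carrier ?I = {x + y | x y. x \<in> X \<and> y \<in> Y}"
    proof (intro equalityI subsetI)
      fix f assume f: "f \<in> carrier ?I"
      \<comment> \<open>The value at \<open>f\<close> of the retraction for \<open>i\<close>, so
        that \<open>f - i ?m\<close> is killed by \<open>H\<close>.\<close>
      let ?m = "gscale M (inverse r) (H f)"
      have m: "?m \<in> carrier M" using f HM Msc by blast
      have d: "f - i ?m \<in> carrier ?I" using I.V.subspace_diff[OF I.subspace_carrier f iI[OF m]] .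
      have "H f = H (f - i ?m) + H (i ?m)" using Hadd[OF d iI[OF m]] by simp
      moreover have "H (i ?m) = H f" using Hi[OF m] r by (simp add: r_def)
      ultimately have "f - i ?m \<in> Y" using d by (simp add: Y_def)
      moreover have "i ?m \<in> X" using m by (simp add: X_def)
      moreover have "f = i ?m + (f - i ?m)" by simp
      ultimately show "f \<in> {x + y | x y. x \<in> X \<and> y \<in> Y}" by blast
    next
      fix f assume "f \<in> {x + y | x y. x \<in> X \<and> y \<in> Y}"
      then show "f \<in> carrier ?I"
        using iI I.V.subspace_add[OF I.subspace_carrier] by (auto simp: X_def Y_def)
    qed
  qed
  moreover have "fg_isomorphic G M (?I\<lparr>carrier := X\<rparr>)"
    unfolding fg_isomorphic_def
  proof (intro bexI[of _ i])
    show "bij_betw i (carrier M) (carrier (?I\<lparr>carrier := X\<rparr>))"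
      using Hi_cancel by (auto simp: bij_betw_def X_def intro!: inj_onI) metis
    show "i \<in> fg_hom G M (?I\<lparr>carrier := X\<rparr>)"
      by (auto simp: fg_hom_def X_def iadd isc iact)
  qed
  ultimately show ?thesis
    using U unfolding summand_of_induced_def direct_summand_def by blast
qed

section \<open>Polytabloids of hook shape\<close>

lemma exists_permutation_matching:
  assumes f: "bij_betw f I A" and g: "bij_betw g I A"
  obtains \<sigma> where "\<sigma> permutes A" "\<And>i. i \<in> I \<Longrightarrow> \<sigma> (f i) = g i"
proof -
  define \<sigma> where "\<sigma> x = (if x \<in> A then g (the_inv_into I f x) else x)" for x
  show thesis
  proof (rule that)
    have "bij_betw (g \<circ> the_inv_into I f) A A"
      using bij_betw_the_inv_into[OF f] g by (rule bij_betw_trans)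
    then have "bij_betw \<sigma> A A" by (rule iffD1[OF bij_betw_cong, rotated]) (simp add: \<sigma>_def)
    then show "\<sigma> permutes A" by (rule bij_imp_permutes) (simp add: \<sigma>_def)
    show "\<sigma> (f i) = g i" if "i \<in> I" for i
      using that f by (auto simp: \<sigma>_def bij_betw_def the_inv_into_f_f)
  qed
qed

lemma tableaux_transitive:
  assumes "s \<in> tableaux l" "t \<in> tableaux l"
  obtains \<sigma> where "\<sigma> permutes {1..sum_list l}" "s = \<sigma> \<circ> t"
proof -
  have b: "bij_betw t (diagram l) {1..sum_list l}" "bij_betw s (diagram l) {1..sum_list l}"
    using assms by (auto simp: tableaux_def)
  obtain \<sigma> where \<sigma>: "\<sigma> permutes {1..sum_list l}" "\<And>x. x \<in> diagram l \<Longrightarrow> \<sigma> (t x) = s x"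
    using exists_permutation_matching[OF b] by blast
  have "s x = (\<sigma> \<circ> t) x" for x
  proof (cases "x \<in> diagram l")
    case True
    then show ?thesis using \<sigma>(2) by simp
  next
    case False
    \<comment> \<open>Outside the diagram both tableaux are 0, and \<sigma> fixes 0.\<close>
    then have "s x = 0" "t x = 0" using assms unfolding tableaux_def by blast+
    then show ?thesis using permutes_not_in[OF \<sigma>(1), of 0] by simp
  qed
  then show thesis using that \<sigma>(1) by blast
qed

lemma image_comp_eq_iff:
  assumes "g permutes {1..n::nat}"
  shows "T = (\<circ>) g ` X \<longleftrightarrow> (\<circ>) (inv' g) ` T = (X :: tabloid)"
proof -
  have "(\<circ>) g ` (\<circ>) (inv' g) ` T = T" "(\<circ>) (inv' g) ` (\<circ>) g ` X = X"
    using permutes_inv_o[OF assms] by (auto simp: image_image comp_assoc[symmetric])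
  then show ?thesis by auto
qed

text \<open>The action read off in coefficients: the sum in the definition of \<open>gact\<close>
  keeps only the preimage of \<open>T\<close> under \<open>g\<close>.\<close>

lemma tabloid_module_act_apply:
  assumes g: "g permutes {1..sum_list l}" and T: "T \<in> tabloids l"
  shows "gact (tabloid_module l :: ('f::field, _, _) gmod) g v T = v ((\<circ>) (inv' g) ` T)"
proof -
  have "gact (tabloid_module l :: ('f, _, _) gmod) g v T =
      (\<Sum>X\<in>tabloids l. if X = (\<circ>) (inv' g) ` T then v X else 0)"
    unfolding tabloid_module_def gmod.select_convs sum_fun_apply
    using image_comp_eq_iff[OF g, of T] by (intro sum.cong) (auto simp: basis_vec_def)
  then show ?thesis
    using finite_tabloids tabloids_act[OF permutes_inv[OF g] T] by simp
qed

lemma gscale_tabloid_module: "gscale (tabloid_module l) c v = (\<lambda>T. c * v T)"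
  by (simp add: tabloid_module_def)

lemma gscale_specht_module: "gscale (specht_module l) = gscale (tabloid_module l)"
  and gact_specht_module: "gact (specht_module l) = gact (tabloid_module l)"
  by (simp_all add: specht_module_def)

lemma specht_subset_tabloid_module:
  "carrier (specht_module l :: ('f::field, _, _) gmod) \<subseteq> carrier (tabloid_module l)"
  using specht_submodule[of l, where 'f='f] by (simp add: fg_submodule_def)

lemma polytabloid_in_specht:
  assumes "t \<in> tableaux l"
  shows "(polytabloid l t :: _ \<Rightarrow> 'f::field) \<in> carrier (specht_module l)"
proof -
  interpret fg_module "sym_group (sum_list l)" "tabloid_module l :: ('f, _, _) gmod"
    by (rule tabloid_module_fg_module)
  show ?thesis using assms by (auto simp: specht_module_def intro: V.span_base)
qed

text \<open>Permutations act transitively on tableaux and carry polytabloids to polytabloids, so one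
  polytabloid generates the module.\<close>

lemma specht_generated_by_polytabloid:
  fixes W :: "(tabloid \<Rightarrow> 'f::field) set"
  assumes W: "fg_submodule (sym_group (sum_list l)) (specht_module l) W"
    and t: "t \<in> tableaux l" "polytabloid l t \<in> W"
  shows "W = carrier (specht_module l)"
proof
  let ?M = "tabloid_module l :: ('f, _, _) gmod"
  interpret M: fg_module "sym_group (sum_list l)" ?M by (rule tabloid_module_fg_module)
  show "W \<subseteq> carrier (specht_module l)" using W by (simp add: fg_submodule_def)
  have "polytabloid l s \<in> W" if s: "s \<in> tableaux l" for s
  proof -
    obtain \<sigma> where \<sigma>: "\<sigma> permutes {1..sum_list l}" "s = \<sigma> \<circ> t"
      by (rule tableaux_transitive[OF s t(1)])
    have "gact ?M \<sigma> (polytabloid l t) \<in> W"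
      using W \<sigma>(1) t(2) unfolding fg_submodule_def gact_specht_module sym_group_carrier[symmetric] by blast
    then show ?thesis unfolding polytabloid_act[OF \<sigma>(1) t(1)] \<sigma>(2) .
  qed
  moreover have "M.V.subspace W" using W by (simp add: fg_submodule_def gscale_specht_module)
  ultimately have "M.V.span (polytabloid l ` tableaux l) \<subseteq> W"
    by (intro M.V.span_minimal) auto
  then show "carrier (specht_module l) \<subseteq> W" by (simp add: specht_module_def)
qed

section \<open>Tableaux and tabloids of hook shape\<close>

text \<open>The hook \<open>(m, 1^r)\<close> of \<open>m + r\<close>, where \<open>m\<close> counts
  the corner. The theorem takes \<open>m = k * p - p\<close> and \<open>r = p\<close>.\<close>

locale hook =
  fixes m r :: nat
  assumes m_pos: "0 < m"
begin

definition shape :: "nat list" where "shape = m # replicate r 1"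

text \<open>The corner is left out here and included in \<open>col\<close>: the leg entries, in
  their order, determine the tabloid, while \<open>col\<close> is what the column stabilizer
  permutes.\<close>

definition leg :: "tableau \<Rightarrow> nat set" where "leg t = (\<lambda>i. t (i, 0)) ` {1..r}"

definition col :: "tableau \<Rightarrow> nat set" where "col t = (\<lambda>i. t (i, 0)) ` {0..r}"

lemma sum_list_shape: "sum_list shape = m + r"
  by (simp add: shape_def sum_list_replicate)

lemma diagram_shape: "diagram shape = {0} \<times> {..<m} \<union> {1..r} \<times> {0}"
proof -
  have "(i, j) \<in> diagram shape \<longleftrightarrow> (i, j) \<in> {0} \<times> {..<m} \<union> {1..r} \<times> {0}" for i j
    by (cases i) (auto simp: shape_def diagram_def)
  then show ?thesis by (intro equalityI subrelI) blast+
qed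

lemma first_column_in_diagram: "i \<le> r \<Longrightarrow> (i, 0) \<in> diagram shape"
  unfolding diagram_shape using m_pos by (cases "i = 0") simp_all

lemma col_eq: "col t = insert (t (0, 0)) (leg t)"
proof -
  have "{0..r} = insert 0 {1..r}" by auto
  then show ?thesis by (simp add: col_def leg_def)
qed

lemma col_comp: "col (s \<circ> t) = s ` col t"
  by (simp add: col_def image_image)

lemma finite_col: "finite (col t)"
  by (simp add: col_def)

context
  fixes t assumes t: "t \<in> tableaux shape"
begin

lemma tableau_bij: "bij_betw t (diagram shape) {1..m + r}"
  using t by (auto simp: tableaux_def sum_list_shape)

lemma tableau_inj: "x \<in> diagram shape \<Longrightarrow> y \<in> diagram shape \<Longrightarrow> t x = t y \<longleftrightarrow> x = y"
  using inj_on_eq_iff[OF bij_betw_imp_inj_on[OF tableau_bij]] .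

lemma col_subset: "col t \<subseteq> {1..m + r}"
proof
  fix x assume "x \<in> col t"
  then obtain i where "i \<le> r" "x = t (i, 0)" by (auto simp: col_def)
  then show "x \<in> {1..m + r}" using bij_betw_apply[OF tableau_bij first_column_in_diagram] by blast
qed

lemma inj_on_first_column: "inj_on (\<lambda>i. t (i, 0)) {0..r}"
proof (rule inj_onI)
  fix i j assume *: "i \<in> {0..r}" "j \<in> {0..r}" and eq: "t (i, 0) = t (j, 0)"
  have "(i, 0) \<in> diagram shape" "(j, 0) \<in> diagram shape"
    using * by (simp_all add: first_column_in_diagram)
  then have "(i, 0 :: nat) = (j, 0)" using tableau_inj eq by blast
  then show "i = j" by simp
qed

lemma col_bij: "bij_betw (\<lambda>i. t (i, 0)) {0..r} (col t)"
  unfolding col_def using inj_on_first_column by (rule inj_on_imp_bij_betw)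

lemma card_col: "card (col t) = Suc r"
  using bij_betw_same_card[OF col_bij] by simp

lemma leg_bij: "bij_betw (\<lambda>i. t (i, 0)) {1..r} (leg t)"
  unfolding leg_def
  by (rule inj_on_imp_bij_betw, rule inj_on_subset[OF inj_on_first_column]) simp

lemma card_leg: "card (leg t) = r"
  using bij_betw_same_card[OF leg_bij] by simp

lemma corner_notin_leg: "t (0, 0) \<notin> leg t"
proof
  assume "t (0, 0) \<in> leg t"
  then obtain i where i: "i \<in> {1..r}" "t (0, 0) = t (i, 0)" unfolding leg_def by blast
  then have "0 = i" using inj_onD[OF inj_on_first_column i(2)] by simp
  then show False using i(1) by simp
qed

lemma first_row: "t ` {x \<in> diagram shape. fst x = 0} = {1..m + r} - leg t"
proof -
  have "{x \<in> diagram shape. fst x = 0} = diagram shape - {1..r} \<times> {0}"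
    by (auto simp: diagram_shape)
  moreover have "t ` (diagram shape - {1..r} \<times> {0}) = t ` diagram shape - t ` ({1..r} \<times> {0})"
    using tableau_bij by (intro inj_on_image_set_diff[of _ "diagram shape"])
      (auto simp: bij_betw_def diagram_shape)
  moreover have "t ` ({1..r} \<times> {0}) = leg t" by (auto simp: leg_def)
  ultimately show ?thesis using tableau_bij by (simp add: bij_betw_def)
qed

text \<open>Every row below the first is a single box, so a row permutation fixes the leg pointwise
  and is free on its complement.\<close>

lemma tabloid_of_hook:
  "tabloid_of shape t = {s \<in> tableaux shape. \<forall>i\<in>{1..r}. s (i, 0) = t (i, 0)}"
proof (intro equalityI subsetI)
  fix s assume "s \<in> tabloid_of shape t"
  then obtain u where u: "u \<in> row_stabilizer shape t" "s = u \<circ> t" by (auto simp: tabloid_of_def)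
  have up: "u permutes {1..sum_list shape}"
    using u(1) by (simp add: row_stabilizer_def sym_group_carrier)
  have "u (t (i, 0)) = t (i, 0)" if "i \<in> {1..r}" for i
  proof -
    have "{x \<in> diagram shape. fst x = i} = {(i, 0)}" using that by (auto simp: diagram_shape)
    moreover have "u ` (t ` {x \<in> diagram shape. fst x = i}) = t ` {x \<in> diagram shape. fst x = i}"
      using u(1) unfolding row_stabilizer_def by blast
    ultimately show ?thesis by simp
  qed
  then show "s \<in> {s \<in> tableaux shape. \<forall>i\<in>{1..r}. s (i, 0) = t (i, 0)}"
    using tableaux_comp[OF up t] u(2) by auto
next
  fix s assume "s \<in> {s \<in> tableaux shape. \<forall>i\<in>{1..r}. s (i, 0) = t (i, 0)}"
  then have s: "s \<in> tableaux shape" "\<And>i. i \<in> {1..r} \<Longrightarrow> s (i, 0) = t (i, 0)" by auto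
  obtain u where u: "u permutes {1..sum_list shape}" "s = u \<circ> t"
    by (rule tableaux_transitive[OF s(1) t])
  have fixed: "u x = x" if "x \<in> leg t" for x using that s(2) u(2) by (auto simp: leg_def)
  have "u ` (t ` {x \<in> diagram shape. fst x = i}) = t ` {x \<in> diagram shape. fst x = i}" for i
  proof (cases "i = 0")
    case True
    have "u ` ({1..m + r} - leg t) = u ` {1..m + r} - u ` leg t"
      using permutes_inj[OF u(1)] by (rule image_set_diff)
    also have "\<dots> = {1..m + r} - leg t"
      using permutes_image[OF u(1)] fixed by (simp add: sum_list_shape)
    finally show ?thesis unfolding True first_row .
  next
    case False
    then have "t ` {x \<in> diagram shape. fst x = i} \<subseteq> leg t" by (auto simp: diagram_shape leg_def)
    then show ?thesis using fixed by force
  qed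
  then have "u \<in> row_stabilizer shape t"
    using u(1) by (simp add: row_stabilizer_def sym_group_carrier)
  then show "s \<in> tabloid_of shape t" using u(2) by (auto simp: tabloid_of_def)
qed

text \<open>Every column but the first has at most one box, whose entry must be fixed.\<close>

lemma column_stabilizer_hook: "column_stabilizer shape t = {s. s permutes col t}"
proof (intro equalityI subsetI CollectI)
  have c0: "t ` {x \<in> diagram shape. snd x = 0} = col t"
  proof -
    have "{x \<in> diagram shape. snd x = 0} = {0..r} \<times> {0}" using m_pos by (auto simp: diagram_shape)
    then show ?thesis by (auto simp: col_def)
  qed
  have cj: "{x \<in> diagram shape. snd x = j} = (if j < m then {(0, j)} else {})" if "j \<noteq> 0" for j
    using that by (auto simp: diagram_shape)
  {
    fix s assume s: "s \<in> column_stabilizer shape t"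
    then have sp: "s permutes {1..m + r}" and
      cols: "\<And>j. s ` (t ` {x \<in> diagram shape. snd x = j}) = t ` {x \<in> diagram shape. snd x = j}"
      unfolding column_stabilizer_def sym_group_carrier sum_list_shape by blast+
    show "s permutes col t"
    proof (rule permutes_superset[OF sp])
      fix x assume x: "x \<in> {1..m + r} - col t"
      then obtain a where a: "a \<in> diagram shape" "x = t a"
        using bij_betw_imp_surj_on[OF tableau_bij] by blast
      have "a \<notin> {x \<in> diagram shape. snd x = 0}" using x a(2) c0 by blast
      then have "snd a \<noteq> 0" using a(1) by simp
      then have "t ` {z \<in> diagram shape. snd z = snd a} = {x}"
        using a cj[of "snd a"] by (cases a) (auto simp: diagram_shape)
      then show "s x = x" using cols[of "snd a"] by simp
    qed
  next
    fix s assume "s \<in> {s. s permutes col t}"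
    then have s: "s permutes col t" by simp
    have "s ` (t ` {x \<in> diagram shape. snd x = j}) = t ` {x \<in> diagram shape. snd x = j}" for j
    proof (cases "j = 0")
      case True
      show ?thesis unfolding True c0 using permutes_image[OF s] .
    next
      case False
      have "s (t (0, j)) = t (0, j)" if "j < m"
      proof (rule permutes_not_in[OF s])
        show "t (0, j) \<notin> col t"
        proof
          assume "t (0, j) \<in> col t"
          then obtain i where "i \<le> r" "t (0, j) = t (i, 0)" by (auto simp: col_def)
          moreover have "(0, j) \<in> diagram shape" using that by (simp add: diagram_shape)
          ultimately have "(0, j) = (i, 0 :: nat)"
            using tableau_inj first_column_in_diagram by blast
          then show False using False by simp
        qed
      qed
      then show ?thesis unfolding cj[OF False] by auto
    qed
    moreover have "s permutes {1..sum_list shape}"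
      using permutes_subset[OF s] col_subset by (simp add: sum_list_shape)
    ultimately show "s \<in> column_stabilizer shape t" by (simp add: column_stabilizer_def sym_group_carrier)
  }
qed

lemma permutes_col_imp: "s permutes col t \<Longrightarrow> s permutes {1..sum_list shape}"
  using permutes_subset[OF _ col_subset] by (simp add: sum_list_shape)

lemma polytabloid_hook_apply:
  "polytabloid shape t T =
    (\<Sum>s | s permutes col t. of_int (sign s) * (if T = tabloid_of shape (s \<circ> t) then 1 else 0 :: 'f::field))"
  unfolding polytabloid_def sum_fun_apply column_stabilizer_hook
  by (intro sum.cong) (simp_all add: basis_vec_def tabloid_of_comp[OF permutes_col_imp])

end

lemma tabloid_of_hook_eq_iff:
  assumes "s \<in> tableaux shape" "t \<in> tableaux shape"
  shows "tabloid_of shape s = tabloid_of shape t \<longleftrightarrow> (\<forall>i\<in>{1..r}. s (i, 0) = t (i, 0))"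
  using assms by (auto simp: tabloid_of_hook)

section \<open>Symmetries and relations of polytabloids\<close>

text \<open>A column permutation that preserves the tabloid fixes the leg pointwise, which leaves
  only the corner to move; so only the identity contributes.\<close>

lemma polytabloid_self:
  assumes "t \<in> tableaux shape"
  shows "polytabloid shape t (tabloid_of shape t) = (1 :: 'f::field)"
proof -
  have id: "s = id" if s: "s permutes col t" "tabloid_of shape t = tabloid_of shape (s \<circ> t)" for s
  proof -
    have "s \<circ> t \<in> tableaux shape" using tableaux_comp[OF permutes_col_imp[OF assms s(1)] assms] .
    then have "s x = x" if "x \<in> leg t" for x
      using that s(2) assms by (auto simp: tabloid_of_hook_eq_iff leg_def)
    then have "s permutes {t (0, 0)}"
      using col_eq by (intro permutes_superset[OF s(1)]) auto
    then show ?thesis by simp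
  qed
  then have "polytabloid shape t (tabloid_of shape t) =
      (\<Sum>s | s permutes col t. if s = id then 1 else 0 :: 'f)"
    unfolding polytabloid_hook_apply[OF assms] by (intro sum.cong) auto
  then show ?thesis
    using finite_permutations[OF finite_col] by (simp add: permutes_id)
qed

text \<open>Substitute \<open>s \<circ> g\<close> for \<open>s\<close> in the sum over column
  permutations; this multiplies the signs by \<open>sign g\<close>.\<close>

lemma polytabloid_col_act:
  assumes t: "t \<in> tableaux shape" and g: "g permutes col t"
  shows "polytabloid shape (g \<circ> t) = (\<lambda>T. of_int (sign g) * polytabloid shape t T :: 'f::field)"
proof
  fix T
  have gt: "g \<circ> t \<in> tableaux shape" using tableaux_comp[OF permutes_col_imp[OF t g] t] .
  have col: "col (g \<circ> t) = col t" unfolding col_comp by (rule permutes_image[OF g])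
  have perm: "permutation s" if "s permutes col t" for s
    using that finite_col by (auto simp: permutation_permutes)
  have "of_int (sign g) * polytabloid shape t T = of_int (sign g) *
      (\<Sum>s | s permutes col t. of_int (sign (s \<circ> g)) * (if T = tabloid_of shape (s \<circ> g \<circ> t) then 1 else 0 :: 'f))"
    unfolding polytabloid_hook_apply[OF t] by (subst sum_permutations_compose_right[OF g]) simp
  also have "\<dots> = polytabloid shape (g \<circ> t) T"
    unfolding polytabloid_hook_apply[OF gt] col sum_distrib_left
  proof (rule sum.cong[OF refl])
    fix s assume "s \<in> {s. s permutes col t}"
    then have "sign (s \<circ> g) = sign s * sign g" using perm[OF g] perm by (simp add: sign_compose)
    then have "sign g * sign (s \<circ> g) = sign s"
      by (simp add: mult.left_commute sign_idempotent)
    then have "of_int (sign g) * of_int (sign (s \<circ> g)) = (of_int (sign s) :: 'f)"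
      by (simp flip: of_int_mult)
    then show "of_int (sign g) * (of_int (sign (s \<circ> g)) *
          (if T = tabloid_of shape (s \<circ> g \<circ> t) then 1 else 0)) =
        (of_int (sign s) * (if T = tabloid_of shape (s \<circ> (g \<circ> t)) then 1 else 0) :: 'f)"
      by (simp add: comp_assoc flip: mult.assoc)
  qed
  finally show "polytabloid shape (g \<circ> t) T = (of_int (sign g) * polytabloid shape t T :: 'f)" ..
qed

text \<open>The tabloids in a hook polytabloid depend only on the entries of the first
  column.\<close>

lemma polytabloid_fixed:
  assumes t: "t \<in> tableaux shape" and g: "g permutes {1..m + r}" "\<And>x. x \<in> col t \<Longrightarrow> g x = x"
  shows "polytabloid shape (g \<circ> t) = (polytabloid shape t :: _ \<Rightarrow> 'f::field)"
proof
  fix T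
  have g': "g permutes {1..sum_list shape}" using g(1) by (simp add: sum_list_shape)
  have gt: "g \<circ> t \<in> tableaux shape" using tableaux_comp[OF g' t] .
  have col: "col (g \<circ> t) = col t" unfolding col_comp using g(2) by force
  have "tabloid_of shape (s \<circ> (g \<circ> t)) = tabloid_of shape (s \<circ> t)" if "s permutes col t" for s
  proof -
    have s: "s permutes {1..sum_list shape}" by (rule permutes_col_imp[OF t that])
    show ?thesis
      using tableaux_comp[OF s gt] tableaux_comp[OF s t] g(2)
      by (simp add: tabloid_of_hook_eq_iff col_def)
  qed
  then show "polytabloid shape (g \<circ> t) T = (polytabloid shape t T :: 'f)"
    unfolding polytabloid_hook_apply[OF gt] polytabloid_hook_apply[OF t] col
    by (intro sum.cong) auto
qed

lemma polytabloid_outside: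
  "t \<in> tableaux shape \<Longrightarrow> T \<notin> tabloids shape \<Longrightarrow> polytabloid shape t T = (0 :: 'f::field)"
  using polytabloid_in_specht[of t shape, where 'f='f] specht_subset_tabloid_module[of shape, where 'f='f]
  by (auto simp: tabloid_module_def)

text \<open>The Garnir relation: the signed sum of the tabloids \<open>\<sigma> {t}\<close> over all permutations \<open>\<sigma>\<close> of
  \<open>insert y (col t)\<close> vanishes, because \<open>y\<close> and \<open>t (0, 0)\<close> lie in the same row.\<close>

lemma polytabloid_garnir:
  assumes t: "t \<in> tableaux shape" and y: "y \<in> {1..m + r} - col t" and char: "(2 :: 'f::field) \<noteq> 0"
  shows "(\<Sum>b\<in>col t. polytabloid shape (transpose y b \<circ> t)) = (polytabloid shape t :: _ \<Rightarrow> 'f)"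
proof
  fix T
  have tr: "transpose y b permutes {1..sum_list shape}" if "b \<in> col t" for b
    using that y col_subset[OF t] by (intro permutes_swap_id) (auto simp: sum_list_shape)
  have tt: "transpose y b \<circ> t \<in> tableaux shape" if "b \<in> col t" for b
    using tableaux_comp[OF tr[OF that] t] .
  show "(\<Sum>b\<in>col t. polytabloid shape (transpose y b \<circ> t)) T = (polytabloid shape t T :: 'f)"
  proof (cases "T \<in> tabloids shape")
    case False
    then show ?thesis using t tt by (simp add: sum_fun_apply polytabloid_outside)
  next
    case T: True
    let ?a = "t (0, 0)" and ?B = "insert y (col t)"
    define f :: "(nat \<Rightarrow> nat) \<Rightarrow> 'f" where
      "f s = of_int (sign s) * (if T = tabloid_of shape (s \<circ> t) then 1 else 0)" for s
    have finB: "finite ?B" using finite_col by simp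
    have BN: "?B \<subseteq> {1..sum_list shape}" using y col_subset[OF t] by (auto simp: sum_list_shape)
    have a: "?a \<in> col t" by (simp add: col_eq)
    \<comment> \<open>Neither \<open>y\<close> nor the corner entry lies in the leg, so their
      transposition keeps every tabloid and reverses every sign. The sum equals its own
      negative.\<close>
    have "sum f {s. s permutes ?B} = (\<Sum>s | s permutes ?B. f (s \<circ> transpose y ?a))"
      using a by (intro sum_permutations_compose_right permutes_swap_id) auto
    also have "\<dots> = (\<Sum>s | s permutes ?B. - f s)"
    proof (rule sum.cong[OF refl])
      fix s assume "s \<in> {s. s permutes ?B}"
      then have s: "s permutes ?B" by simp
      have sN: "s permutes {1..sum_list shape}" using permutes_subset[OF s BN] .
      have "permutation s" using s finB unfolding permutation_permutes by blast
      moreover have "y \<noteq> ?a" using y a by auto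
      ultimately have "sign (s \<circ> transpose y ?a) = - sign s"
        by (simp add: sign_compose permutation_swap_id sign_swap_id)
      moreover have "tabloid_of shape (s \<circ> transpose y ?a \<circ> t) = tabloid_of shape (s \<circ> t)"
      proof -
        have "transpose y ?a (t (i, 0)) = t (i, 0)" if "i \<in> {1..r}" for i
        proof -
          have "t (i, 0) \<in> leg t" using that by (auto simp: leg_def)
          then show ?thesis using y corner_notin_leg[OF t] by (metis DiffD2 col_eq insertI2 transpose_apply_other)
        qed
        then show ?thesis
          unfolding comp_assoc
            tabloid_of_hook_eq_iff[OF tableaux_comp[OF sN tt[OF a]] tableaux_comp[OF sN t]]
          by simp
      qed
      ultimately show "f (s \<circ> transpose y ?a) = - f s" by (simp add: f_def)
    qed
    finally have "2 * sum f {s. s permutes ?B} = 0" by (simp add: sum_negf)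
    then have "sum f {s. s permutes ?B} = 0" using char by simp
    \<comment> \<open>Permutations of \<open>?B\<close> factor uniquely as
      \<open>transpose y b \<circ> s\<close>. The term \<open>b = y\<close> is the polytabloid of
      \<open>t\<close>; the others carry a minus sign from the transposition.\<close>
    then have "(\<Sum>b\<in>?B. \<Sum>s | s permutes col t. f (transpose y b \<circ> s)) = 0"
      using sum_over_permutations_insert[of "col t" y f] finite_col y by simp
    moreover have "(\<Sum>s | s permutes col t. f (transpose y b \<circ> s)) = - polytabloid shape (transpose y b \<circ> t) T"
      if b: "b \<in> col t" for b
    proof -
      have inv: "inv' (transpose y b) = transpose y b" by (simp add: inv_transpose_eq)
      have "polytabloid shape (transpose y b \<circ> t) T =
          (polytabloid shape t ((\<circ>) (transpose y b) ` T) :: 'f)"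
        unfolding polytabloid_act[OF tr[OF b] t, symmetric] tabloid_module_act_apply[OF tr[OF b] T] inv ..
      also have "\<dots> = (\<Sum>s | s permutes col t. - f (transpose y b \<circ> s))"
        unfolding polytabloid_hook_apply[OF t]
      proof (rule sum.cong[OF refl])
        fix s assume "s \<in> {s. s permutes col t}"
        then have s: "s permutes col t" by simp
        have "permutation s" using s finite_col unfolding permutation_permutes by blast
        moreover have "y \<noteq> b" using y b by auto
        ultimately have "sign (transpose y b \<circ> s) = - sign s"
          by (simp add: sign_compose permutation_swap_id sign_swap_id)
        moreover have "(\<circ>) (transpose y b) ` T = tabloid_of shape (s \<circ> t) \<longleftrightarrow>
            T = tabloid_of shape (transpose y b \<circ> s \<circ> t)"
          using image_comp_eq_iff[OF tr[OF b], of T "tabloid_of shape (s \<circ> t)"]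
          by (simp add: inv comp_assoc tabloid_of_comp[OF tr[OF b]])
        ultimately show "of_int (sign s) * (if (\<circ>) (transpose y b) ` T = tabloid_of shape (s \<circ> t) then 1 else 0)
            = - f (transpose y b \<circ> s)" by (simp add: f_def)
      qed
      finally show ?thesis by (simp add: sum_negf)
    qed
    moreover have "(\<Sum>s | s permutes col t. f (transpose y y \<circ> s)) = polytabloid shape t T"
      by (simp add: polytabloid_hook_apply[OF t] f_def)
    ultimately show ?thesis
      using y finite_col by (simp add: sum_fun_apply sum_negf)
  qed
qed

text \<open>A tabloid with two entries of \<open>col t\<close> in its first row is fixed by their transposition, so it has
  coefficient \<open>0\<close>; any other tabloid is of the form \<open>\<sigma> {t}\<close> with \<open>\<sigma>\<close> a permutation of \<open>col t\<close>.\<close>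

lemma sign_equivariant_determined:
  assumes t: "t \<in> tableaux shape" and char: "(2 :: 'f::field) \<noteq> 0"
    and u: "u \<in> carrier (tabloid_module shape :: ('f, _, _) gmod)"
    and equiv: "\<And>g. g permutes col t \<Longrightarrow>
      gact (tabloid_module shape) g u = (\<lambda>T. of_int (sign g) * u T)"
    and zero: "u (tabloid_of shape t) = 0"
  shows "u = 0"
proof
  fix T
  have inv: "u ((\<circ>) (inv' g) ` T) = of_int (sign g) * u T" if "g permutes col t" "T \<in> tabloids shape" for g T
    using equiv[OF that(1)] tabloid_module_act_apply[OF permutes_col_imp[OF t that(1)] that(2), of u]
    by simp
  have "u T = 0"
  proof (cases "T \<in> tabloids shape")
    case False
    then show ?thesis using u by (simp add: tabloid_module_def)
  next
    case T: True
    then obtain s where s: "s \<in> tableaux shape" "T = tabloid_of shape s" by (auto simp: tabloids_def)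
    show ?thesis
    proof (cases "\<exists>a\<in>col t - leg s. \<exists>b\<in>col t - leg s. a \<noteq> b")
      case True
      then obtain a b where ab: "a \<in> col t" "b \<in> col t" "a \<notin> leg s" "b \<notin> leg s" "a \<noteq> b" by blast
      have tr: "transpose a b permutes col t" using ab by (intro permutes_swap_id) auto
      have trN: "transpose a b permutes {1..sum_list shape}" by (rule permutes_col_imp[OF t tr])
      have "transpose a b (s (i, 0)) = s (i, 0)" if "i \<in> {1..r}" for i
      proof -
        have "s (i, 0) \<in> leg s" using that by (auto simp: leg_def)
        then show ?thesis using ab by (metis transpose_apply_other)
      qed
      then have "tabloid_of shape (transpose a b \<circ> s) = T"
        unfolding s(2) tabloid_of_hook_eq_iff[OF tableaux_comp[OF trN s(1)] s(1)] by simp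
      then have "(\<circ>) (inv' (transpose a b)) ` T = T"
        unfolding inv_transpose_eq s(2) tabloid_of_comp[OF trN] .
      then have "u T = - u T" using inv[OF tr T] ab by (simp add: sign_swap_id)
      then have "2 * u T = 0" by (metis add_eq_0_iff mult_2)
      then show ?thesis using char by simp
    next
      case False
      have fin: "finite (leg s)" by (simp add: leg_def)
      \<comment> \<open>\<open>col t\<close> has \<open>r + 1\<close> elements and
        \<open>leg s\<close> only \<open>r\<close>. With at most one element of \<open>col t\<close>
        outside \<open>leg s\<close>, there is exactly one, and
        \<open>leg s \<subseteq> col t\<close>.\<close>
      have "card (col t - leg s) \<le> 1"
        using False finite_col by (subst card_le_Suc0_iff_eq[unfolded One_nat_def[symmetric]]) auto
      moreover have "card (col t - leg s) + card (col t \<inter> leg s) = Suc r"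
        using card_col[OF t] card_Diff_subset_Int[of "col t" "leg s"] card_mono[OF finite_col, of "col t \<inter> leg s" t] fin
        by (simp add: card_col)
      moreover have "card (col t \<inter> leg s) \<le> r"
        using card_mono[OF fin, of "col t \<inter> leg s"] card_leg[OF s(1)] by simp
      ultimately have c: "card (col t - leg s) = 1" "card (col t \<inter> leg s) = card (leg s)"
        using card_leg[OF s(1)] by simp_all
      have leg: "leg s \<subseteq> col t" using card_subset_eq[OF fin _ c(2)] by blast
      obtain a where a: "col t - leg s = {a}" using c(1) by (auto simp: card_1_singleton_iff)
      have "{0..r} = insert 0 {1..r}" by auto
      moreover have "bij_betw (\<lambda>i. if i = 0 then a else s (i, 0)) {1..r} (leg s)"
        using leg_bij[OF s(1)] by (rule iffD1[OF bij_betw_cong, rotated]) simp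
      moreover have "insert a (leg s) = col t" "a \<notin> leg s" using a leg by auto
      ultimately have b: "bij_betw (\<lambda>i. if i = 0 then a else s (i, 0)) {0..r} (col t)"
        using notIn_Un_bij_betw[of 0 "{1..r}" "\<lambda>i. if i = 0 then a else s (i, 0)" "leg s"] by simp
      \<comment> \<open>The left-over element \<open>a\<close> goes to the corner, and the leg of
        \<open>t\<close> is matched with that of \<open>s\<close>.\<close>
      obtain \<sigma> where \<sigma>: "\<sigma> permutes col t"
        "\<And>i. i \<in> {0..r} \<Longrightarrow> \<sigma> (t (i, 0)) = (if i = 0 then a else s (i, 0))"
        by (rule exists_permutation_matching[OF col_bij[OF t] b]) (rule that)
      have \<sigma>N: "\<sigma> permutes {1..sum_list shape}" by (rule permutes_col_imp[OF t \<sigma>(1)])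
      have "tabloid_of shape (\<sigma> \<circ> t) = T"
        unfolding s(2) tabloid_of_hook_eq_iff[OF tableaux_comp[OF \<sigma>N t] s(1)] using \<sigma>(2) by simp
      then have "(\<circ>) (inv' \<sigma>) ` T = tabloid_of shape t"
        using image_comp_eq_iff[OF \<sigma>N, of T "tabloid_of shape t"] by (simp add: tabloid_of_comp[OF \<sigma>N])
      then have "of_int (sign \<sigma>) * u T = 0" using inv[OF \<sigma>(1) T] zero by simp
      then show ?thesis by (auto simp: sign_def split: if_splits)
    qed
  qed
  then show "u T = 0 T" by simp
qed

text \<open>The polytabloid has coefficient 1 at the tabloid of \<open>t\<close>, so subtracting the
  stated multiple leaves a sign-equivariant vector with coefficient 0 there.\<close>

lemma sign_equivariant_multiple:
  assumes t: "t \<in> tableaux shape" and char: "(2 :: 'f::field) \<noteq> 0"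
    and u: "u \<in> carrier (tabloid_module shape :: ('f, _, _) gmod)"
    and equiv: "\<And>g. g permutes col t \<Longrightarrow>
      gact (tabloid_module shape) g u = (\<lambda>T. of_int (sign g) * u T)"
  shows "u = (\<lambda>T. u (tabloid_of shape t) * polytabloid shape t T)"
proof -
  let ?M = "tabloid_module shape :: ('f, _, _) gmod"
  interpret M: fg_module "sym_group (sum_list shape)" ?M by (rule tabloid_module_fg_module)
  let ?e = "polytabloid shape t :: _ \<Rightarrow> 'f" and ?c = "u (tabloid_of shape t)"
  let ?w = "gscale ?M ?c ?e"
  have e: "?e \<in> carrier ?M"
    using polytabloid_in_specht[OF t] specht_subset_tabloid_module by blast
  have w: "?w \<in> carrier ?M" using M.V.subspace_scale[OF M.subspace_carrier e] .
  have "u - ?w = 0"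
  proof (rule sign_equivariant_determined[OF t char])
    show "u - ?w \<in> carrier ?M" using M.V.subspace_diff[OF M.subspace_carrier u w] .
    show "(u - ?w) (tabloid_of shape t) = 0"
      by (simp add: gscale_tabloid_module polytabloid_self[OF t])
    fix g assume g: "g permutes col t"
    have gN: "g permutes {1..sum_list shape}" by (rule permutes_col_imp[OF t g])
    then have gG: "g \<in> carrier (sym_group (sum_list shape))" by (simp add: sym_group_carrier)
    have "gact ?M g ?e = (\<lambda>T. of_int (sign g) * ?e T)"
      unfolding polytabloid_act[OF gN t] polytabloid_col_act[OF t g] ..
    then show "gact ?M g (u - ?w) = (\<lambda>T. of_int (sign g) * (u - ?w) T)"
      using equiv[OF g] unfolding M.act_diff[OF gG u w] M.act_scale[OF gG e]
      by (simp add: fun_eq_iff gscale_tabloid_module algebra_simps)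
  qed
  then have "u = ?w" by simp
  then show ?thesis unfolding gscale_tabloid_module .
qed

text \<open>Both components of a polytabloid in a direct sum are sign-equivariant, hence multiples
  of it. A non-zero component puts the generator into its summand.\<close>

lemma specht_indecomposable:
  assumes char: "(2 :: 'f::field) \<noteq> 0" and t: "t \<in> tableaux shape"
  shows "indecomposable (sym_group (sum_list shape)) (specht_module shape :: ('f, _, _) gmod)"
  unfolding indecomposable_def
proof (intro conjI allI impI)
  let ?G = "sym_group (sum_list shape)" and ?M = "tabloid_module shape :: ('f, _, _) gmod"
  let ?S = "specht_module shape :: ('f, _, _) gmod"
  let ?e = "polytabloid shape t :: _ \<Rightarrow> 'f"
  interpret S: fg_module ?G ?S by (rule specht_fg_module)
  show "fg_module ?G ?S" by (rule specht_fg_module)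
  have eS: "?e \<in> carrier ?S" by (rule polytabloid_in_specht[OF t])
  have e0: "?e \<noteq> 0" using polytabloid_self[OF t, where 'f='f] by (metis zero_fun_apply zero_neq_one)
  show "carrier ?S \<noteq> {0}" using eS e0 by auto
  fix U W assume UW: "internal_direct_sum ?G ?S U W"
  then have sub: "fg_submodule ?G ?S U" "fg_submodule ?G ?S W" and U0: "U \<inter> W = {0}"
    by (auto simp: internal_direct_sum_def)
  then have subspaces: "S.V.subspace U" "S.V.subspace W" "U \<subseteq> carrier ?S" "W \<subseteq> carrier ?S"
    and closed: "\<And>g u. g \<in> carrier ?G \<Longrightarrow> u \<in> U \<Longrightarrow> gact ?S g u \<in> U"
      "\<And>g u. g \<in> carrier ?G \<Longrightarrow> u \<in> W \<Longrightarrow> gact ?S g u \<in> W"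
    by (auto simp: fg_submodule_def)
  obtain u w where uw: "?e = u + w" "u \<in> U" "w \<in> W"
    using UW eS unfolding internal_direct_sum_def by blast
  have act: "gact ?S g u = gscale ?S (of_int (sign g)) u \<and> gact ?S g w = gscale ?S (of_int (sign g)) w"
    if g: "g permutes col t" for g
  proof -
    have gN: "g permutes {1..sum_list shape}" by (rule permutes_col_imp[OF t g])
    then have gG: "g \<in> carrier ?G" by (simp add: sym_group_carrier)
    let ?s = "gscale ?S (of_int (sign g))"
    have "gact ?S g ?e = ?s ?e"
      unfolding gact_specht_module gscale_specht_module gscale_tabloid_module
        polytabloid_act[OF gN t] polytabloid_col_act[OF t g] ..
    moreover have uS: "u \<in> carrier ?S" and wS: "w \<in> carrier ?S" using uw subspaces by auto
    ultimately have "gact ?S g u + gact ?S g w = ?s u + ?s w"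
      unfolding uw(1) S.V.scale_right_distrib S.act_add[OF gG uS wS] by blast
    moreover have "a - c = d - b" if "a + b = c + d" for a b c d :: "tabloid \<Rightarrow> 'f"
      using that by (simp add: fun_eq_iff algebra_simps)
    \<comment> \<open>The left side lies in \<open>U\<close> and the right side in \<open>W\<close>,
      so both vanish.\<close>
    ultimately have eq: "gact ?S g u - ?s u = ?s w - gact ?S g w" by blast
    have "gact ?S g u - ?s u \<in> U"
      by (intro S.V.subspace_diff S.V.subspace_scale subspaces closed gG uw)
    moreover have "?s w - gact ?S g w \<in> W"
      by (intro S.V.subspace_diff S.V.subspace_scale subspaces closed gG uw)
    ultimately have "gact ?S g u - ?s u \<in> U \<inter> W" unfolding eq by blast
    then have "gact ?S g u - ?s u = 0" unfolding U0 by blast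
    moreover from this have "?s w - gact ?S g w = 0" unfolding eq .
    ultimately show ?thesis by simp
  qed
  have mult: "v = (\<lambda>T. v (tabloid_of shape t) * ?e T)" if "v = u \<or> v = w" for v
  proof (rule sign_equivariant_multiple[OF t char])
    show "v \<in> carrier ?M" using that uw subspaces specht_subset_tabloid_module by blast
    show "gact ?M g v = (\<lambda>T. of_int (sign g) * v T)" if "g permutes col t" for g
      using act[OF that] \<open>v = u \<or> v = w\<close>
      unfolding gact_specht_module gscale_specht_module gscale_tabloid_module by blast
  qed
  have e_in: "?e \<in> X" if v: "v = u \<or> v = w" "v \<noteq> 0" "v \<in> X" "S.V.subspace X" for v X
  proof -
    let ?c = "v (tabloid_of shape t)"
    have vc: "v = gscale ?S ?c ?e"
      using mult[OF v(1)] unfolding gscale_specht_module gscale_tabloid_module .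
    have "?c \<noteq> 0"
    proof
      assume "?c = 0"
      then show False using vc v(2) by (metis S.V.scale_zero_left)
    qed
    then have "?e = gscale ?S (inverse ?c) v"
      by (subst vc) simp
    then show ?thesis using S.V.subspace_scale[OF v(4,3)] by metis
  qed
  show "U = {0} \<or> W = {0}"
  proof (cases "u = 0")
    case True
    then have "w \<noteq> 0" using uw e0 by auto
    then have "W = carrier ?S"
      using e_in[of w W] uw subspaces by (intro specht_generated_by_polytabloid[OF sub(2) t]) auto
    then show ?thesis using U0 subspaces by auto
  next
    case False
    then have "U = carrier ?S"
      using e_in[of u U] uw subspaces by (intro specht_generated_by_polytabloid[OF sub(1) t]) auto
    then show ?thesis using U0 subspaces by auto
  qed
qed

section \<open>Invariance of a tabloid coefficient\<close>

text \<open>Such a \<open>g\<close> fixes the tabloid itself; this will give the invariance of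
  \<open>\<mu>\<close> under \<open>H\<close>.\<close>

lemma coefficient_fixing_leg:
  assumes t: "t \<in> tableaux shape" and g: "g permutes {1..m + r}" "\<And>x. x \<in> leg t \<Longrightarrow> g x = x"
  shows "gact (specht_module shape :: ('f::field, _, _) gmod) g v (tabloid_of shape t) = v (tabloid_of shape t)"
proof -
  have gN: "g permutes {1..sum_list shape}" using g(1) by (simp add: sum_list_shape)
  have "tabloid_of shape (g \<circ> t) = tabloid_of shape t"
    unfolding tabloid_of_hook_eq_iff[OF tableaux_comp[OF gN t] t] using g(2) by (auto simp: leg_def)
  then have "(\<circ>) (inv' g) ` tabloid_of shape t = tabloid_of shape t"
    using image_comp_eq_iff[OF gN, of "tabloid_of shape t" "tabloid_of shape t"]
    by (simp add: tabloid_of_comp[OF gN])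
  then show ?thesis
    unfolding gact_specht_module tabloid_module_act_apply[OF gN tabloid_of_in[OF t]] by simp
qed

text \<open>Checked on the spanning polytabloids: if the column of \<open>s\<close> contains the leg
  of \<open>t\<close>, then \<open>g\<close> is a column permutation of \<open>s\<close>; otherwise
  the coefficient is 0 before and after. As rotations of odd order are even, \<open>\<mu>\<close> is
  invariant under \<open>K\<close>.\<close>

lemma coefficient_permuting_leg:
  assumes t: "t \<in> tableaux shape" and g: "g permutes leg t"
    and v: "v \<in> carrier (specht_module shape :: ('f::field, _, _) gmod)"
  shows "gact (specht_module shape :: ('f::field, _, _) gmod) g v (tabloid_of shape t) =
    of_int (sign g) * v (tabloid_of shape t)"
proof -
  let ?M = "tabloid_module shape :: ('f, _, _) gmod"
  interpret M: fg_module "sym_group (sum_list shape)" ?M by (rule tabloid_module_fg_module)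
  let ?T = "tabloid_of shape t"
  have "leg t \<subseteq> col t" by (auto simp: col_eq)
  then have gc: "g permutes col t" by (rule permutes_subset[OF g])
  have gN: "g permutes {1..sum_list shape}" by (rule permutes_col_imp[OF t gc])
  let ?P = "{v :: tabloid \<Rightarrow> 'f. v ((\<circ>) (inv' g) ` ?T) = of_int (sign g) * v ?T}"
  have coeff: "gact ?M g u ?T = u ((\<circ>) (inv' g) ` ?T)" for u
    by (rule tabloid_module_act_apply[OF gN tabloid_of_in[OF t]])
  \<comment> \<open>Every tabloid in the polytabloid of \<open>s\<close> has its leg entries in
    \<open>col s\<close>.\<close>
  have zero: "polytabloid shape s ?T = (0 :: 'f)" if s: "s \<in> tableaux shape" and "\<not> leg t \<subseteq> col s" for s
    unfolding polytabloid_hook_apply[OF s]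
  proof (intro sum.neutral ballI)
    fix q assume "q \<in> {q. q permutes col s}"
    then have q: "q permutes col s" by simp
    have "?T \<noteq> tabloid_of shape (q \<circ> s)"
    proof
      assume "?T = tabloid_of shape (q \<circ> s)"
      then have "t (i, 0) = q (s (i, 0))" if "i \<in> {1..r}" for i
        using that unfolding tabloid_of_hook_eq_iff[OF t tableaux_comp[OF permutes_col_imp[OF s q] s]] by simp
      moreover have "q (s (i, 0)) \<in> col s" if "i \<in> {1..r}" for i
        using that permutes_in_image[OF q] by (auto simp: col_def)
      ultimately have "leg t \<subseteq> col s" by (auto simp: leg_def)
      then show False using that by simp
    qed
    then show "of_int (sign q) * (if ?T = tabloid_of shape (q \<circ> s) then 1 else 0) = (0 :: 'f)" by simp
  qed
  have "polytabloid shape s \<in> ?P" if s: "s \<in> tableaux shape" for s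
  proof (cases "leg t \<subseteq> col s")
    case True
    then show ?thesis
      using polytabloid_act[OF gN s, where 'f='f] polytabloid_col_act[OF s permutes_subset[OF g True], where 'f='f]
        coeff[of "polytabloid shape s"]
      by simp
  next
    case False
    have "g ` leg t \<subseteq> g ` col s \<longleftrightarrow> leg t \<subseteq> col s"
      using permutes_inj[OF g] by (simp add: inj_image_subset_iff)
    then have "\<not> leg t \<subseteq> col (g \<circ> s)" using False permutes_image[OF g] by (simp add: col_comp)
    then show ?thesis
      using zero[OF s False] zero[OF tableaux_comp[OF gN s]] polytabloid_act[OF gN s, where 'f='f]
        coeff[of "polytabloid shape s"]
      by simp
  qed
  moreover have "M.V.subspace ?P"
    unfolding M.V.subspace_def by (auto simp: gscale_tabloid_module algebra_simps)
  ultimately have "M.V.span (polytabloid shape ` tableaux shape) \<subseteq> ?P"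
    by (intro M.V.span_minimal) auto
  then have "v \<in> ?P" using v by (auto simp: specht_module_def)
  then show ?thesis by (simp add: gact_specht_module coeff)
qed

section \<open>The vertex\<close>

text \<open>The leg carries \<open>1, \<dots>, r\<close> and the corner \<open>Suc r\<close>, so
  that \<open>K\<close> permutes the leg and \<open>H\<close> fixes it pointwise. For
  \<open>0 < r\<close> the first column is not increasing.\<close>

definition standard_tableau :: tableau
  where "standard_tableau x = (if x \<in> diagram shape then
    if fst x = 0 then Suc (r + snd x) else fst x else 0)"

lemma standard_tableau: "standard_tableau \<in> tableaux shape"
proof -
  have "bij_betw standard_tableau (diagram shape) {1..m + r}"
    using m_pos
    by (intro bij_betw_byWitness[of _ "\<lambda>x. if x \<le> r then (x, 0) else (0, x - Suc r)"])
      (auto simp: diagram_shape standard_tableau_def split: if_splits)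
  then show ?thesis unfolding tableaux_def sum_list_shape by (simp add: standard_tableau_def)
qed

lemma leg_standard: "leg standard_tableau = {1..r}"
  using first_column_in_diagram by (force simp: leg_def standard_tableau_def image_iff)

lemma col_standard: "col standard_tableau = insert (Suc r) {1..r}"
  using first_column_in_diagram[of 0] by (simp add: col_eq leg_standard standard_tableau_def)

text \<open>With \<open>y = g (Suc r)\<close>, the rotations permute the terms \<open>b \<noteq> Suc r\<close> of the Garnir relation simply
  transitively.\<close>

lemma polytabloid_minus_translate_is_trace:
  assumes char: "(2 :: 'f::field) \<noteq> 0" and r: "odd r"
    and g: "g permutes {Suc r..m + r}"
  obtains w :: "tabloid \<Rightarrow> 'f::field" where "w \<in> carrier (specht_module shape)"
    and "polytabloid shape standard_tableau =
      gact (specht_module shape) g (polytabloid shape standard_tableau) +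
      (\<Sum>j<r. gact (specht_module shape) (rot r ^^ j) w)"
proof -
  let ?t = standard_tableau
  let ?S = "specht_module shape :: ('f, _, _) gmod"
  interpret S: fg_module "sym_group (sum_list shape)" ?S by (rule specht_fg_module)
  note t = standard_tableau
  have r0: "0 < r" using r by (rule odd_pos)
  have act: "gact ?S h (polytabloid shape s) = polytabloid shape (h \<circ> s)"
    if "h permutes {1..m + r}" "s \<in> tableaux shape" for h s
    using that unfolding gact_specht_module by (intro polytabloid_act) (simp_all add: sum_list_shape)
  have comp: "h \<circ> s \<in> tableaux shape" if "h permutes {1..m + r}" "s \<in> tableaux shape" for h s
    using that by (intro tableaux_comp) (simp_all add: sum_list_shape)
  have gN: "g permutes {1..m + r}" using permutes_subset[OF g] by auto
  have g_leg: "g x = x" if "x \<in> {1..r}" for x using permutes_not_in[OF g] that by auto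
  define y where "y = g (Suc r)"
  have y: "y \<in> {Suc r..m + r}" using permutes_in_image[OF g, of "Suc r"] m_pos by (simp add: y_def)
  show thesis
  \<comment> \<open>If \<open>g\<close> fixes the corner entry, it fixes the whole column and
    \<open>w = 0\<close> serves; otherwise \<open>y\<close> lies outside the column and the Garnir
    relation applies.\<close>
  proof (cases "y = Suc r")
    case True
    then have "polytabloid shape (g \<circ> ?t) = (polytabloid shape ?t :: _ \<Rightarrow> 'f)"
      using g_leg by (intro polytabloid_fixed t gN) (auto simp: col_standard y_def)
    moreover have "gact ?S (rot r ^^ j) 0 = 0" for j
      using S.act_zero[of "rot r ^^ j"] subgroup.subset[OF subgroup_rotations[OF r0, of "m + r"]]
      by (auto simp: rotations_def sum_list_shape)
    ultimately show thesis using act[OF gN t] by (intro that[OF S.zero_mem]) simp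
  next
    case False
    have tr: "transpose y b permutes {1..m + r}" if "b \<in> col ?t" for b
      using that y col_subset[OF t] by (intro permutes_swap_id) auto
    \<comment> \<open>The term \<open>b = 1\<close> of the relation; \<open>rot r ^^ j\<close> will
      carry it to the term \<open>b = Suc j\<close>.\<close>
    define w :: "tabloid \<Rightarrow> 'f" where "w = polytabloid shape (transpose y 1 \<circ> ?t)"
    have one: "1 \<in> col ?t" using r0 by (simp add: col_standard)
    have w: "w \<in> carrier ?S" unfolding w_def by (intro polytabloid_in_specht comp tr one t)
    \<comment> \<open>As \<open>g\<close> sends \<open>Suc r\<close> to \<open>y\<close>, following
      it by \<open>transpose y (Suc r)\<close> gives a permutation that fixes the column
      pointwise.\<close>
    have head: "polytabloid shape (transpose y (Suc r) \<circ> ?t) = gact ?S g (polytabloid shape ?t)"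
    proof -
      let ?h = "transpose y (Suc r) \<circ> g"
      have Sr: "Suc r \<in> col ?t" by (simp add: col_standard)
      have hN: "?h permutes {1..m + r}" using permutes_compose[OF gN tr[OF Sr]] .
      have "?h x = x" if "x \<in> col ?t" for x
        using that y g_leg False by (auto simp: col_standard y_def[symmetric] transpose_apply_other)
      then have fix_h: "polytabloid shape (?h \<circ> ?t) = (polytabloid shape ?t :: _ \<Rightarrow> 'f)"
        by (rule polytabloid_fixed[OF t hN])
      have "transpose y (Suc r) \<circ> (?h \<circ> ?t) = g \<circ> ?t" by (auto simp: fun_eq_iff)
      then have "polytabloid shape (g \<circ> ?t) = gact ?S (transpose y (Suc r)) (polytabloid shape (?h \<circ> ?t))"
        using act[OF tr[OF Sr] comp[OF hN t]] by simp
      also have "\<dots> = polytabloid shape (transpose y (Suc r) \<circ> ?t)"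
        unfolding fix_h using act[OF tr[OF Sr] t] .
      finally show ?thesis using act[OF gN t] by simp
    qed
    have rotated: "gact ?S (rot r ^^ j) w = polytabloid shape (transpose y (Suc j) \<circ> ?t)" if j: "j < r" for j
    proof -
      let ?k = "rot r ^^ j"
      have k: "?k permutes {1..r}" by (rule rotations_permutes[OF r0]) (simp add: rotations_def)
      then have kN: "?k permutes {1..m + r}" by (rule permutes_subset) auto
      have kc: "?k permutes col ?t" using k by (rule permutes_subset) (auto simp: col_standard)
      have b: "Suc j \<in> col ?t" using j by (simp add: col_standard)
      have "?k y = y" using permutes_not_in[OF k] y by auto
      moreover have "?k 1 = Suc j" using rot_pow_one[OF j] .
      \<comment> \<open>Conjugating by \<open>?k\<close> turns \<open>transpose y 1\<close> into
        \<open>transpose y (Suc j)\<close>; the remaining \<open>?k\<close> is an even column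
        permutation and fixes the polytabloid.\<close>
      ultimately have "?k \<circ> transpose y 1 = transpose y (Suc j) \<circ> ?k"
        using injD[OF permutes_inj[OF k]] by (fastforce simp: fun_eq_iff transpose_def)
      then have "?k \<circ> (transpose y 1 \<circ> ?t) = transpose y (Suc j) \<circ> (?k \<circ> ?t)"
        by (metis comp_assoc)
      then have "gact ?S ?k w = gact ?S (transpose y (Suc j)) (polytabloid shape (?k \<circ> ?t))"
        unfolding w_def using act[OF kN comp[OF tr[OF one] t]] act[OF tr[OF b] comp[OF kN t]] by simp
      moreover have "polytabloid shape (?k \<circ> ?t) = (polytabloid shape ?t :: _ \<Rightarrow> 'f)"
        using sign_rotation[OF r, of ?k] unfolding polytabloid_col_act[OF t kc] by (simp add: rotations_def)
      ultimately show ?thesis using act[OF tr[OF b] t] by simp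
    qed
    have "polytabloid shape ?t = (\<Sum>b\<in>col ?t. polytabloid shape (transpose y b \<circ> ?t) :: _ \<Rightarrow> 'f)"
      using False y by (intro polytabloid_garnir[symmetric] t char) (auto simp: col_standard)
    also have "\<dots> = polytabloid shape (transpose y (Suc r) \<circ> ?t) +
        (\<Sum>b\<in>{1..r}. polytabloid shape (transpose y b \<circ> ?t))"
      unfolding col_standard by (rule sum.insert) auto
    also have "(\<Sum>b\<in>{1..r}. polytabloid shape (transpose y b \<circ> ?t) :: _ \<Rightarrow> 'f) =
        (\<Sum>j<r. polytabloid shape (transpose y (Suc j) \<circ> ?t))"
      by (rule sum.reindex_bij_witness[of _ Suc "\<lambda>b. b - 1"]) auto
    also have "\<dots> = (\<Sum>j<r. gact ?S (rot r ^^ j) w)"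
      using rotated by (intro sum.cong) auto
    finally show thesis unfolding head by (rule that[OF w])
  qed
qed

section \<open>The lower bound for a vertex\<close>

text \<open>Here \<open>r\<close> is both the leg length and the prime. A bound on orders is enough,
  since it already excludes proper subgroups of the product.\<close>

lemma card_le_if_relatively_projective:
  assumes p: "prime r" "odd r" and char: "of_nat r = (0 :: 'f::field)" "(2 :: 'f) \<noteq> 0"
    and H: "subgroup H (sym_group (m + r))" "card H = r ^ k" "\<And>h. h \<in> H \<Longrightarrow> h permutes {Suc r..m + r}"
    and R: "subgroup R (sym_group (m + r))"
      "summand_of_induced (sym_group (m + r)) R (specht_module shape :: ('f, _, _) gmod)"
  shows "card (rotations r <#>\<^bsub>sym_group (m + r)\<^esub> H) \<le> card R"
proof -
  let ?G = "sym_group (m + r)" and ?S = "specht_module shape :: ('f, _, _) gmod"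
  let ?K = "rotations r"
  interpret G: group ?G by (rule sym_group_is_group)
  have finG: "finite (carrier ?G)" by (simp add: sym_group_def finite_permutations)
  have fgS: "fg_module ?G ?S" using specht_fg_module[of shape] by (simp add: sum_list_shape)
  interpret S: fg_module ?G ?S by (rule fgS)
  have r0: "0 < r" using p(2) by (rule odd_pos)
  have K: "subgroup ?K ?G" by (rule subgroup_rotations[OF r0]) simp
  have comm: "k \<circ> h = h \<circ> k" if "k \<in> ?K" "h \<in> H" for k h
    by (rule permutes_disjoint_commute[OF rotations_permutes[OF r0 that(1)] H(3)[OF that(2)]]) auto
  have KG: "k \<in> carrier ?G" if "k \<in> ?K" for k using that subgroup.subset[OF K] by auto
  have HG: "h \<in> carrier ?G" if "h \<in> H" for h using that subgroup.subset[OF H(1)] by auto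
  let ?t = standard_tableau
  note t = standard_tableau
  define v :: "tabloid \<Rightarrow> 'f" where "v = polytabloid shape ?t"
  define \<mu> :: "(tabloid \<Rightarrow> 'f) \<Rightarrow> 'f" where "\<mu> u = u (tabloid_of shape ?t)" for u
  have v: "v \<in> carrier ?S" unfolding v_def by (rule polytabloid_in_specht[OF t])
  have \<mu>K: "\<mu> (gact ?S k u) = \<mu> u" if "k \<in> ?K" "u \<in> carrier ?S" for k u
    using coefficient_permuting_leg[OF t _ that(2), of k] rotations_permutes[OF r0 that(1)]
      sign_rotation[OF p(2) that(1)]
    by (simp add: \<mu>_def leg_standard)
  have \<mu>H: "\<mu> (gact ?S h u) = \<mu> u" if h: "h \<in> H" for h u
    unfolding \<mu>_def
  proof (rule coefficient_fixing_leg[OF t])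
    show "h permutes {1..m + r}" using HG[OF h] by (simp add: sym_group_carrier)
    show "h x = x" if "x \<in> leg ?t" for x
      using permutes_not_in[OF H(3)[OF h], of x] that by (simp add: leg_standard)
  qed
  have vK: "gact ?S k v = v" if k: "k \<in> ?K" for k
  proof -
    have kc: "k permutes col ?t"
      using rotations_permutes[OF r0 k] by (rule permutes_subset) (auto simp: col_standard)
    show ?thesis
      unfolding v_def gact_specht_module polytabloid_act[OF permutes_col_imp[OF t kc] t]
        polytabloid_col_act[OF t kc] sign_rotation[OF p(2) k] by simp
  qed
  obtain \<theta> where \<theta>S: "\<And>C u. C \<in> lcosets\<^bsub>?G\<^esub> R \<Longrightarrow> u \<in> carrier ?S \<Longrightarrow> \<theta> C u \<in> carrier ?S"
    and \<theta>add: "\<And>C u u'. C \<in> lcosets\<^bsub>?G\<^esub> R \<Longrightarrow> u \<in> carrier ?S \<Longrightarrow> u' \<in> carrier ?S \<Longrightarrow>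
      \<theta> C (u + u') = \<theta> C u + \<theta> C u'"
    and \<theta>act: "\<And>g C u. g \<in> carrier ?G \<Longrightarrow> C \<in> lcosets\<^bsub>?G\<^esub> R \<Longrightarrow> u \<in> carrier ?S \<Longrightarrow>
      gact ?S g (\<theta> C u) = \<theta> (g <#\<^bsub>?G\<^esub> C) (gact ?S g u)"
    and \<theta>sum: "\<And>u. u \<in> carrier ?S \<Longrightarrow> (\<Sum>C\<in>lcosets\<^bsub>?G\<^esub> R. \<theta> C u) = u"
    by (rule summand_of_induced_trace[OF sym_group_is_group finG R(1) fgS R(2)]) (rule that)
  define X where "X = lcosets\<^bsub>?G\<^esub> R"
  define a where "a C = \<mu> (\<theta> C v)" for C
  have finX: "finite X" using finG by (simp add: X_def LCOSETS_def)
  have XP: "X \<subseteq> Pow (carrier ?G)" unfolding X_def by (rule G.lcosets_subset_PowG[OF R(1)])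
  have XG: "g <#\<^bsub>?G\<^esub> C \<in> X" if "g \<in> carrier ?G" "C \<in> X" for g C
    using that unfolding X_def by (intro G.lcosets_translate R(1))
  have aK: "a (k <#\<^bsub>?G\<^esub> C) = a C" if "k \<in> ?K" "C \<in> X" for k C
  proof -
    have "\<theta> (k <#\<^bsub>?G\<^esub> C) v = gact ?S k (\<theta> C v)"
      using that \<theta>act[OF KG[OF that(1)] _ v, of C] vK by (simp add: X_def)
    then show ?thesis using \<mu>K[OF that(1)] \<theta>S that(2) v by (simp add: a_def X_def)
  qed
  \<comment> \<open>\<open>H\<close> acts on these cosets because it commutes with
    \<open>K\<close>.\<close>
  define Y where "Y = {C \<in> X. \<forall>k\<in>?K. k <#\<^bsub>?G\<^esub> C = C}"
  have YX: "Y \<subseteq> X" by (auto simp: Y_def)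
  have YH: "h <#\<^bsub>?G\<^esub> C \<in> Y" if h: "h \<in> H" and C: "C \<in> Y" for h C
  proof -
    have CG: "C \<subseteq> carrier ?G" using C XP by (auto simp: Y_def)
    have "k <#\<^bsub>?G\<^esub> (h <#\<^bsub>?G\<^esub> C) = h <#\<^bsub>?G\<^esub> C" if k: "k \<in> ?K" for k
    proof -
      have "k <#\<^bsub>?G\<^esub> (h <#\<^bsub>?G\<^esub> C) = (h \<otimes>\<^bsub>?G\<^esub> k) <#\<^bsub>?G\<^esub> C"
        using G.lcos_m_assoc[OF CG KG[OF k] HG[OF h]] comm[OF k h] by (simp add: sym_group_mult)
      also have "\<dots> = h <#\<^bsub>?G\<^esub> (k <#\<^bsub>?G\<^esub> C)"
        using G.lcos_m_assoc[OF CG HG[OF h] KG[OF k]] by simp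
      finally show ?thesis using C k by (simp add: Y_def)
    qed
    then show ?thesis using XG HG[OF h] C by (simp add: Y_def)
  qed
  \<comment> \<open>For \<open>C\<close> fixed by \<open>K\<close> the map \<open>\<theta> C\<close>
    commutes with \<open>K\<close>. All \<open>r\<close> terms of the trace then have the same value
    under \<open>\<mu>\<close> after \<open>\<theta> C\<close>, and \<open>r\<close> is 0 in the
    field.\<close>
  have \<mu>\<theta>: "\<mu> (\<theta> C (gact ?S g v)) = \<mu> (\<theta> C v)" if C: "C \<in> Y" and g: "g \<in> H" for C g
  proof -
    obtain w where w: "w \<in> carrier ?S" and vw: "v = gact ?S g v + (\<Sum>j<r. gact ?S (rot r ^^ j) w)"
      unfolding v_def by (rule polytabloid_minus_translate_is_trace[OF char(2) p(2) H(3)[OF g]]) (rule that, unfold v_def)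
    have CX: "C \<in> lcosets\<^bsub>?G\<^esub> R" using C by (simp add: Y_def X_def)
    have k: "rot r ^^ j \<in> ?K" for j by (simp add: rotations_def)
    have kw: "gact ?S (rot r ^^ j) w \<in> carrier ?S" for j by (rule S.act_closed[OF KG[OF k] w])
    have \<theta>0: "\<theta> C 0 = 0" using \<theta>add[OF CX S.zero_mem S.zero_mem] by simp
    have "(\<Sum>j\<in>J. gact ?S (rot r ^^ j) w) \<in> carrier ?S \<and>
        \<mu> (\<theta> C (\<Sum>j\<in>J. gact ?S (rot r ^^ j) w)) = of_nat (card J) * \<mu> (\<theta> C w)" if "finite J" for J
      using that
    proof (induction J)
      case empty
      then show ?case unfolding sum.empty using S.zero_mem \<theta>0 by (simp add: \<mu>_def zero_fun_def)
    next
      case (insert j J)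
      let ?s = "\<Sum>j\<in>J. gact ?S (rot r ^^ j) w"
      have s: "?s \<in> carrier ?S" using insert by blast
      have "\<theta> C (gact ?S (rot r ^^ j) w) = gact ?S (rot r ^^ j) (\<theta> C w)"
        using \<theta>act[OF KG[OF k] CX w, of j] C k by (simp add: Y_def)
      then have "\<mu> (\<theta> C (gact ?S (rot r ^^ j) w)) = \<mu> (\<theta> C w)"
        using \<mu>K[OF k \<theta>S[OF CX w]] by simp
      then have "\<mu> (\<theta> C (gact ?S (rot r ^^ j) w + ?s)) = of_nat (card (insert j J)) * \<mu> (\<theta> C w)"
        unfolding \<theta>add[OF CX kw s] using insert by (simp add: \<mu>_def algebra_simps)
      then show ?case
        unfolding sum.insert[OF insert.hyps] using S.V.subspace_add[OF S.subspace_carrier kw s] by blast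
    qed
    from this[of "{..<r}"] have s: "(\<Sum>j<r. gact ?S (rot r ^^ j) w) \<in> carrier ?S"
      and z: "\<mu> (\<theta> C (\<Sum>j<r. gact ?S (rot r ^^ j) w)) = 0"
      using char(1) by auto
    have "\<theta> C v = \<theta> C (gact ?S g v) + \<theta> C (\<Sum>j<r. gact ?S (rot r ^^ j) w)"
      by (subst vw) (rule \<theta>add[OF CX S.act_closed[OF HG[OF g] v] s])
    then show ?thesis using z by (simp add: \<mu>_def)
  qed
  \<comment> \<open>Write \<open>\<theta> (h C) v\<close> as
    \<open>h (\<theta> C (inv h v))\<close>: the outer \<open>h\<close> is absorbed by
    \<open>\<mu>\<close>, the inner \<open>inv h\<close> by the preceding fact.\<close>
  have aH: "a (h <#\<^bsub>?G\<^esub> C) = a C" if h: "h \<in> H" and C: "C \<in> Y" for h C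
  proof -
    let ?h = "inv\<^bsub>?G\<^esub> h"
    have h': "?h \<in> H" using subgroup.m_inv_closed[OF H(1) h] .
    have CX: "C \<in> lcosets\<^bsub>?G\<^esub> R" using C by (simp add: Y_def X_def)
    have hv: "gact ?S ?h v \<in> carrier ?S" by (rule S.act_closed[OF HG[OF h'] v])
    have "gact ?S h (gact ?S ?h v) = v"
      using S.act_mult[OF HG[OF h] HG[OF h'] v] unfolding G.r_inv[OF HG[OF h]] S.act_one[OF v]
      by (rule sym)
    then have "\<theta> (h <#\<^bsub>?G\<^esub> C) v = gact ?S h (\<theta> C (gact ?S ?h v))"
      using \<theta>act[OF HG[OF h] CX hv] by simp
    then show ?thesis using \<mu>H[OF h] \<mu>\<theta>[OF C h'] by (simp add: a_def)
  qed
  have "1 = \<mu> v" unfolding \<mu>_def v_def by (simp add: polytabloid_self[OF t])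
  also have "\<dots> = sum a X"
    using fun_cong[OF \<theta>sum[OF v], of "tabloid_of shape ?t"] unfolding sum_fun_apply
    by (simp add: \<mu>_def a_def X_def)
  \<comment> \<open>The count for \<open>K\<close> must come first, as \<open>a\<close> is known to
    be invariant under \<open>H\<close> only on \<open>Y\<close>.\<close>
  also have "\<dots> = sum a Y"
    unfolding Y_def using aK XG KG XP finX p(1) card_rotations[OF r0] char(1)
    by (intro G.sum_eq_sum_translation_fixed[OF K, where k=1 and p=r]) auto
  also have "\<dots> = sum a {C \<in> Y. \<forall>h\<in>H. h <#\<^bsub>?G\<^esub> C = C}"
    using aH YH YX XP finX finite_subset[OF YX] p(1) H(2) char(1)
    by (intro G.sum_eq_sum_translation_fixed[OF H(1), where k=k and p=r]) auto
  finally have "{C \<in> Y. \<forall>h\<in>H. h <#\<^bsub>?G\<^esub> C = C} \<noteq> {}" by force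
  then obtain C where C: "C \<in> Y" "\<And>h. h \<in> H \<Longrightarrow> h <#\<^bsub>?G\<^esub> C = C" by blast
  show ?thesis
  proof (rule G.card_le_if_fixes_lcoset[OF finG _ R(1)])
    show "subgroup (?K <#>\<^bsub>?G\<^esub> H) ?G"
      using comm by (intro G.commuting_set_mult_subgroup K H(1)) (simp add: sym_group_mult)
    show "C \<in> lcosets\<^bsub>?G\<^esub> R" using C YX by (auto simp: X_def)
    fix q assume "q \<in> ?K <#>\<^bsub>?G\<^esub> H"
    then obtain k h where q: "q = k \<otimes>\<^bsub>?G\<^esub> h" "k \<in> ?K" "h \<in> H" by (auto simp: set_mult_def)
    have CG: "C \<subseteq> carrier ?G" using C XP by (auto simp: Y_def)
    show "q <#\<^bsub>?G\<^esub> C = C"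
      using G.lcos_m_assoc[OF CG KG[OF q(2)] HG[OF q(3)]] C q by (simp add: Y_def)
  qed
qed

end

theorem theorem1p2:
  fixes p k :: nat
  assumes "prime p" and "odd p"
    and "[k = 1] (mod p)" and "\<not> [k = 1] (mod p\<^sup>2)"
    and "CHAR('f::field) = p"
  shows "\<exists>P. sylow_subgroup p (sym_group (k * p)) P \<and>
    is_vertex (sym_group (k * p))
      (specht_module ((k * p - p) # replicate p 1) :: ('f, nat \<Rightarrow> nat, tabloid \<Rightarrow> 'f) gmod) P"
proof -
  let ?m = "k * p - p" and ?G = "sym_group (k * p)"
  let ?S = "specht_module ((k * p - p) # replicate p 1) :: ('f, nat \<Rightarrow> nat, tabloid \<Rightarrow> 'f) gmod"
  have p1: "1 < p" using assms(1) by (rule prime_gt_1_nat)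
  have pk: "\<not> p dvd k"
    using assms(3) p1 cong_dvd_iff[of k 1 p] by auto
  have k1: "1 < k"
  proof -
    have "k \<noteq> 0" using pk by (intro notI) simp
    \<comment> \<open>Together with \<open>k \<noteq> 0\<close> this makes the first row
      non-empty.\<close>
    moreover have "k \<noteq> 1" using assms(4) by auto
    ultimately show ?thesis by simp
  qed
  have n: "k * p = ?m + p" using k1 by simp
  interpret hook ?m p using k1 p1 by unfold_locales simp
  have shape: "shape = ?m # replicate p 1" by (rule shape_def)
  have sum: "sum_list shape = k * p" unfolding sum_list_shape using n by simp
  have char0: "of_nat p = (0 :: 'f)" using assms(5) by (metis of_nat_CHAR)
  have char2: "(2 :: 'f) \<noteq> 0"
  proof
    assume "(2 :: 'f) = 0"
    then have "of_nat 2 = (0 :: 'f)" by simp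
    then have "p dvd 2" using assms(5) by (simp only: of_nat_eq_0_iff_char_dvd)
    then show False using assms(2) p1 dvd_imp_le[of p 2] by (cases "p = 2") auto
  qed
  interpret G: group ?G by (rule sym_group_is_group)
  have finG: "finite (carrier ?G)" by (simp add: sym_group_def finite_permutations)
  have order: "order ?G = fact (k * p)" by (simp add: order_def sym_group_def card_permutations[OF refl])
  let ?A = "{Suc p..k * p}"
  let ?N = "{h. h permutes ?A}"
  have N: "subgroup ?N ?G"
  proof (rule G.subgroupI)
    have "h permutes {1..k * p}" if "h permutes ?A" for h using permutes_subset[OF that] by auto
    then show sub: "?N \<subseteq> carrier ?G" by (auto simp: sym_group_carrier)
    show "?N \<noteq> {}" using permutes_id by blast
    show "inv\<^bsub>?G\<^esub> h \<in> ?N" if "h \<in> ?N" for h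
      using sub that permutes_inv by (subst sym_group_inv_equality) auto
    show "h \<otimes>\<^bsub>?G\<^esub> h' \<in> ?N" if "h \<in> ?N" "h' \<in> ?N" for h h'
      using that by (auto simp: sym_group_mult intro: permutes_compose)
  qed
  define e where "e = multiplicity p (fact ?m :: nat)"
  obtain q where q: "(fact ?m :: nat) = p ^ e * q"
    using multiplicity_dvd[of p "fact ?m :: nat"] unfolding e_def dvd_def by blast
  have "order (?G\<lparr>carrier := ?N\<rparr>) = p ^ e * q"
    using q n by (simp add: order_def card_permutations[OF refl])
  \<comment> \<open>Sylow's theorem in the symmetric group on the points outside
    \<open>{1..p}\<close>, whose order is the factorial of \<open>?m\<close>.\<close>
  then obtain H where H: "subgroup H (?G\<lparr>carrier := ?N\<rparr>)" "card H = p ^ e"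
    using sylow_thm[OF assms(1) G.subgroup_imp_group[OF N]] finite_permutations[of ?A] by auto
  have HN: "h permutes ?A" if "h \<in> H" for h using that subgroup.subset[OF H(1)] by auto
  have HG: "subgroup H ?G" using G.incl_subgroup[OF N H(1)] .
  have p0: "0 < p" using p1 by simp
  let ?K = "rotations p"
  have K: "subgroup ?K ?G" using subgroup_rotations[OF p0] k1 by simp
  have comm: "x \<circ> h = h \<circ> x" if "x \<in> ?K" "h \<in> H" for x h
    by (rule permutes_disjoint_commute[OF rotations_permutes[OF p0 that(1)] HN[OF that(2)]]) auto
  define P where "P = ?K <#>\<^bsub>?G\<^esub> H"
  have P: "subgroup P ?G"
    unfolding P_def using comm by (intro G.commuting_set_mult_subgroup K HG) (simp add: sym_group_mult)
  have "x = id" if "x \<in> ?K" "x \<in> H" for x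
  proof
    fix y
    show "x y = id y"
      using permutes_not_in[OF rotations_permutes[OF p0 that(1)], of y] permutes_not_in[OF HN[OF that(2)], of y]
      by (cases "y \<in> {1..p}") auto
  qed
  then have int: "?K \<inter> H = {\<one>\<^bsub>?G\<^esub>}"
    using subgroup.one_closed[OF K] subgroup.one_closed[OF HG] by (auto simp: sym_group_one)
  \<comment> \<open>\<open>K\<close> supplies the one factor \<open>p\<close> by which the two
    factorials differ.\<close>
  have cardP: "card P = p ^ multiplicity p (order ?G)"
    unfolding P_def G.card_set_mult_trivial_Int[OF K HG int] order
    using H(2) card_rotations[OF p0] multiplicity_fact_step[OF assms(1) _ pk] k1 by (simp add: e_def)
  have finP: "finite P" using finite_subset[OF subgroup.subset[OF P] finG] .
  have "indecomposable ?G ?S"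
    using specht_indecomposable[OF char2 standard_tableau] unfolding sum unfolding shape .
  moreover have "summand_of_induced ?G P ?S"
  proof (rule summand_of_induced_if_index_invertible[OF sym_group_is_group finG P])
    show "fg_module ?G ?S" using specht_fg_module[of shape] unfolding sum unfolding shape .
    \<comment> \<open>A factor \<open>p\<close> in the index would give the order of the group one
      power of \<open>p\<close> too many.\<close>
    have "card (lcosets\<^bsub>?G\<^esub> P) * p ^ multiplicity p (order ?G) = order ?G"
      using G.l_lagrange[OF finG P] cardP by simp
    then have "p dvd card (lcosets\<^bsub>?G\<^esub> P) \<Longrightarrow> p ^ Suc (multiplicity p (order ?G)) dvd order ?G"
      by (metis mult_dvd_mono dvd_refl power_Suc)
    moreover have "\<not> p ^ Suc (multiplicity p (order ?G)) dvd order ?G"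
      using p1 by (subst power_dvd_iff_le_multiplicity) (auto simp: order)
    ultimately have "\<not> p dvd card (lcosets\<^bsub>?G\<^esub> P)" by blast
    then show "of_nat (card (lcosets\<^bsub>?G\<^esub> P)) \<noteq> (0 :: 'f)"
      using assms(5) by (simp add: of_nat_eq_0_iff_char_dvd)
  qed
  moreover have "\<not> summand_of_induced ?G R ?S" if R: "subgroup R ?G" "R \<subset> P" for R
  proof
    assume *: "summand_of_induced ?G R ?S"
    have "card (?K <#>\<^bsub>sym_group (?m + p)\<^esub> H) \<le> card R"
    proof (rule card_le_if_relatively_projective[OF assms(1,2) char0 char2])
      show "subgroup H (sym_group (?m + p))" "subgroup R (sym_group (?m + p))"
        unfolding n[symmetric] by (rule HG R(1))+
      show "summand_of_induced (sym_group (?m + p)) R (specht_module shape :: ('f, _, _) gmod)"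
        unfolding shape n[symmetric] by (rule *)
      show "h permutes {Suc p..?m + p}" if "h \<in> H" for h
        unfolding n[symmetric] by (rule HN[OF that])
    qed (use H(2) in auto)
    then have "card P \<le> card R" unfolding P_def n[symmetric] .
    moreover have "card R < card P" using R(2) finP by (rule psubset_card_mono[rotated])
    ultimately show False by simp
  qed
  ultimately have "is_vertex ?G ?S P" using P by (auto simp: is_vertex_def)
  moreover have "sylow_subgroup p ?G P" using P cardP by (simp add: sylow_subgroup_def)
  ultimately show ?thesis by blast
qed

end
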